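(* For each integer $n\ge 3$ there exists a nonpositive solution $Q_{n,0}=Q_{n,0}(t,z,\bar z)\le 0$ of the Novikov–Veselov equation at zero energy $$\partial_t v = 8(\partial_z^3+\partial_{\bar z}^3)v + 2\partial_z(vw)+2\partial_{\bar z}(v\bar w),\qquad \partial_{\bar z}w=-3\partial_z v,$$ decaying as $|z|^{-2(n+1)}$ when $|z|\to\infty$, such that $\int_{\mathbb{R}^2} Q_{n,0}\,dx\,dy=-8n\pi$, and such that $Q_{n,0}$ is globally well-defined (for all $t\in\mathbb{R}$) but blows up in infinite time: $\|Q_{n,0}(t)\|_{L^2(\mathbb{R}^2)}\to+\infty$ as $t\to\pm\infty$.
   Context: Here $z=x+iy$, $\bar z=x-iy$, $\partial_z=\frac12(\partial_x-i\partial_y)$, $\partial_{\bar z}=\frac12(\partial_x+i\partial_y)$; $v=v(t,x,y)$ is real-valued and $w=w(t,x,y)$ is complex-valued, given by $w=-3\partial_{\bar z}^{-1}\partial_z v$, where $\partial_{\bar z}^{-1}\partial_z$ is the Fourier multiplier on $L^2(\mathbb{R}^2)$ with symbol $\frac{\xi_1-i\xi_2}{\xi_1+i\xi_2}$. The integral of $Q_{n,0}$ and the spatial decay are at each fixed time $t$. *)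

theory Defs
  imports "HOL-Analysis.Analysis" "HOL-Library.Landau_Symbols"
begin

text \<open>The plane \<open>\<real>\<^sup>2\<close>, in the physical as well as in the frequency variable, is identified with
  the type \<^typ>\<open>complex\<close>: the point \<open>(x, y)\<close> is \<open>z = x + \<i>y\<close>, the frequency
  \<open>(\<xi>\<^sub>1, \<xi>\<^sub>2)\<close> is \<open>\<xi>\<^sub>1 + \<i>\<xi>\<^sub>2\<close>, the measure \<open>lborel\<close> on \<^typ>\<open>complex\<close> is \<open>dx dy\<close>, and
  \<open>z \<bullet> \<xi>\<close> is the real inner product \<open>x\<xi>\<^sub>1 + y\<xi>\<^sub>2\<close>.\<close>

section \<open>Functions of class \<open>C\<^sup>k\<close> and Wirtinger derivatives\<close>

fun C_k :: "nat \<Rightarrow> ('a::euclidean_space \<Rightarrow> 'b::real_normed_vector) \<Rightarrow> bool" where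
  "C_k 0 f \<longleftrightarrow> continuous_on UNIV f"
| "C_k (Suc k) f \<longleftrightarrow>
     (\<exists>f'. (\<forall>x. (f has_derivative f' x) (at x)) \<and> (\<forall>b\<in>Basis. C_k k (\<lambda>x. f' x b)))"

definition partial_x :: "(complex \<Rightarrow> complex) \<Rightarrow> complex \<Rightarrow> complex" where
  "partial_x f z = vector_derivative (\<lambda>x. f (Complex x (Im z))) (at (Re z))"

definition partial_y :: "(complex \<Rightarrow> complex) \<Rightarrow> complex \<Rightarrow> complex" where
  "partial_y f z = vector_derivative (\<lambda>y. f (Complex (Re z) y)) (at (Im z))"

definition d_z :: "(complex \<Rightarrow> complex) \<Rightarrow> complex \<Rightarrow> complex" where
  "d_z f z = (partial_x f z - \<i> * partial_y f z) / 2"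

definition d_zbar :: "(complex \<Rightarrow> complex) \<Rightarrow> complex \<Rightarrow> complex" where
  "d_zbar f z = (partial_x f z + \<i> * partial_y f z) / 2"

section \<open>Square integrable functions and Fourier multipliers on \<open>L\<^sup>2(\<real>\<^sup>2)\<close>\<close>

definition square_integrable :: "(complex \<Rightarrow> 'b::{real_normed_vector}) \<Rightarrow> bool" where
  "square_integrable f \<longleftrightarrow>
     f \<in> borel_measurable lborel \<and> integrable lborel (\<lambda>z. (norm (f z))\<^sup>2)"

text \<open>Only meaningful for square integrable functions: otherwise the Bochner integral is 0.\<close>

definition L2_norm_plane :: "(complex \<Rightarrow> 'b::{real_normed_vector}) \<Rightarrow> real" where
  "L2_norm_plane f = sqrt (LINT z|lborel. (norm (f z))\<^sup>2)"

definition fourier_integral :: "(complex \<Rightarrow> complex) \<Rightarrow> complex \<Rightarrow> complex" where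
  "fourier_integral f \<xi> = (LINT z|lborel. cis (- (z \<bullet> \<xi>)) * f z)"

text \<open>\<open>F\<close> is (a representative of) the Fourier--Plancherel transform of \<open>f \<in> L\<^sup>2\<close>: the limit in
  \<open>L\<^sup>2\<close>, as \<open>R \<rightarrow> \<infinity>\<close>, of the Fourier integrals of \<open>f\<close> truncated to the discs \<open>|z| \<le> R\<close>.
  The truncations are in \<open>L\<^sup>1\<close>, so that these integrals converge absolutely. The distance is
  taken as an extended nonnegative integral in order that it cannot vanish by convention.\<close>

definition has_L2_fourier :: "(complex \<Rightarrow> complex) \<Rightarrow> (complex \<Rightarrow> complex) \<Rightarrow> bool" where
  "has_L2_fourier f F \<longleftrightarrow> square_integrable f \<and> square_integrable F \<and>
     ((\<lambda>R::real. \<integral>\<^sup>+ \<xi>. ennreal ((norm (F \<xi>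
          - fourier_integral (\<lambda>z. indicator (cball 0 R) z *\<^sub>R f z) \<xi>))\<^sup>2) \<partial>lborel)
        \<longlongrightarrow> 0) at_top"

text \<open>\<open>g\<close> is the image of \<open>f \<in> L\<^sup>2\<close> under the Fourier multiplier with symbol \<open>m\<close>; this determines
  \<open>g\<close> up to a null set.\<close>

definition is_fourier_multiplier ::
    "(complex \<Rightarrow> complex) \<Rightarrow> (complex \<Rightarrow> complex) \<Rightarrow> (complex \<Rightarrow> complex) \<Rightarrow> bool" where
  "is_fourier_multiplier m f g \<longleftrightarrow>
     (\<exists>F. has_L2_fourier f F \<and> has_L2_fourier g (\<lambda>\<xi>. m \<xi> * F \<xi>))"

text \<open>The symbol \<open>(\<xi>\<^sub>1 - \<i>\<xi>\<^sub>2) / (\<xi>\<^sub>1 + \<i>\<xi>\<^sub>2)\<close> of \<open>\<partial>\<^bsub>zbar\<^esub>\<inverse> \<partial>\<^bsub>z\<^esub>\<close>.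
  Its value at the origin (0 in HOL) is immaterial.\<close>

definition beurling_symbol :: "complex \<Rightarrow> complex" where
  "beurling_symbol \<xi> = (of_real (Re \<xi>) - \<i> * of_real (Im \<xi>)) / (of_real (Re \<xi>) + \<i> * of_real (Im \<xi>))"

section \<open>The Novikov--Veselov equation at zero energy\<close>

text \<open>Classical solutions, defined for all \<open>t \<in> \<real>\<close>. The regularity makes every derivative below
  exist and be continuous. The third clause is \<open>w = -3 \<partial>\<^bsub>zbar\<^esub>\<inverse> \<partial>\<^bsub>z\<^esub> v\<close>;
  it contains the requirement that \<open>v(t)\<close> and \<open>w(t)\<close> belong to \<open>L\<^sup>2(\<real>\<^sup>2)\<close>.\<close>

definition NV_solution ::
    "(real \<Rightarrow> complex \<Rightarrow> real) \<Rightarrow> (real \<Rightarrow> complex \<Rightarrow> complex) \<Rightarrow> bool" where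
  "NV_solution v w \<longleftrightarrow>
     C_k 3 (\<lambda>(t, z). v t z) \<and> C_k 1 (\<lambda>(t, z). w t z) \<and>
     (\<forall>t. is_fourier_multiplier (\<lambda>\<xi>. - 3 * beurling_symbol \<xi>) (\<lambda>z. of_real (v t z)) (w t)) \<and>
     (\<forall>t z. let V = (\<lambda>z. complex_of_real (v t z)); W = w t in
        ((\<lambda>s. complex_of_real (v s z)) has_vector_derivative
           (8 * (d_z (d_z (d_z V)) z + d_zbar (d_zbar (d_zbar V)) z)
            + 2 * d_z (\<lambda>\<zeta>. V \<zeta> * W \<zeta>) z
            + 2 * d_zbar (\<lambda>\<zeta>. V \<zeta> * cnj (W \<zeta>)) z)) (at t) \<and>
        d_zbar W z = - 3 * d_z V z)"

end

theory Submission
  imports Defs "HOL-Probability.Probability" "HOL-Computational_Algebra.Fundamental_Theorem_Algebra"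
begin

text \<open>
  Let \<open>f(t, \<cdot>)\<close> be the polynomial solution \<open>\<Sum>\<^sub>k (8t)\<^sup>k / k! \<cdot> z\<^bsup>n-3k\<^esup> / (n-3k)!\<close> of \<open>\<partial>\<^sub>t f = 8 \<partial>\<^sub>z\<^sup>3 f\<close>,
  and put \<open>\<tau> = 1 + |f|\<^sup>2\<close>, \<open>\<phi> = \<partial>\<^sub>z log \<tau>\<close>, \<open>Q = - 8 \<partial>\<^bsub>zbar\<^esub> \<phi> = - 8 |\<partial>\<^sub>z f|\<^sup>2 / \<tau>\<^sup>2\<close>, \<open>W = 24 \<partial>\<^sub>z \<phi>\<close>.
  Since \<open>4 \<partial>\<^sub>z\<^sup>2 Q + Q W = - 32 (\<partial>\<^sub>z\<^sup>3 f) (cnj (\<partial>\<^sub>z f)) / \<tau>\<^sup>2\<close>, the equation for \<open>Q\<close> reduces to the linear equation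
  for \<open>f\<close>. The integral of \<open>Q\<close> is the flux of \<open>\<phi>\<close> at infinity, where \<open>z \<phi> \<rightarrow> n\<close>. In the scaling
  \<open>z = s \<zeta>\<close>, \<open>8t = s\<^sup>3\<close>, one has \<open>f(t, z) = s\<^sup>n P(\<zeta>)\<close> with a fixed polynomial \<open>P\<close>, which is not an \<open>n\<close>-th
  power; near a zero of \<open>P\<close> of order \<open>m < n\<close> the potential \<open>Q\<close> concentrates in a disc of radius
  proportional to \<open>|s|\<^bsup>1-n/m\<^esup> \<rightarrow> 0\<close>, and its \<open>L\<^sup>2\<close> norm there is of the order of the inverse of this radius.
\<close>

section \<open>Functions of class \<open>C\<^sup>k\<close>\<close>

text \<open>With \<open>Q\<close> equal to -8 times the zbar-derivative of \<open>phi\<close>, the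
  constraint on \<open>W\<close> is the symmetry of the mixed derivatives of \<open>phi\<close>;
  this fixes the factor 24. The harder clause is that \<open>W\<close> is the multiplier image of
  \<open>Q\<close>, not just some solution of the constraint. On the Fourier side both are
  derivatives of \<open>phi\<close>, with symbols whose quotient is the Beurling symbol. But
  \<open>phi\<close> is of order 1/|z| and \<open>W\<close> of order 1/|z|^2, neither integrable, so
  the relation is proved for Gaussian cutoffs of \<open>phi\<close> and carried to the limit in L^2
  by a Plancherel inequality. The same cutoff identity at frequency 0 gives the integral of
  \<open>Q\<close>. The bound n >= 3 is where \<open>f\<close> begins to depend on time: below it
  the sum has only the term k = 0. The leading term of \<open>f\<close> never changes, so degree,
  decay rate and integral are the same at all times, and the L^2 norm can grow only by
  concentration: size r^(-2) on a disc of area r^2 gives norm of order 1/r. The parameter s is real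
  of either sign, so one estimate serves both ends of the time axis.\<close>

lemma C_k_SucE:
  assumes "C_k (Suc k) f"
  obtains f' where "\<And>x. (f has_derivative f' x) (at x)" "\<And>b. b \<in> Basis \<Longrightarrow> C_k k (\<lambda>x. f' x b)"
  using assms by auto

lemma C_k_SucI:
  assumes "\<And>x. (f has_derivative f' x) (at x)" "\<And>b. b \<in> Basis \<Longrightarrow> C_k k (\<lambda>x. f' x b)"
  shows "C_k (Suc k) f"
  using assms by auto

text \<open>The product and quotient rules leave some factors undifferentiated; the inductions below
  need those factors at the lower order.\<close>

lemma C_k_SucD: "C_k (Suc k) f \<Longrightarrow> C_k k f"
proof (induction k arbitrary: f)
  case 0
  then obtain f' where "\<And>x. (f has_derivative f' x) (at x)" by (rule C_k_SucE) blast
  then show ?case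
    by (auto intro!: continuous_at_imp_continuous_on has_derivative_continuous)
next
  case (Suc k)
  from Suc.prems obtain f' where f': "\<And>x. (f has_derivative f' x) (at x)"
    "\<And>b. b \<in> Basis \<Longrightarrow> C_k (Suc k) (\<lambda>x. f' x b)"
    by (rule C_k_SucE) blast
  show ?case using f'(1) Suc.IH[OF f'(2)] by (rule C_k_SucI)
qed

lemma C_k_const: "C_k k (\<lambda>x. c)"
proof (induction k arbitrary: c)
  case (Suc k)
  have "((\<lambda>x. c) has_derivative (\<lambda>h. 0)) (at x)" for x :: 'a by simp
  then show ?case using Suc by (rule C_k_SucI)
qed simp

lemma C_k_linear:
  assumes "bounded_linear L"
  shows "C_k k L"
proof (cases k)
  case 0
  then show ?thesis
    using assms by (simp add: linear_continuous_on)
next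
  case (Suc m)
  then show ?thesis
    using C_k_const bounded_linear_imp_has_derivative[OF assms] by fastforce
qed

lemma C_k_compose_linear:
  assumes L: "bounded_linear L"
  shows "C_k k f \<Longrightarrow> C_k k (\<lambda>x. L (f x))"
proof (induction k arbitrary: f)
  case 0
  then show ?case using bounded_linear.continuous_on[OF L] by simp
next
  case (Suc k)
  from Suc.prems obtain f' where f': "\<And>x. (f has_derivative f' x) (at x)"
    "\<And>b. b \<in> Basis \<Longrightarrow> C_k k (\<lambda>x. f' x b)" by (rule C_k_SucE) blast
  have "((\<lambda>x. L (f x)) has_derivative (\<lambda>h. L (f' x h))) (at x)" for x
    by (rule bounded_linear.has_derivative[OF L f'(1)])
  then show ?case using Suc.IH[OF f'(2)] by (rule C_k_SucI)
qed

lemma C_k_add: "C_k k f \<Longrightarrow> C_k k g \<Longrightarrow> C_k k (\<lambda>x. f x + g x)"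
proof (induction k arbitrary: f g)
  case 0
  then show ?case by (simp add: continuous_on_add)
next
  case (Suc k)
  from Suc.prems(1) obtain f' where
    f': "\<And>x. (f has_derivative f' x) (at x)" "\<And>b. b \<in> Basis \<Longrightarrow> C_k k (\<lambda>x. f' x b)"
    by (rule C_k_SucE) blast
  from Suc.prems(2) obtain g' where
    g': "\<And>x. (g has_derivative g' x) (at x)" "\<And>b. b \<in> Basis \<Longrightarrow> C_k k (\<lambda>x. g' x b)"
    by (rule C_k_SucE) blast
  have "((\<lambda>x. f x + g x) has_derivative (\<lambda>h. f' x h + g' x h)) (at x)" for x
    by (intro derivative_intros f' g')
  then show ?case using Suc.IH[OF f'(2) g'(2)] by (rule C_k_SucI)
qed

lemma C_k_mult:
  fixes f g :: "'a::euclidean_space \<Rightarrow> 'b::real_normed_algebra"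
  shows "C_k k f \<Longrightarrow> C_k k g \<Longrightarrow> C_k k (\<lambda>x. f x * g x)"
proof (induction k arbitrary: f g)
  case 0
  then show ?case by (simp add: continuous_on_mult)
next
  case (Suc k)
  from Suc.prems(1) obtain f' where
    f': "\<And>x. (f has_derivative f' x) (at x)" "\<And>b. b \<in> Basis \<Longrightarrow> C_k k (\<lambda>x. f' x b)"
    by (rule C_k_SucE) blast
  from Suc.prems(2) obtain g' where
    g': "\<And>x. (g has_derivative g' x) (at x)" "\<And>b. b \<in> Basis \<Longrightarrow> C_k k (\<lambda>x. g' x b)"
    by (rule C_k_SucE) blast
  have "((\<lambda>x. f x * g x) has_derivative (\<lambda>h. f x * g' x h + f' x h * g x)) (at x)" for x
    by (intro derivative_intros f' g')
  moreover have "C_k k (\<lambda>x. f x * g' x b + f' x b * g x)" if "b \<in> Basis" for b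
    using that by (intro C_k_add Suc.IH C_k_SucD[OF Suc.prems(1)] C_k_SucD[OF Suc.prems(2)] f' g')
  ultimately show ?case by (rule C_k_SucI)
qed

lemma C_k_inverse:
  fixes f :: "'a::euclidean_space \<Rightarrow> 'b::real_normed_div_algebra"
  assumes nz: "\<And>x. f x \<noteq> 0"
  shows "C_k k f \<Longrightarrow> C_k k (\<lambda>x. inverse (f x))"
proof (induction k)
  case 0
  then show ?case using nz by (auto intro!: continuous_intros)
next
  case (Suc k)
  from Suc.prems obtain f' where
    f': "\<And>x. (f has_derivative f' x) (at x)" "\<And>b. b \<in> Basis \<Longrightarrow> C_k k (\<lambda>x. f' x b)"
    by (rule C_k_SucE) blast
  have "((\<lambda>x. inverse (f x)) has_derivative (\<lambda>h. - (inverse (f x) * f' x h * inverse (f x)))) (at x)" for x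
    by (intro Deriv.has_derivative_inverse nz f')
  moreover have "C_k k (\<lambda>x. - (inverse (f x) * f' x b * inverse (f x)))" if "b \<in> Basis" for b
    using that
    by (intro C_k_compose_linear[OF bounded_linear_minus[OF bounded_linear_ident]] C_k_mult
        Suc.IH C_k_SucD[OF Suc.prems] f')
  ultimately show ?case by (rule C_k_SucI)
qed

lemma C_k_power:
  fixes f :: "'a::euclidean_space \<Rightarrow> 'b::real_normed_algebra_1"
  shows "C_k k f \<Longrightarrow> C_k k (\<lambda>x. f x ^ m)"
  by (induction m) (auto intro: C_k_const C_k_mult)

lemma C_k_sum: "(\<And>i. i \<in> I \<Longrightarrow> C_k k (f i)) \<Longrightarrow> C_k k (\<lambda>x. \<Sum>i\<in>I. f i x)"
proof (induction I rule: infinite_finite_induct)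
  case (insert i I)
  then show ?case by (auto intro: C_k_add)
qed (auto intro: C_k_const)

lemma C_k_poly:
  fixes g :: "'a::euclidean_space \<Rightarrow> 'b::{real_normed_algebra_1,comm_ring_1}"
  assumes "C_k k g"
  shows "C_k k (\<lambda>x. poly q (g x))"
  by (induction q) (simp_all add: C_k_const C_k_add C_k_mult assms)

section \<open>Wirtinger derivatives\<close>

text \<open>Every real-linear map of the plane is \<open>h \<mapsto> a * h + b * cnj h\<close> for a
  unique pair \<open>a\<close>, \<open>b\<close>. Keeping the pair inside a full derivative lets the
  Leibniz and chain rules act on both components at once; \<open>d_z\<close> and
  \<open>d_zbar\<close>, which see only lines parallel to the axes, are read off at the end.\<close>

definition has_wirtinger :: "(complex \<Rightarrow> complex) \<Rightarrow> complex \<Rightarrow> complex \<Rightarrow> complex \<Rightarrow> bool" where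
  "has_wirtinger f a b z \<longleftrightarrow> (f has_derivative (\<lambda>h. a * h + b * cnj h)) (at z)"

lemma has_wirtinger_partial:
  assumes "has_wirtinger f a b z"
  shows "partial_x f z = a + b" "partial_y f z = \<i> * (a - b)"
proof -
  have f: "(f has_derivative (\<lambda>h. a * h + b * cnj h)) (at z)"
    using assms by (simp add: has_wirtinger_def)
  have cx: "((\<lambda>x. Complex x (Im z)) has_derivative of_real) (at (Re z))"
    by (simp add: Complex_eq) (auto intro!: derivative_eq_intros)
  have cy: "((\<lambda>y. Complex (Re z) y) has_derivative (\<lambda>h. \<i> * of_real h)) (at (Im z))"
    by (simp add: Complex_eq) (auto intro!: derivative_eq_intros)
  have "((\<lambda>x. f (Complex x (Im z))) has_vector_derivative (a + b)) (at (Re z))"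
    unfolding has_vector_derivative_def
    by (rule has_derivative_eq_rhs[OF has_derivative_compose[OF cx]])
      (use f in \<open>auto simp: fun_eq_iff scaleR_conv_of_real algebra_simps\<close>)
  then show "partial_x f z = a + b"
    by (simp add: partial_x_def vector_derivative_at)
  have "((\<lambda>y. f (Complex (Re z) y)) has_vector_derivative (\<i> * (a - b))) (at (Im z))"
    unfolding has_vector_derivative_def
    by (rule has_derivative_eq_rhs[OF has_derivative_compose[OF cy]])
      (use f in \<open>auto simp: fun_eq_iff scaleR_conv_of_real algebra_simps\<close>)
  then show "partial_y f z = \<i> * (a - b)"
    by (simp add: partial_y_def vector_derivative_at)
qed

lemma has_wirtinger_d_z: "has_wirtinger f a b z \<Longrightarrow> d_z f z = a"
  and has_wirtinger_d_zbar: "has_wirtinger f a b z \<Longrightarrow> d_zbar f z = b"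
  unfolding d_z_def d_zbar_def
  by (simp_all add: has_wirtinger_partial flip: mult.assoc)

lemma has_wirtinger_continuous: "has_wirtinger f a b z \<Longrightarrow> isCont f z"
  unfolding has_wirtinger_def by (rule has_derivative_continuous)

lemma has_wirtinger_holomorphic:
  "(f has_field_derivative a) (at z) \<Longrightarrow> has_wirtinger f a 0 z"
  by (simp add: has_wirtinger_def has_field_derivative_def)

lemma has_wirtinger_const: "has_wirtinger (\<lambda>z. c) 0 0 z"
  by (simp add: has_wirtinger_def)

lemma has_wirtinger_cnj:
  assumes "has_wirtinger f a b z"
  shows "has_wirtinger (\<lambda>z. cnj (f z)) (cnj b) (cnj a) z"
  unfolding has_wirtinger_def
  by (rule has_derivative_eq_rhs, rule bounded_linear.has_derivative[OF bounded_linear_cnj])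
    (use assms in \<open>auto simp: has_wirtinger_def fun_eq_iff algebra_simps\<close>)

lemma has_wirtinger_add:
  assumes "has_wirtinger f a b z" "has_wirtinger g c d z"
  shows "has_wirtinger (\<lambda>z. f z + g z) (a + c) (b + d) z"
  unfolding has_wirtinger_def
  by (rule has_derivative_eq_rhs, rule has_derivative_add)
    (use assms in \<open>auto simp: has_wirtinger_def fun_eq_iff algebra_simps\<close>)

lemma has_wirtinger_mult:
  assumes "has_wirtinger f a b z" "has_wirtinger g c d z"
  shows "has_wirtinger (\<lambda>z. f z * g z) (a * g z + f z * c) (b * g z + f z * d) z"
  unfolding has_wirtinger_def
  by (rule has_derivative_eq_rhs, rule has_derivative_mult)
    (use assms in \<open>auto simp: has_wirtinger_def fun_eq_iff algebra_simps\<close>)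

lemma has_wirtinger_cmult:
  assumes "has_wirtinger f a b z"
  shows "has_wirtinger (\<lambda>z. c * f z) (c * a) (c * b) z"
  using has_wirtinger_mult[OF has_wirtinger_const assms, of c] by simp

lemma has_wirtinger_inverse:
  assumes "has_wirtinger f a b z" "f z \<noteq> 0"
  shows "has_wirtinger (\<lambda>z. inverse (f z)) (- a / (f z)\<^sup>2) (- b / (f z)\<^sup>2) z"
  unfolding has_wirtinger_def
  by (rule has_derivative_eq_rhs, rule Deriv.has_derivative_inverse)
    (use assms in \<open>auto simp: has_wirtinger_def fun_eq_iff field_simps power2_eq_square\<close>)

lemma has_wirtinger_cong: "has_wirtinger f a b z \<Longrightarrow> a = a' \<Longrightarrow> b = b' \<Longrightarrow> has_wirtinger f a' b' z"
  by simp

section \<open>Integration over the plane\<close>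

lemma measurable_Complex [measurable]: "case_prod Complex \<in> borel_measurable (borel \<Otimes>\<^sub>M borel)"
proof -
  have "(\<lambda>p. of_real (fst p) + \<i> * of_real (snd p)) \<in> borel_measurable (borel \<Otimes>\<^sub>M borel)"
    by measurable
  moreover have "case_prod Complex = (\<lambda>p. of_real (fst p) + \<i> * of_real (snd p))"
    by (auto simp: fun_eq_iff complex_eq_iff)
  ultimately show ?thesis by simp
qed

text \<open>Lebesgue measure is determined by its values on boxes, and a box pulls back to a product
  of intervals. This makes Fubini in the coordinates x, y available on the type
  \<open>complex\<close>.\<close>

lemma lborel_complex: "distr (lborel \<Otimes>\<^sub>M lborel) borel (case_prod Complex) = lborel"
proof (rule lborel_eqI[symmetric])
  fix l u :: complex
  assume le: "\<And>b. b \<in> Basis \<Longrightarrow> l \<bullet> b \<le> u \<bullet> b"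
  have le': "Re l \<le> Re u" "Im l \<le> Im u"
    using le[of 1] le[of \<i>] by (auto simp: Basis_complex_def)
  have "case_prod Complex -` box l u \<inter> space (lborel \<Otimes>\<^sub>M lborel)
      = {Re l<..<Re u} \<times> {Im l<..<Im u}"
    by (auto simp: box_def Basis_complex_def space_pair_measure)
  moreover have "emeasure (lborel \<Otimes>\<^sub>M lborel) ({Re l<..<Re u} \<times> {Im l<..<Im u})
      = ennreal (Re u - Re l) * ennreal (Im u - Im l)"
    using le' by (subst lborel.emeasure_pair_measure_Times) auto
  ultimately show "emeasure (distr (lborel \<Otimes>\<^sub>M lborel) borel (case_prod Complex)) (box l u)
      = (\<Prod>b\<in>Basis. (u - l) \<bullet> b)"
    using le' by (subst emeasure_distr) (auto simp: Basis_complex_def ennreal_mult)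
qed simp

lemma has_bochner_integral_complex_product:
  fixes f g :: "real \<Rightarrow> complex"
  assumes f: "integrable lborel f" and g: "integrable lborel g"
  shows "has_bochner_integral lborel (\<lambda>z. f (Re z) * g (Im z)) ((LINT x|lborel. f x) * (LINT y|lborel. g y))"
proof -
  have [measurable]: "f \<in> borel_measurable borel" "g \<in> borel_measurable borel"
    using f g by auto
  have int: "integrable (lborel \<Otimes>\<^sub>M lborel) (\<lambda>p. f (fst p) * g (snd p))"
    by (rule lborel_pair.Fubini_integrable)
      (use f g in \<open>auto simp: norm_mult intro!: integrable_mult_right integrable_mult_left integrable_norm\<close>)
  have "(\<integral>p. f (fst p) * g (snd p) \<partial>(lborel \<Otimes>\<^sub>M lborel)) = (LINT x|lborel. f x) * (LINT y|lborel. g y)"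
    using lborel_pair.integral_fst'[OF int] by simp
  then have "has_bochner_integral (lborel \<Otimes>\<^sub>M lborel) (\<lambda>p. f (fst p) * g (snd p))
      ((LINT x|lborel. f x) * (LINT y|lborel. g y))"
    using int by (simp add: has_bochner_integral_iff)
  then have "has_bochner_integral (distr (lborel \<Otimes>\<^sub>M lborel) borel (case_prod Complex))
      (\<lambda>z. f (Re z) * g (Im z)) ((LINT x|lborel. f x) * (LINT y|lborel. g y))"
    by (subst has_bochner_integral_distr) (auto simp: case_prod_beta)
  then show ?thesis by (simp add: lborel_complex)
qed

section \<open>An integrable weight on the plane\<close>

lemma one_plus_cmod_sq [simp]: "1 + (cmod z)\<^sup>2 > 0" "1 + (cmod z)\<^sup>2 \<noteq> 0"
  using zero_le_power2[of "cmod z"] by linarith+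

text \<open>The common majorant of the development: fields below \<open>decay\<close> are
  integrable, and fields below its square root, the rate of \<open>W\<close>, are square
  integrable.\<close>

definition decay :: "complex \<Rightarrow> real" where
  "decay z = 1 / (1 + (cmod z)\<^sup>2)\<^sup>2"

lemma decay_pos [simp]: "decay z > 0" "decay z \<ge> 0"
  by (simp_all add: decay_def zero_less_power add_pos_nonneg)

lemma continuous_on_decay: "continuous_on A decay"
  unfolding decay_def by (intro continuous_intros) simp

lemma borel_measurable_decay [measurable]: "decay \<in> borel_measurable borel"
  by (intro borel_measurable_continuous_onI continuous_on_decay)

lemma integrable_decay: "integrable lborel decay"
proof -
  have "integrable lborel (\<lambda>x::real. inverse (1 + x\<^sup>2))"
    using integrable_inverse_1_plus_square by (simp add: set_integrable_def)
  then have "integrable lborel (\<lambda>x::real. complex_of_real (inverse (1 + x\<^sup>2)))"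
    by (rule integrable_of_real)
  then have "integrable lborel
      (\<lambda>z. complex_of_real (inverse (1 + (Re z)\<^sup>2)) * complex_of_real (inverse (1 + (Im z)\<^sup>2)))"
    using has_bochner_integral_complex_product by (auto simp: has_bochner_integral_iff)
  then show ?thesis
  proof (rule Bochner_Integration.integrable_bound, goal_cases)
    case 2
    show ?case
    proof (rule AE_I2)
      fix z
      have a: "1 \<le> 1 + (Re z)\<^sup>2" "1 \<le> 1 + (Im z)\<^sup>2" by simp_all
      \<comment> \<open>A product of two one-dimensional Cauchy weights majorizes
        \<open>decay\<close>, because each factor of its denominator is at most 1 + |z|^2.\<close>
      have "(1 + (Re z)\<^sup>2) * (1 + (Im z)\<^sup>2) \<le> (1 + (cmod z)\<^sup>2) * (1 + (cmod z)\<^sup>2)"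
        by (intro mult_mono) (auto simp: cmod_power2)
      then have "decay z \<le> inverse (1 + (Re z)\<^sup>2) * inverse (1 + (Im z)\<^sup>2)"
        unfolding decay_def inverse_mult_distrib[symmetric]
        using a by (auto simp: inverse_eq_divide power2_eq_square[of "1 + (cmod z)\<^sup>2"] intro!: divide_left_mono mult_pos_pos add_pos_nonneg)
      then show "norm (decay z) \<le> norm (complex_of_real (inverse (1 + (Re z)\<^sup>2)) * complex_of_real (inverse (1 + (Im z)\<^sup>2)))"
        by (simp add: norm_mult flip: of_real_mult del: of_real_inverse of_real_add of_real_power)
    qed
  qed simp
qed

lemma integrable_decay_bound:
  fixes f :: "complex \<Rightarrow> 'b::{banach, second_countable_topology}"
  assumes "f \<in> borel_measurable borel" "\<And>z. norm (f z) \<le> C * decay z"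
  shows "integrable lborel f"
proof (rule Bochner_Integration.integrable_bound)
  show "integrable lborel (\<lambda>z. C * decay z)" by (intro integrable_mult_right integrable_decay)
  show "AE z in lborel. norm (f z) \<le> norm (C * decay z)"
    using assms(2) by (auto intro: order_trans[OF _ abs_ge_self])
qed (use assms in simp)

text \<open>Read off from the characteristic function of the standard normal distribution, after
  clearing its normalizing constant.\<close>

lemma gaussian_1d:
  "has_bochner_integral lborel (\<lambda>x. cis (- (x * t)) * of_real (exp (- x\<^sup>2 / 2)))
     (of_real (sqrt (2 * pi) * exp (- t\<^sup>2 / 2)))"
proof -
  interpret N: prob_space std_normal_distribution
    by (rule prob_space_normal_density) simp
  have "char std_normal_distribution (-t) = (LINT x|lborel. std_normal_density x *\<^sub>R iexp (-t * x))"
    unfolding char_def by (subst integral_density) (auto simp: std_normal_density_def)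
  also have "\<dots> = (LINT x|lborel. of_real (1 / sqrt (2 * pi)) * (cis (- (x * t)) * of_real (exp (- x\<^sup>2 / 2))))"
    by (intro Bochner_Integration.integral_cong)
      (auto simp: std_normal_density_def scaleR_conv_of_real cis_conv_exp mult_ac)
  also have "\<dots> = of_real (1 / sqrt (2 * pi)) * (LINT x|lborel. cis (- (x * t)) * of_real (exp (- x\<^sup>2 / 2)))"
    by (rule integral_mult_right_zero)
  finally have "(LINT x|lborel. cis (- (x * t)) * of_real (exp (- x\<^sup>2 / 2)))
      = of_real (sqrt (2 * pi) * exp (- t\<^sup>2 / 2))"
    by (simp add: char_std_normal_distribution field_simps)
  moreover have "integrable lborel (\<lambda>x. cis (- (x * t)) * complex_of_real (exp (- x\<^sup>2 / 2)))"
  proof (rule Bochner_Integration.integrable_bound)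
    show "integrable lborel (\<lambda>x. sqrt (2 * pi) * std_normal_density x)"
      by (intro integrable_mult_right) (auto intro: integrable_normal_density)
    show "(\<lambda>x. cis (- (x * t)) * complex_of_real (exp (- x\<^sup>2 / 2))) \<in> borel_measurable lborel"
      by (simp add: cis_conv_exp)
    show "AE x in lborel. norm (cis (- (x * t)) * complex_of_real (exp (- x\<^sup>2 / 2)))
        \<le> norm (sqrt (2 * pi) * std_normal_density x)"
      by (rule AE_I2) (simp add: norm_mult std_normal_density_def)
  qed
  ultimately show ?thesis by (simp add: has_bochner_integral_iff)
qed

lemma gaussian_2d:
  "has_bochner_integral lborel (\<lambda>z. cis (- (z \<bullet> \<xi>)) * of_real (exp (- (cmod z)\<^sup>2 / 2)))
     (of_real (2 * pi * exp (- (cmod \<xi>)\<^sup>2 / 2)))"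
proof -
  note g = gaussian_1d[of "Re \<xi>"] gaussian_1d[of "Im \<xi>"]
  have e: "exp (- (cmod z)\<^sup>2 / 2) = exp (- (Re z)\<^sup>2 / 2) * exp (- (Im z)\<^sup>2 / 2)" for z
    by (simp add: cmod_power2 add_divide_distrib diff_divide_distrib flip: exp_add)
  have "sqrt (2 * pi) * exp (- (Re \<xi>)\<^sup>2 / 2) * (sqrt (2 * pi) * exp (- (Im \<xi>)\<^sup>2 / 2))
      = 2 * pi * exp (- (cmod \<xi>)\<^sup>2 / 2)"
    unfolding e by simp
  moreover have "(\<lambda>z. cis (- (Re z * Re \<xi>)) * of_real (exp (- (Re z)\<^sup>2 / 2)) *
        (cis (- (Im z * Im \<xi>)) * of_real (exp (- (Im z)\<^sup>2 / 2))))
      = (\<lambda>z. cis (- (z \<bullet> \<xi>)) * of_real (exp (- (cmod z)\<^sup>2 / 2)))" (is "?L = ?R")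
  proof
    fix z
    have c: "cis (- (z \<bullet> \<xi>)) = cis (- (Re z * Re \<xi>)) * cis (- (Im z * Im \<xi>))"
      by (simp add: inner_complex_def cis_mult)
    show "?L z = ?R z" unfolding e c of_real_mult by (simp only: mult_ac)
  qed
  ultimately show ?thesis
    using has_bochner_integral_complex_product[OF integrable.intros[OF g(1)] integrable.intros[OF g(2)]]
      has_bochner_integral_integral_eq[OF g(1)] has_bochner_integral_integral_eq[OF g(2)]
    by (simp flip: of_real_mult)
qed

lemma lborel_complex_scale:
  assumes "c \<noteq> 0"
  shows "(lborel :: complex measure) = density (distr lborel borel (\<lambda>z. c *\<^sub>R z)) (\<lambda>_. ennreal (c\<^sup>2))"
  using lborel_affine[of c "0::complex"] assms by simp

lemma has_bochner_integral_complex_scale: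
  fixes f :: "complex \<Rightarrow> complex"
  assumes c: "c \<noteq> 0" and [measurable]: "f \<in> borel_measurable borel"
    and "has_bochner_integral lborel (\<lambda>z. c\<^sup>2 *\<^sub>R f (c *\<^sub>R z)) x"
  shows "has_bochner_integral lborel f x"
  by (subst lborel_complex_scale[OF c])
    (use assms(3) in \<open>auto intro!: has_bochner_integral_density has_bochner_integral_distr\<close>)

section \<open>The Fourier integral and the Plancherel inequality\<close>

lemma measurable_cis [measurable]: "cis \<in> borel_measurable borel"
  by (intro borel_measurable_continuous_onI continuous_intros)

lemma borel_measurable_fourier_integral [measurable]:
  assumes [measurable]: "f \<in> borel_measurable borel"
  shows "fourier_integral f \<in> borel_measurable borel"
proof -
  have "(\<lambda>\<xi>. LINT z|lborel. cis (- (z \<bullet> \<xi>)) * f z) \<in> borel_measurable borel"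
    by (rule sigma_finite_measure.borel_measurable_lebesgue_integral[OF sigma_finite_lborel]) measurable
  then show ?thesis by (simp add: fourier_integral_def[abs_def])
qed

lemma integrable_cis_mult:
  assumes "integrable lborel f"
  shows "integrable lborel (\<lambda>z::complex. cis (- (z \<bullet> \<xi>)) * f z)"
  by (rule Bochner_Integration.integrable_bound[OF assms]) (use assms in \<open>auto simp: norm_mult\<close>)

lemma fourier_integral_diff:
  assumes "integrable lborel f" "integrable lborel g"
  shows "fourier_integral (\<lambda>z. f z - g z) \<xi> = fourier_integral f \<xi> - fourier_integral g \<xi>"
  unfolding fourier_integral_def
  by (simp add: right_diff_distrib Bochner_Integration.integral_diff[OF integrable_cis_mult integrable_cis_mult] assms)

lemma fourier_integral_cmult: "fourier_integral (\<lambda>z. c * f z) \<xi> = c * fourier_integral f \<xi>"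
  unfolding fourier_integral_def by (simp add: mult.left_commute)

lemma norm_fourier_integral_le:
  "norm (fourier_integral f \<xi>) \<le> (LINT z|lborel. norm (f z))"
  unfolding fourier_integral_def
  by (rule order_trans[OF integral_norm_bound]) (simp add: norm_mult)

text \<open>Fubini's theorem: the kernel \<open>cis (- (z \<bullet> \<xi>))\<close> is symmetric in
  its two variables, so the transform can be moved from one factor to the other.\<close>

lemma fourier_integral_multiplication:
  assumes f: "integrable lborel f" and h: "integrable lborel h"
  shows "(LINT \<xi>|lborel. fourier_integral f \<xi> * h \<xi>) = (LINT z|lborel. f z * fourier_integral h z)"
proof -
  have [measurable]: "f \<in> borel_measurable borel" "h \<in> borel_measurable borel"
    using f h by auto
  let ?F = "\<lambda>z \<xi>. cis (- (z \<bullet> \<xi>)) * f z * h \<xi>"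
  have int: "integrable (lborel \<Otimes>\<^sub>M lborel) (case_prod ?F)"
  proof (rule lborel_pair.Fubini_integrable)
    show "integrable lborel (\<lambda>x. LINT y|lborel. norm (case (x, y) of (z, \<xi>) \<Rightarrow> ?F z \<xi>))"
      using f h by (auto simp: norm_mult intro!: integrable_mult_left integrable_norm)
    show "AE x in lborel. integrable lborel (\<lambda>y. case (x, y) of (z, \<xi>) \<Rightarrow> ?F z \<xi>)"
    proof (rule AE_I2)
      fix x
      show "integrable lborel (\<lambda>y. case (x, y) of (z, \<xi>) \<Rightarrow> ?F z \<xi>)"
        by (rule Bochner_Integration.integrable_bound[OF integrable_mult_right[OF h, of "f x"]])
          (auto simp: norm_mult)
    qed
  qed measurable
  have "(LINT \<xi>|lborel. fourier_integral f \<xi> * h \<xi>) = (LINT \<xi>|lborel. LINT z|lborel. ?F z \<xi>)"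
    unfolding fourier_integral_def by simp
  also have "\<dots> = (LINT z|lborel. LINT \<xi>|lborel. ?F z \<xi>)"
    by (rule lborel_pair.Fubini_integral[OF int])
  also have "\<dots> = (LINT z|lborel. f z * fourier_integral h z)"
  proof (intro Bochner_Integration.integral_cong refl)
    fix z
    have "(LINT \<xi>|lborel. ?F z \<xi>) = (LINT \<xi>|lborel. f z * (cis (- (\<xi> \<bullet> z)) * h \<xi>))"
      by (intro Bochner_Integration.integral_cong) (auto simp: inner_commute mult_ac)
    also have "\<dots> = f z * fourier_integral h z"
      unfolding fourier_integral_def by (rule integral_mult_right_zero)
    finally show "(LINT \<xi>|lborel. ?F z \<xi>) = f z * fourier_integral h z" .
  qed
  finally show ?thesis .
qed

text \<open>The unnormalized Fourier transform of exp (-s^2 |z|^2 / 2); it concentrates at the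
  origin as s tends to 0.\<close>

definition gauss_kernel :: "real \<Rightarrow> complex \<Rightarrow> real" where
  "gauss_kernel s z = 2 * pi / s\<^sup>2 * exp (- (cmod z)\<^sup>2 / (2 * s\<^sup>2))"

lemma gauss_kernel_nonneg [simp]: "gauss_kernel s z \<ge> 0"
  by (simp add: gauss_kernel_def)

lemma measurable_gauss_kernel [measurable]: "gauss_kernel s \<in> borel_measurable borel"
  by (simp add: gauss_kernel_def[abs_def])

lemma fourier_gaussian:
  assumes "s > 0"
  shows "has_bochner_integral lborel (\<lambda>z. cis (- (z \<bullet> \<xi>)) * of_real (exp (- s\<^sup>2 * (cmod z)\<^sup>2 / 2)))
     (of_real (gauss_kernel s \<xi>))"
proof -
  have "has_bochner_integral lborel
      (\<lambda>z. of_real (1 / s\<^sup>2) * (cis (- (z \<bullet> (\<xi> /\<^sub>R s))) * of_real (exp (- (cmod z)\<^sup>2 / 2))))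
      (of_real (1 / s\<^sup>2) * of_real (2 * pi * exp (- (cmod (\<xi> /\<^sub>R s))\<^sup>2 / 2)))"
    by (intro has_bochner_integral_mult_right gaussian_2d)
  moreover have "of_real (1 / s\<^sup>2) * of_real (2 * pi * exp (- (cmod (\<xi> /\<^sub>R s))\<^sup>2 / 2))
      = complex_of_real (gauss_kernel s \<xi>)"
  proof -
    have "(cmod (\<xi> /\<^sub>R s))\<^sup>2 = (cmod \<xi>)\<^sup>2 / s\<^sup>2"
      by (simp add: power_mult_distrib power_inverse divide_inverse)
    then have "1 / s\<^sup>2 * (2 * pi * exp (- (cmod (\<xi> /\<^sub>R s))\<^sup>2 / 2)) = gauss_kernel s \<xi>"
      by (simp add: gauss_kernel_def mult.commute)
    then show ?thesis by (simp only: of_real_mult[symmetric])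
  qed
  moreover have "(1 / s)\<^sup>2 *\<^sub>R (cis (- (((1 / s) *\<^sub>R z) \<bullet> \<xi>)) * of_real (exp (- s\<^sup>2 * (cmod ((1 / s) *\<^sub>R z))\<^sup>2 / 2)))
      = of_real (1 / s\<^sup>2) * (cis (- (z \<bullet> (\<xi> /\<^sub>R s))) * of_real (exp (- (cmod z)\<^sup>2 / 2)))" for z
  proof -
    have "s\<^sup>2 * (cmod ((1 / s) *\<^sub>R z))\<^sup>2 = (cmod z)\<^sup>2" "(1 / s)\<^sup>2 = 1 / s\<^sup>2"
      "((1 / s) *\<^sub>R z) \<bullet> \<xi> = z \<bullet> (\<xi> /\<^sub>R s)"
      using assms by (simp_all add: power_mult_distrib power_divide inverse_eq_divide)
    then show ?thesis by (simp only: mult_minus_left scaleR_conv_of_real)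
  qed
  ultimately have "has_bochner_integral lborel
      (\<lambda>z. (1 / s)\<^sup>2 *\<^sub>R (cis (- (((1 / s) *\<^sub>R z) \<bullet> \<xi>)) * of_real (exp (- s\<^sup>2 * (cmod ((1 / s) *\<^sub>R z))\<^sup>2 / 2))))
      (of_real (gauss_kernel s \<xi>))"
    by (simp only:)
  then show ?thesis
    using assms by - (rule has_bochner_integral_complex_scale[of "1 / s"], simp_all)
qed

text \<open>The mass does not depend on \<open>s\<close>, which allows the weight to be removed
  later; its value is the Plancherel constant of the unnormalized transform in the plane.\<close>

lemma nn_integral_gauss_kernel:
  assumes "s > 0"
  shows "(\<integral>\<^sup>+z. ennreal (gauss_kernel s (z - a)) \<partial>lborel) = ennreal ((2 * pi)\<^sup>2)"
proof -
  have "has_bochner_integral lborel (\<lambda>z. complex_of_real (2 * pi) * (cis (- (z \<bullet> 0)) * of_real (exp (- (cmod z)\<^sup>2 / 2))))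
      (complex_of_real (2 * pi) * of_real (2 * pi * exp (- (cmod 0)\<^sup>2 / 2)))"
    by (intro has_bochner_integral_mult_right gaussian_2d)
  then have "has_bochner_integral lborel (\<lambda>z. complex_of_real (gauss_kernel s z)) (of_real ((2 * pi)\<^sup>2))"
  proof -
    have *: "s\<^sup>2 *\<^sub>R complex_of_real (gauss_kernel s (s *\<^sub>R z))
        = complex_of_real (2 * pi) * (cis (- (z \<bullet> 0)) * of_real (exp (- (cmod z)\<^sup>2 / 2)))" for z
    proof -
      have "(cmod (s *\<^sub>R z))\<^sup>2 / (2 * s\<^sup>2) = (cmod z)\<^sup>2 / 2"
        using assms by (simp add: power_mult_distrib)
      then have "s\<^sup>2 * gauss_kernel s (s *\<^sub>R z) = 2 * pi * exp (- (cmod z)\<^sup>2 / 2)"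
        using assms by (simp add: gauss_kernel_def)
      then show ?thesis by (simp add: scaleR_conv_of_real flip: of_real_mult of_real_power)
    qed
    have "complex_of_real (2 * pi) * of_real (2 * pi * exp (- (cmod 0)\<^sup>2 / 2)) = of_real ((2 * pi)\<^sup>2)"
      by (simp add: power2_eq_square)
    moreover assume "has_bochner_integral lborel
      (\<lambda>z. complex_of_real (2 * pi) * (cis (- (z \<bullet> 0)) * of_real (exp (- (cmod z)\<^sup>2 / 2))))
      (complex_of_real (2 * pi) * of_real (2 * pi * exp (- (cmod 0)\<^sup>2 / 2)))"
    ultimately have "has_bochner_integral lborel
        (\<lambda>z. s\<^sup>2 *\<^sub>R complex_of_real (gauss_kernel s (s *\<^sub>R z))) (of_real ((2 * pi)\<^sup>2))"
      by (simp only: *)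
    then show ?thesis
      using assms by - (rule has_bochner_integral_complex_scale[of s], simp_all)
  qed
  then have "has_bochner_integral lborel (\<lambda>z. Re (complex_of_real (gauss_kernel s z))) (Re (of_real ((2 * pi)\<^sup>2)))"
    by (rule has_bochner_integral_bounded_linear[OF bounded_linear_Re])
  then have "has_bochner_integral lborel (gauss_kernel s) ((2 * pi)\<^sup>2)" by (simp add: eta_contract_eq)
  then have *: "(\<integral>\<^sup>+z. ennreal (gauss_kernel s z) \<partial>lborel) = ennreal ((2 * pi)\<^sup>2)"
    by (subst nn_integral_eq_integral) (auto simp: has_bochner_integral_iff)
  have "(\<integral>\<^sup>+z. ennreal (gauss_kernel s (z - a)) \<partial>lborel)
      = (\<integral>\<^sup>+z. ennreal (gauss_kernel s (z - a)) \<partial>distr lborel borel ((+) a))"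
    by (simp only: lborel_distr_plus)
  also have "\<dots> = (\<integral>\<^sup>+z. ennreal (gauss_kernel s z) \<partial>lborel)"
    by (subst nn_integral_distr) auto
  finally show ?thesis using * by simp
qed

text \<open>A Gaussian weight in frequency turns the integral of the squared transform into the quadratic
  form of a positive convolution kernel of mass \<open>(2\<pi>)\<^sup>2\<close>, which is bounded by Schur's test.\<close>

lemma plancherel_inequality_weighted:
  assumes g: "integrable lborel g" and s: "s > 0"
  shows "(\<integral>\<^sup>+\<xi>. ennreal ((norm (fourier_integral g \<xi>))\<^sup>2 * exp (- s\<^sup>2 * (cmod \<xi>)\<^sup>2 / 2)) \<partial>lborel)
    \<le> ennreal ((2 * pi)\<^sup>2) * (\<integral>\<^sup>+z. ennreal ((norm (g z))\<^sup>2) \<partial>lborel)"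
proof -
  have [measurable]: "g \<in> borel_measurable borel" using g by auto
  define w where "w = (\<lambda>\<xi>. complex_of_real (exp (- s\<^sup>2 * (cmod \<xi>)\<^sup>2 / 2)))"
  \<comment> \<open>With this \<open>h\<close> the product
    \<open>fourier_integral g \<xi> * h \<xi>\<close> is the nonnegative integrand of the claim, so
    its integral equals the integral of its norm.\<close>
  define h where "h = (\<lambda>\<xi>. cnj (fourier_integral g \<xi>) * w \<xi>)"
  define I where "I = (LINT z|lborel. norm (g z))"
  have w_meas [measurable]: "w \<in> borel_measurable borel" unfolding w_def by measurable
  have cnj_meas [measurable]: "cnj \<in> borel_measurable borel"
    by (intro borel_measurable_continuous_onI continuous_intros)
  have h_meas [measurable]: "h \<in> borel_measurable borel" unfolding h_def by measurable
  have w_int: "integrable lborel w"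
    using fourier_gaussian[OF s, of 0] by (auto simp: has_bochner_integral_iff w_def)
  have bound: "norm (fourier_integral g \<xi>) \<le> I" for \<xi>
    unfolding I_def by (rule norm_fourier_integral_le)
  have I0: "I \<ge> 0" unfolding I_def by simp
  have h_int: "integrable lborel h"
    by (rule Bochner_Integration.integrable_bound[OF integrable_mult_right[OF w_int, of "of_real I"]])
      (auto simp: h_def norm_mult I0 intro!: mult_right_mono bound)
  have gh_int: "integrable lborel (\<lambda>\<xi>. fourier_integral g \<xi> * h \<xi>)"
    by (rule Bochner_Integration.integrable_bound[OF integrable_mult_right[OF h_int, of "of_real I"]])
      (auto simp: norm_mult I0 intro!: mult_right_mono bound)
  \<comment> \<open>Multiplying the weight by a character shifts its transform to x. A further use
    of the multiplication formula then turns the transform of \<open>h\<close> into \<open>g\<close>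
    integrated against the shifted kernel.\<close>
  have h_hat: "fourier_integral h x = cnj (LINT y|lborel. g y * of_real (gauss_kernel s (y - x)))" for x
  proof -
    define m where "m = (\<lambda>\<xi>. cis (- (\<xi> \<bullet> (- x))) * w \<xi>)"
    have m_int: "integrable lborel m"
      unfolding m_def by (rule integrable_cis_mult[OF w_int])
    have m_hat: "fourier_integral m y = of_real (gauss_kernel s (y - x))" for y
    proof -
      have "fourier_integral m y = (LINT z|lborel. cis (- (z \<bullet> (y - x))) * w z)"
        unfolding fourier_integral_def m_def
        by (intro Bochner_Integration.integral_cong refl)
          (simp add: cis_mult inner_diff_right flip: mult.assoc)
      then show ?thesis
        using has_bochner_integral_integral_eq[OF fourier_gaussian[OF s, of "y - x"]] by (simp add: w_def)
    qed
    have "fourier_integral h x = cnj (LINT \<xi>|lborel. fourier_integral g \<xi> * m \<xi>)"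
      unfolding fourier_integral_def[of h] Bochner_Integration.integral_cnj[symmetric]
      by (intro Bochner_Integration.integral_cong refl)
        (simp add: h_def m_def w_def cis_cnj mult_ac)
    then show ?thesis
      unfolding fourier_integral_multiplication[OF g m_int] m_hat .
  qed
  let ?k = "\<lambda>x y. ennreal (gauss_kernel s (y - x))"
  let ?N = "\<integral>\<^sup>+z. ennreal ((norm (g z))\<^sup>2 / 2) \<partial>lborel"
  have "(\<integral>\<^sup>+\<xi>. ennreal ((norm (fourier_integral g \<xi>))\<^sup>2 * exp (- s\<^sup>2 * (cmod \<xi>)\<^sup>2 / 2)) \<partial>lborel)
      = (\<integral>\<^sup>+\<xi>. ennreal (norm (fourier_integral g \<xi> * h \<xi>)) \<partial>lborel)"
    by (intro nn_integral_cong) (simp add: h_def w_def norm_mult power2_eq_square mult_ac)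
  also have "\<dots> = ennreal (LINT \<xi>|lborel. norm (fourier_integral g \<xi> * h \<xi>))"
    using gh_int by (intro nn_integral_eq_integral) auto
  also have "(LINT \<xi>|lborel. norm (fourier_integral g \<xi> * h \<xi>)) = norm (LINT \<xi>|lborel. fourier_integral g \<xi> * h \<xi>)"
  proof -
    have "fourier_integral g \<xi> * h \<xi>
        = of_real ((cmod (fourier_integral g \<xi>))\<^sup>2 * exp (- s\<^sup>2 * (cmod \<xi>)\<^sup>2 / 2))" for \<xi>
      unfolding of_real_mult complex_norm_square h_def w_def by simp
    then have e: "fourier_integral g \<xi> * h \<xi> = of_real (norm (fourier_integral g \<xi> * h \<xi>))" for \<xi>
      by (simp only: norm_of_real) simp
    have "(LINT \<xi>|lborel. fourier_integral g \<xi> * h \<xi>) = of_real (LINT \<xi>|lborel. norm (fourier_integral g \<xi> * h \<xi>))"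
      by (subst e) (rule integral_complex_of_real)
    then show ?thesis by simp
  qed
  also have "\<dots> = norm (LINT x|lborel. g x * fourier_integral h x)"
    by (subst fourier_integral_multiplication[OF g h_int]) simp
  \<comment> \<open>If the integrand is not integrable, its Bochner integral is 0 by convention and
    the bound is trivial; hence the case split.\<close>
  also have "ennreal \<dots> \<le> (\<integral>\<^sup>+x. norm (g x * fourier_integral h x) \<partial>lborel)"
    by (cases "integrable lborel (\<lambda>x. g x * fourier_integral h x)")
      (auto intro: integral_norm_bound_ennreal simp: not_integrable_integral_eq)
  also have "\<dots> \<le> (\<integral>\<^sup>+x. \<integral>\<^sup>+y. ennreal (norm (g x)) * (ennreal (norm (g y)) * ?k x y) \<partial>lborel \<partial>lborel)"
  proof (rule nn_integral_mono)
    fix x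
    have "ennreal (norm (fourier_integral h x)) \<le> (\<integral>\<^sup>+y. norm (g y * of_real (gauss_kernel s (y - x))) \<partial>lborel)"
      unfolding h_hat complex_mod_cnj
      by (cases "integrable lborel (\<lambda>y. g y * complex_of_real (gauss_kernel s (y - x)))")
        (auto intro: integral_norm_bound_ennreal simp: not_integrable_integral_eq)
    also have "\<dots> = (\<integral>\<^sup>+y. ennreal (norm (g y)) * ?k x y \<partial>lborel)"
      by (intro nn_integral_cong) (simp add: norm_mult ennreal_mult)
    finally have "ennreal (norm (g x)) * ennreal (norm (fourier_integral h x))
        \<le> ennreal (norm (g x)) * (\<integral>\<^sup>+y. ennreal (norm (g y)) * ?k x y \<partial>lborel)"
      by (rule mult_left_mono) simp
    also have "\<dots> = (\<integral>\<^sup>+y. ennreal (norm (g x)) * (ennreal (norm (g y)) * ?k x y) \<partial>lborel)"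
      by (rule nn_integral_cmult[symmetric]) measurable
    finally show "ennreal (norm (g x * fourier_integral h x))
        \<le> (\<integral>\<^sup>+y. ennreal (norm (g x)) * (ennreal (norm (g y)) * ?k x y) \<partial>lborel)"
      by (simp add: norm_mult ennreal_mult)
  qed
  \<comment> \<open>Schur's test for a symmetric kernel: the product of the two norms is at most
    half the sum of their squares, and in each half the kernel is integrated over the variable that
    \<open>g\<close> does not contain.\<close>
  also have "\<dots> \<le> (\<integral>\<^sup>+x. \<integral>\<^sup>+y. ennreal ((norm (g x))\<^sup>2 / 2) * ?k x y + ennreal ((norm (g y))\<^sup>2 / 2) * ?k x y \<partial>lborel \<partial>lborel)"
  proof (intro nn_integral_mono)
    fix x y
    have "norm (g x) * norm (g y) \<le> (norm (g x))\<^sup>2 / 2 + (norm (g y))\<^sup>2 / 2"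
      using sum_squares_bound[of "norm (g x)" "norm (g y)"] by simp
    then have "norm (g x) * (norm (g y) * gauss_kernel s (y - x))
        \<le> (norm (g x))\<^sup>2 / 2 * gauss_kernel s (y - x) + (norm (g y))\<^sup>2 / 2 * gauss_kernel s (y - x)"
      using mult_right_mono[of _ _ "gauss_kernel s (y - x)"] by (fastforce simp: algebra_simps)
    then show "ennreal (norm (g x)) * (ennreal (norm (g y)) * ?k x y)
        \<le> ennreal ((norm (g x))\<^sup>2 / 2) * ?k x y + ennreal ((norm (g y))\<^sup>2 / 2) * ?k x y"
      by (simp add: ennreal_leI flip: ennreal_mult ennreal_plus)
  qed
  also have "\<dots> = (\<integral>\<^sup>+x. \<integral>\<^sup>+y. ennreal ((norm (g x))\<^sup>2 / 2) * ?k x y \<partial>lborel \<partial>lborel)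
      + (\<integral>\<^sup>+x. \<integral>\<^sup>+y. ennreal ((norm (g y))\<^sup>2 / 2) * ?k x y \<partial>lborel \<partial>lborel)"
    by (simp add: nn_integral_add)
  also have "(\<integral>\<^sup>+x. \<integral>\<^sup>+y. ennreal ((norm (g y))\<^sup>2 / 2) * ?k x y \<partial>lborel \<partial>lborel)
      = (\<integral>\<^sup>+y. \<integral>\<^sup>+x. ennreal ((norm (g y))\<^sup>2 / 2) * ?k y x \<partial>lborel \<partial>lborel)"
  proof -
    have "(\<integral>\<^sup>+x. \<integral>\<^sup>+y. ennreal ((norm (g y))\<^sup>2 / 2) * ?k x y \<partial>lborel \<partial>lborel)
        = (\<integral>\<^sup>+y. \<integral>\<^sup>+x. ennreal ((norm (g y))\<^sup>2 / 2) * ?k x y \<partial>lborel \<partial>lborel)"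
      by (rule lborel_pair.Fubini') measurable
    then show ?thesis by (simp add: gauss_kernel_def norm_minus_commute)
  qed
  also have "(\<integral>\<^sup>+x. \<integral>\<^sup>+y. ennreal ((norm (g x))\<^sup>2 / 2) * ?k x y \<partial>lborel \<partial>lborel) = ?N * ennreal ((2 * pi)\<^sup>2)"
    by (simp add: nn_integral_cmult nn_integral_gauss_kernel[OF s] nn_integral_multc)
  also have "?N * ennreal ((2 * pi)\<^sup>2) + ?N * ennreal ((2 * pi)\<^sup>2)
      = ennreal ((2 * pi)\<^sup>2) * (?N + ?N)"
    by (simp add: algebra_simps)
  also have "?N + ?N = (\<integral>\<^sup>+z. ennreal ((norm (g z))\<^sup>2) \<partial>lborel)"
    by (subst nn_integral_add[symmetric]) (auto intro!: nn_integral_cong simp flip: ennreal_plus)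
  finally show ?thesis .
qed

text \<open>The weights 1/(k+1) tend to 0 and the weighted bound is uniform in them, so Fatou's
  lemma removes the Gaussian.\<close>

lemma plancherel_inequality:
  assumes g: "integrable lborel g"
  shows "(\<integral>\<^sup>+\<xi>. ennreal ((norm (fourier_integral g \<xi>))\<^sup>2) \<partial>lborel)
    \<le> ennreal ((2 * pi)\<^sup>2) * (\<integral>\<^sup>+z. ennreal ((norm (g z))\<^sup>2) \<partial>lborel)"
proof -
  have [measurable]: "g \<in> borel_measurable borel" using g by auto
  let ?u = "\<lambda>k \<xi>. ennreal ((norm (fourier_integral g \<xi>))\<^sup>2 * exp (- (1 / real (Suc k))\<^sup>2 * (cmod \<xi>)\<^sup>2 / 2))"
  have "(\<lambda>k. ?u k \<xi>) \<longlonglongrightarrow> ennreal ((norm (fourier_integral g \<xi>))\<^sup>2)" for \<xi>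
  proof (rule tendsto_ennrealI)
    have "(\<lambda>k. (norm (fourier_integral g \<xi>))\<^sup>2 * exp (- (1 / real (Suc k))\<^sup>2 * (cmod \<xi>)\<^sup>2 / 2))
        \<longlonglongrightarrow> (norm (fourier_integral g \<xi>))\<^sup>2 * exp (- (0)\<^sup>2 * (cmod \<xi>)\<^sup>2 / 2)"
      using LIMSEQ_inverse_real_of_nat by (intro tendsto_intros) (auto simp: inverse_eq_divide)
    then show "(\<lambda>k. (norm (fourier_integral g \<xi>))\<^sup>2 * exp (- (1 / real (Suc k))\<^sup>2 * (cmod \<xi>)\<^sup>2 / 2))
        \<longlonglongrightarrow> (norm (fourier_integral g \<xi>))\<^sup>2" by simp
  qed
  then have "ennreal ((norm (fourier_integral g \<xi>))\<^sup>2) = liminf (\<lambda>k. ?u k \<xi>)" for \<xi>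
    by (intro lim_imp_Liminf[symmetric]) auto
  then have "(\<integral>\<^sup>+\<xi>. ennreal ((norm (fourier_integral g \<xi>))\<^sup>2) \<partial>lborel) = (\<integral>\<^sup>+\<xi>. liminf (\<lambda>k. ?u k \<xi>) \<partial>lborel)"
    by simp
  also have "\<dots> \<le> liminf (\<lambda>k. \<integral>\<^sup>+\<xi>. ?u k \<xi> \<partial>lborel)"
    by (rule nn_integral_liminf) measurable
  also have "\<dots> \<le> liminf (\<lambda>k::nat. ennreal ((2 * pi)\<^sup>2) * (\<integral>\<^sup>+z. ennreal ((norm (g z))\<^sup>2) \<partial>lborel))"
    by (intro Liminf_mono always_eventually allI plancherel_inequality_weighted[OF g]) simp
  also have "\<dots> = ennreal ((2 * pi)\<^sup>2) * (\<integral>\<^sup>+z. ennreal ((norm (g z))\<^sup>2) \<partial>lborel)"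
    by (intro Liminf_const) simp
  finally show ?thesis .
qed

section \<open>Integration by parts\<close>

text \<open>Provides one majorant for all difference quotients with step at most 1. The 9 is the
  square of the 3 in 1 + |z|^2 <= 3 (1 + |z + h|^2).\<close>

lemma decay_shift:
  assumes "norm h \<le> 1"
  shows "decay (z + h) \<le> 9 * decay z"
proof -
  have "cmod z \<le> cmod (z + h) + 1"
    using norm_triangle_ineq4[of "z + h" h] assms by simp
  then have "(cmod z)\<^sup>2 \<le> (cmod (z + h) + 1)\<^sup>2" by (simp add: power_mono)
  also have "\<dots> \<le> 2 * (cmod (z + h))\<^sup>2 + 2"
    using sum_squares_bound[of "cmod (z + h)" 1] by (simp add: power2_eq_square algebra_simps)
  finally have "1 + (cmod z)\<^sup>2 \<le> 3 * (1 + (cmod (z + h))\<^sup>2)"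
    using zero_le_power2[of "cmod (z + h)"] by (simp only: distrib_left)
  then have "(1 + (cmod z)\<^sup>2)\<^sup>2 \<le> (3 * (1 + (cmod (z + h))\<^sup>2))\<^sup>2"
    by (intro power_mono) auto
  then have "(1 + (cmod z)\<^sup>2)\<^sup>2 \<le> 9 * (1 + (cmod (z + h))\<^sup>2)\<^sup>2"
    by (simp only: power_mult_distrib) simp
  then show ?thesis
    unfolding decay_def by (simp add: divide_simps mult.commute)
qed

lemma integral_complex_shift:
  fixes f :: "complex \<Rightarrow> complex"
  assumes "integrable lborel f"
  shows "has_bochner_integral lborel (\<lambda>z. f (z + c)) (LINT z|lborel. f z)"
proof -
  have [measurable]: "f \<in> borel_measurable borel" using assms by auto
  have "integrable (distr lborel borel ((+) c)) f"
    unfolding lborel_distr_plus by (rule assms)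
  then have "integrable lborel (\<lambda>z. f (c + z))"
    by (subst (asm) integrable_distr_eq) auto
  moreover have "(LINT z|distr lborel borel ((+) c). f z) = (LINT z|lborel. f (c + z))"
    by (subst integral_distr) auto
  ultimately show ?thesis
    by (simp add: has_bochner_integral_iff lborel_distr_plus add.commute)
qed

text \<open>Each difference quotient of \<open>G\<close> has integral zero by translation
  invariance. The mean value inequality and \<open>decay_shift\<close> dominate the quotients by a
  multiple of \<open>decay\<close>, so the integral of their limit is zero as well.\<close>

lemma has_bochner_integral_derivative_zero:
  fixes G :: "complex \<Rightarrow> complex"
  assumes D: "\<And>z. (G has_derivative D z) (at z)"
    and G_le: "\<And>z. norm (G z) \<le> C * decay z"
    and D_le: "\<And>z. onorm (D z) \<le> C * decay z"
    and h: "norm h \<le> 1"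
  shows "has_bochner_integral lborel (\<lambda>z. D z h) 0"
proof -
  define s where "s = (\<lambda>k z. real (Suc k) *\<^sub>R (G (z + (1 / real (Suc k)) *\<^sub>R h) - G z))"
  have "continuous_on UNIV G"
    using D by (auto intro!: continuous_at_imp_continuous_on has_derivative_continuous)
  then have [measurable]: "G \<in> borel_measurable borel"
    by (rule borel_measurable_continuous_onI)
  have G_int: "integrable lborel G"
    by (rule integrable_decay_bound[OF _ G_le]) simp
  have C: "C \<ge> 0"
    using order_trans[OF norm_ge_zero G_le, of 0] by (simp add: decay_def)
  have s_meas [measurable]: "s k \<in> borel_measurable borel" for k
    unfolding s_def by measurable
  have s_lim: "(\<lambda>k. s k z) \<longlonglongrightarrow> D z h" for z
  proof -
    have lin: "linear (D z)" using D has_derivative_linear by blast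
    have "((\<lambda>x. G (z + x *\<^sub>R h)) has_derivative (\<lambda>x. D z (x *\<^sub>R h))) (at 0)"
      by (rule has_derivative_compose[where g = G and f = "\<lambda>x. z + x *\<^sub>R h"])
        (auto intro!: derivative_eq_intros D)
    then have "((\<lambda>x. norm (G (z + x *\<^sub>R h) - G z - x *\<^sub>R D z h) / norm x) \<longlongrightarrow> 0) (at 0)"
      by (simp add: has_derivative_at linear_cmul[OF lin])
    moreover have "filterlim (\<lambda>k. 1 / real (Suc k)) (at 0) sequentially"
      using LIMSEQ_inverse_real_of_nat
      by (auto simp: filterlim_at inverse_eq_divide)
    ultimately have "(\<lambda>k. norm (G (z + (1 / real (Suc k)) *\<^sub>R h) - G z - (1 / real (Suc k)) *\<^sub>R D z h)
        / norm (1 / real (Suc k))) \<longlonglongrightarrow> 0"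
      by (rule filterlim_compose)
    moreover have "norm (G (z + (1 / real (Suc k)) *\<^sub>R h) - G z - (1 / real (Suc k)) *\<^sub>R D z h)
        / norm (1 / real (Suc k)) = norm (s k z - D z h)" for k
    proof -
      have "s k z - D z h = real (Suc k) *\<^sub>R (G (z + (1 / real (Suc k)) *\<^sub>R h) - G z - (1 / real (Suc k)) *\<^sub>R D z h)"
        by (simp add: s_def scaleR_right_diff_distrib)
      then show ?thesis by (simp add: divide_inverse mult.commute)
    qed
    ultimately show ?thesis
      by (intro LIM_zero_cancel[where l = "D z h"]) (simp add: tendsto_norm_zero_iff)
  qed
  have s_le: "norm (s k z) \<le> 9 * C * decay z" for k z
  proof -
    let ?d = "1 / real (Suc k)"
    have d: "norm (?d *\<^sub>R h) \<le> 1 * 1" "?d \<le> 1"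
      using h unfolding norm_scaleR by (auto intro!: mult_mono)
    have "norm (G (z + ?d *\<^sub>R h) - G z) \<le> norm (?d *\<^sub>R h) * (9 * C * decay z)"
    proof (rule differentiable_bound_segment[where G = UNIV])
      fix t :: real assume t: "t \<in> {0..1}"
      have "norm (t *\<^sub>R ?d *\<^sub>R h) \<le> 1 * 1"
        using d t unfolding norm_scaleR[of t] by (intro mult_mono) auto
      then have "C * decay (z + t *\<^sub>R ?d *\<^sub>R h) \<le> C * (9 * decay z)"
        using C by (intro mult_left_mono decay_shift) auto
      then show "onorm (D (z + t *\<^sub>R ?d *\<^sub>R h)) \<le> 9 * C * decay z"
        using D_le[of "z + t *\<^sub>R ?d *\<^sub>R h"] by linarith
    qed (use D in auto)
    also have "\<dots> \<le> ?d * (9 * C * decay z)"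
      using h C by (intro mult_right_mono) (auto simp: divide_simps)
    finally have "real (Suc k) * norm (G (z + ?d *\<^sub>R h) - G z) \<le> real (Suc k) * (?d * (9 * C * decay z))"
      by (rule mult_left_mono) simp
    then show ?thesis by (simp add: s_def)
  qed
  have s_int: "(LINT z|lborel. s k z) = 0" for k
    using integral_complex_shift[OF G_int, of "(1 / real (Suc k)) *\<^sub>R h"] G_int
    by (simp add: s_def has_bochner_integral_iff)
  have D_meas: "(\<lambda>z. D z h) \<in> borel_measurable lborel"
    by (rule borel_measurable_LIMSEQ_metric[OF _ s_lim]) simp
  have dom: "integrable lborel (\<lambda>z. 9 * C * decay z)"
    by (intro integrable_mult_right integrable_decay)
  have "(\<lambda>k. LINT z|lborel. s k z) \<longlonglongrightarrow> (LINT z|lborel. D z h)"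
    by (rule integral_dominated_convergence[OF D_meas _ dom]) (use s_lim s_le in auto)
  then have "(LINT z|lborel. D z h) = 0"
    by (simp add: s_int LIMSEQ_const_iff)
  moreover have "integrable lborel (\<lambda>z. D z h)"
    by (rule integrable_dominated_convergence[where s = s, OF D_meas _ dom]) (use s_lim s_le in auto)
  ultimately show ?thesis by (simp add: has_bochner_integral_iff)
qed

text \<open>The directions 1 and \<open>\<i>\<close> show that \<open>a + b\<close> and
  \<open>\<i> * (a - b)\<close> integrate to zero; \<open>a\<close> and \<open>b\<close> are linear
  combinations of these two.\<close>

lemma has_bochner_integral_wirtinger_zero:
  assumes G: "\<And>z. has_wirtinger G (a z) (b z) z"
    and le: "\<And>z. norm (G z) \<le> C * decay z" "\<And>z. norm (a z) \<le> C * decay z" "\<And>z. norm (b z) \<le> C * decay z"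
  shows "has_bochner_integral lborel a 0" "has_bochner_integral lborel b 0"
proof -
  have C: "C \<ge> 0"
    using order_trans[OF norm_ge_zero le(1), of 0] by (simp add: decay_def)
  have D: "(G has_derivative (\<lambda>h. a z * h + b z * cnj h)) (at z)" for z
    using G by (simp add: has_wirtinger_def)
  have on: "onorm (\<lambda>h. a z * h + b z * cnj h) \<le> 2 * C * decay z" for z
  proof (rule onorm_le)
    fix h
    have "norm (a z * h + b z * cnj h) \<le> norm (a z) * norm h + norm (b z) * norm h"
      by (rule order_trans[OF norm_triangle_ineq]) (simp add: norm_mult)
    also have "\<dots> \<le> C * decay z * norm h + C * decay z * norm h"
      using le by (intro add_mono mult_right_mono) auto
    finally show "norm (a z * h + b z * cnj h) \<le> 2 * C * decay z * norm h" by (simp add: mult_ac)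
  qed
  have G_le: "norm (G z) \<le> 2 * C * decay z" for z
    using le(1)[of z] mult_nonneg_nonneg[OF C decay_pos(2)[of z]] by linarith
  note * = has_bochner_integral_derivative_zero[OF D G_le on]
  have 1: "has_bochner_integral lborel (\<lambda>z. a z + b z) 0"
    using *[of 1] by simp
  have 2: "has_bochner_integral lborel (\<lambda>z. a z * \<i> + b z * (- \<i>)) 0"
    using *[of \<i>] by simp
  have "has_bochner_integral lborel (\<lambda>z. ((a z + b z) + (- \<i>) * (a z * \<i> + b z * (- \<i>))) * (1/2)) ((0 + (- \<i>) * 0) * (1/2))"
    by (intro has_bochner_integral_mult_left has_bochner_integral_add has_bochner_integral_mult_right 1 2)
  moreover have "(\<lambda>z. ((a z + b z) + (- \<i>) * (a z * \<i> + b z * (- \<i>))) * (1/2)) = a"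
    by (auto simp: fun_eq_iff algebra_simps)
  ultimately show "has_bochner_integral lborel a 0" by simp
  have "has_bochner_integral lborel (\<lambda>z. ((a z + b z) - (- \<i>) * (a z * \<i> + b z * (- \<i>))) * (1/2)) ((0 - (- \<i>) * 0) * (1/2))"
    by (intro has_bochner_integral_mult_left has_bochner_integral_diff has_bochner_integral_mult_right 1 2)
  moreover have "(\<lambda>z. ((a z + b z) - (- \<i>) * (a z * \<i> + b z * (- \<i>))) * (1/2)) = b"
    by (auto simp: fun_eq_iff algebra_simps)
  ultimately show "has_bochner_integral lborel b 0" by simp
qed

section \<open>Gaussian cutoffs and characters of the plane\<close>

lemma has_wirtinger_exp:
  assumes "has_wirtinger f a b z"
  shows "has_wirtinger (\<lambda>z. exp (f z)) (exp (f z) * a) (exp (f z) * b) z"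
  unfolding has_wirtinger_def
  by (rule has_derivative_eq_rhs, rule has_derivative_compose[where g = exp])
    (use assms DERIV_exp[of "f z"] in \<open>auto simp: has_wirtinger_def has_field_derivative_def fun_eq_iff algebra_simps\<close>)

lemma has_wirtinger_id: "has_wirtinger (\<lambda>z. z) 1 0 z"
  by (simp add: has_wirtinger_def)

text \<open>Written through z and its conjugate so that the Wirtinger rules apply; the real form exp
  (-e |z|^2) is \<open>gauss_cutoff_eq\<close>.\<close>

definition gauss_cutoff :: "real \<Rightarrow> complex \<Rightarrow> complex" where
  "gauss_cutoff e z = exp (of_real (- e) * (z * cnj z))"

lemma gauss_cutoff_eq: "gauss_cutoff e z = of_real (exp (- (e * (cmod z)\<^sup>2)))"
  unfolding gauss_cutoff_def complex_norm_square[symmetric] exp_of_real[symmetric] by simp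

lemma norm_gauss_cutoff: "norm (gauss_cutoff e z) = exp (- (e * (cmod z)\<^sup>2))"
  by (simp add: gauss_cutoff_eq)

lemma has_wirtinger_gauss_cutoff:
  "has_wirtinger (gauss_cutoff e) (- of_real e * cnj z * gauss_cutoff e z) (- of_real e * z * gauss_cutoff e z) z"
  unfolding gauss_cutoff_def
  by (rule has_wirtinger_cong, rule has_wirtinger_exp[OF has_wirtinger_cmult[OF has_wirtinger_mult[OF has_wirtinger_id has_wirtinger_cnj[OF has_wirtinger_id]]]]) auto

text \<open>The inner product is half of \<open>cnj \<xi> * z + \<xi> * cnj z\<close>. The quotient
  of the two resulting factors, \<open>cnj \<xi> / \<xi>\<close>, is the source of the Beurling
  symbol.\<close>

lemma has_wirtinger_character:
  "has_wirtinger (\<lambda>z. cis (- (z \<bullet> \<xi>))) (- (\<i> / 2 * cnj \<xi> * cis (- (z \<bullet> \<xi>)))) (- (\<i> / 2 * \<xi> * cis (- (z \<bullet> \<xi>)))) z"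
proof -
  have e: "cis (- (z \<bullet> \<xi>)) = exp (- \<i> / 2 * (cnj \<xi> * z + \<xi> * cnj z))" for z
    unfolding cis_conv_exp
    by (rule arg_cong[of _ _ exp]) (simp add: complex_eq_iff inner_complex_def field_simps)
  show ?thesis
    unfolding e
    by (rule has_wirtinger_cong, rule has_wirtinger_exp[OF has_wirtinger_cmult[OF has_wirtinger_add[OF
        has_wirtinger_cmult[OF has_wirtinger_id] has_wirtinger_cmult[OF has_wirtinger_cnj[OF has_wirtinger_id]]]]])
      (auto simp: algebra_simps)
qed

text \<open>The first bound makes cutoffs of bounded fields integrable for fixed \<open>e\<close>.
  The second is uniform in \<open>e\<close> and controls the term in which the cutoff itself is
  differentiated. They come from the quadratic and the linear lower bound of exp.\<close>

lemma norm_gauss_cutoff_le: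
  assumes "0 < e" "e \<le> 1"
  shows "norm (gauss_cutoff e z) \<le> 2 / e\<^sup>2 * decay z"
    and "e * norm (gauss_cutoff e z) \<le> 2 / (1 + (cmod z)\<^sup>2)"
proof -
  define x where "x = (cmod z)\<^sup>2"
  have x: "x \<ge> 0" by (simp add: x_def)
  have "e\<^sup>2 / 2 * (1 + x)\<^sup>2 \<le> 1 + e * x + (e * x)\<^sup>2 / 2"
  proof -
    have "e\<^sup>2 \<le> 1" "e\<^sup>2 * x \<le> e * x"
      using assms x mult_left_le_one_le[of "e * x" e] by (auto simp: power2_eq_square mult_le_one)
    then show ?thesis by (simp add: power2_eq_square algebra_simps)
  qed
  also have "\<dots> \<le> exp (e * x)"
    using assms x by (intro exp_lower_Taylor_quadratic) auto
  finally have "inverse (exp (e * x)) \<le> inverse (e\<^sup>2 / 2 * (1 + x)\<^sup>2)"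
    using assms x by (intro le_imp_inverse_le) (auto intro!: mult_pos_pos zero_less_power add_pos_nonneg)
  then show "norm (gauss_cutoff e z) \<le> 2 / e\<^sup>2 * decay z"
    by (simp add: norm_gauss_cutoff decay_def exp_minus x_def inverse_eq_divide)
  have "e * (1 + x) \<le> 2 * exp (e * x)"
  proof -
    have "0 \<le> e * x" "1 + e * x \<le> exp (e * x)"
      using exp_ge_add_one_self[of "e * x"] assms x by auto
    then show ?thesis using assms unfolding distrib_left by linarith
  qed
  then have "e * inverse (exp (e * x)) \<le> 2 / (1 + x)"
    using x by (simp add: field_simps)
  then show "e * norm (gauss_cutoff e z) \<le> 2 / (1 + (cmod z)\<^sup>2)"
    by (simp add: norm_gauss_cutoff exp_minus x_def)
qed

section \<open>The Beurling multiplier relates the two Wirtinger derivatives\<close>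

lemma square_decay:
  assumes "norm x \<le> C / (1 + (cmod z)\<^sup>2)"
  shows "(norm x)\<^sup>2 \<le> C\<^sup>2 * decay z"
  using power_mono[OF assms norm_ge_zero, of 2] by (simp add: decay_def power_divide)

lemma decay_le: "decay z \<le> 1 / (1 + (cmod z)\<^sup>2)"
proof -
  have "1 * (1 + (cmod z)\<^sup>2) \<le> (1 + (cmod z)\<^sup>2) * (1 + (cmod z)\<^sup>2)"
    by (intro mult_right_mono) auto
  then show ?thesis
    unfolding decay_def power2_eq_square[of "1 + (cmod z)\<^sup>2"] by (intro divide_left_mono) auto
qed

lemma square_integrable_decay:
  fixes f :: "complex \<Rightarrow> 'b::{banach, second_countable_topology}"
  assumes [measurable]: "f \<in> borel_measurable borel" and le: "\<And>z. norm (f z) \<le> C / (1 + (cmod z)\<^sup>2)"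
  shows "square_integrable f"
  unfolding square_integrable_def
  using square_decay[OF le] by (auto intro!: integrable_decay_bound[where C = "C\<^sup>2"])

lemma square_integrable_nn:
  assumes [measurable]: "f \<in> borel_measurable borel" and "(\<integral>\<^sup>+z. ennreal ((norm (f z))\<^sup>2) \<partial>lborel) < \<infinity>"
  shows "square_integrable f"
  unfolding square_integrable_def using assms(2) by (auto intro!: integrableI_bounded)

lemma nn_integral_square_finite:
  assumes "square_integrable f"
  shows "(\<integral>\<^sup>+z. ennreal ((norm (f z))\<^sup>2) \<partial>lborel) < \<infinity>"
  using assms unfolding square_integrable_def integrable_iff_bounded by auto

lemma tendsto_L2_dominated:
  fixes f :: "complex \<Rightarrow> 'b::{banach, second_countable_topology}"
  assumes [measurable]: "f \<in> borel_measurable borel" "\<And>k::nat. g k \<in> borel_measurable borel"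
    and lim: "\<And>z. (\<lambda>k. g k z) \<longlonglongrightarrow> f z"
    and le: "\<And>k z. norm (g k z) \<le> C / (1 + (cmod z)\<^sup>2)"
  shows "(\<lambda>k. \<integral>\<^sup>+z. ennreal ((norm (g k z))\<^sup>2) \<partial>lborel) \<longlonglongrightarrow> (\<integral>\<^sup>+z. ennreal ((norm (f z))\<^sup>2) \<partial>lborel)"
proof (rule nn_integral_dominated_convergence[where w = "\<lambda>z. ennreal (C\<^sup>2 * decay z)"])
  show "(\<integral>\<^sup>+z. ennreal (C\<^sup>2 * decay z) \<partial>lborel) < \<infinity>"
    using integrable_mult_right[OF integrable_decay, of "C\<^sup>2"]
    by (subst nn_integral_eq_integral) auto
  show "AE z in lborel. ennreal ((norm (g k z))\<^sup>2) \<le> ennreal (C\<^sup>2 * decay z)" for k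
    using square_decay[OF le] by (auto intro: ennreal_leI)
  show "AE z in lborel. (\<lambda>k. ennreal ((norm (g k z))\<^sup>2)) \<longlonglongrightarrow> ennreal ((norm (f z))\<^sup>2)"
    by (intro AE_I2 tendsto_ennrealI tendsto_intros lim)
qed auto

section \<open>Truncation to discs and transforms of integrable fields\<close>

definition truncate :: "real \<Rightarrow> (complex \<Rightarrow> complex) \<Rightarrow> complex \<Rightarrow> complex" where
  "truncate R f z = indicator (cball 0 R) z *\<^sub>R f z"

lemma truncate_measurable [measurable]:
  "f \<in> borel_measurable borel \<Longrightarrow> truncate R f \<in> borel_measurable borel"
  unfolding truncate_def[abs_def] by (intro borel_measurable_scaleR borel_measurable_indicator) auto

lemma norm_truncate_le: "norm (truncate R f z) \<le> norm (f z)"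
  and norm_truncate_diff_le: "norm (f z - truncate R f z) \<le> norm (f z)"
  by (auto simp: truncate_def indicator_def)

lemma truncate_L2_tendsto:
  assumes f [measurable]: "f \<in> borel_measurable borel" and le: "\<And>z. norm (f z) \<le> C / (1 + (cmod z)\<^sup>2)"
  shows "((\<lambda>R. \<integral>\<^sup>+z. ennreal ((norm (f z - truncate R f z))\<^sup>2) \<partial>lborel) \<longlongrightarrow> 0) at_top"
proof (rule tendsto_at_topI_sequentially)
  fix X :: "nat \<Rightarrow> real" assume X: "filterlim X at_top sequentially"
  have "(\<lambda>k. \<integral>\<^sup>+z. ennreal ((norm (f z - truncate (X k) f z))\<^sup>2) \<partial>lborel)
      \<longlonglongrightarrow> (\<integral>\<^sup>+z. ennreal ((norm (0::complex))\<^sup>2) \<partial>(lborel :: complex measure))"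
  proof (rule tendsto_L2_dominated[where C = C])
    show "(\<lambda>k. f z - truncate (X k) f z) \<longlonglongrightarrow> 0" for z
    proof (rule tendsto_eventually)
      have "eventually (\<lambda>k. X k \<ge> norm z) sequentially"
        using X by (simp add: filterlim_at_top)
      then show "eventually (\<lambda>k. f z - truncate (X k) f z = 0) sequentially"
        by eventually_elim (simp add: truncate_def)
    qed
    show "norm (f z - truncate (X k) f z) \<le> C / (1 + (cmod z)\<^sup>2)" for k z
      using norm_truncate_diff_le[of f z "X k"] le[of z] by linarith
  qed auto
  then show "(\<lambda>k. \<integral>\<^sup>+z. ennreal ((norm (f z - truncate (X k) f z))\<^sup>2) \<partial>lborel) \<longlonglongrightarrow> 0" by simp
qed

lemma integrable_truncate:
  assumes "continuous_on UNIV f"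
  shows "integrable lborel (truncate R f)"
  unfolding truncate_def[abs_def]
  by (rule borel_integrable_compact) (auto intro: continuous_on_subset[OF assms])

text \<open>By the Plancherel inequality the error made in the transform by truncation is controlled
  by the L^2 norm of \<open>f\<close> outside the disc.\<close>

lemma has_L2_fourier_integrable:
  assumes cont: "continuous_on UNIV f" and le: "\<And>z. norm (f z) \<le> C * decay z" and C: "C \<ge> 0"
  shows "has_L2_fourier f (fourier_integral f)"
proof -
  have [measurable]: "f \<in> borel_measurable borel" using cont by (rule borel_measurable_continuous_onI)
  have int: "integrable lborel f" by (rule integrable_decay_bound[OF _ le]) simp
  have le': "norm (f z) \<le> C / (1 + (cmod z)\<^sup>2)" for z
    using le[of z] mult_left_mono[OF decay_le C, of z] by simp
  have sq: "square_integrable f" by (rule square_integrable_decay[OF _ le']) simp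
  have "(\<integral>\<^sup>+\<xi>. ennreal ((norm (fourier_integral f \<xi>))\<^sup>2) \<partial>lborel) < \<infinity>"
    using plancherel_inequality[OF int] nn_integral_square_finite[OF sq]
    by (simp add: ennreal_mult_less_top order.strict_trans1)
  then have "square_integrable (fourier_integral f)" by (intro square_integrable_nn) simp_all
  moreover have "((\<lambda>R. \<integral>\<^sup>+\<xi>. ennreal ((norm (fourier_integral f \<xi> - fourier_integral (truncate R f) \<xi>))\<^sup>2) \<partial>lborel) \<longlongrightarrow> 0) at_top"
  proof (rule tendsto_sandwich[OF _ _ tendsto_const])
    show "\<forall>\<^sub>F R in at_top. (\<integral>\<^sup>+\<xi>. ennreal ((norm (fourier_integral f \<xi> - fourier_integral (truncate R f) \<xi>))\<^sup>2) \<partial>lborel)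
        \<le> ennreal ((2 * pi)\<^sup>2) * (\<integral>\<^sup>+z. ennreal ((norm (f z - truncate R f z))\<^sup>2) \<partial>lborel)"
      using plancherel_inequality[OF Bochner_Integration.integrable_diff[OF int integrable_truncate[OF cont]]]
      by (simp add: fourier_integral_diff[OF int integrable_truncate[OF cont]])
    show "((\<lambda>R. ennreal ((2 * pi)\<^sup>2) * (\<integral>\<^sup>+z. ennreal ((norm (f z - truncate R f z))\<^sup>2) \<partial>lborel)) \<longlongrightarrow> 0) at_top"
      using tendsto_mult_ennreal[OF tendsto_const truncate_L2_tendsto[OF _ le']] by fastforce
  qed auto
  ultimately show ?thesis
    using sq by (simp add: has_L2_fourier_def truncate_def[abs_def])
qed

lemma beurling_symbol_eq: "beurling_symbol \<xi> = cnj \<xi> / \<xi>"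
  unfolding beurling_symbol_def
  by (rule arg_cong2[of _ _ _ _ "(/)"]) (simp_all add: complex_eq_iff)

lemma norm_beurling_symbol_le: "norm (beurling_symbol \<xi>) \<le> 1"
  by (simp add: beurling_symbol_eq norm_divide)

lemma measurable_beurling_symbol [measurable]: "beurling_symbol \<in> borel_measurable borel"
proof -
  have [measurable]: "cnj \<in> borel_measurable borel"
    by (intro borel_measurable_continuous_onI continuous_intros)
  show ?thesis unfolding beurling_symbol_eq[abs_def] by measurable
qed

text \<open>A potential of order 1/|z| at infinity with its z-derivative \<open>a\<close> and
  zbar-derivative \<open>b\<close>. The rates are those of the profile, where \<open>a\<close> is a
  multiple of \<open>W\<close> and \<open>b\<close> of \<open>V\<close>: \<open>b\<close> is
  integrable, \<open>a\<close> is only required to decay like a square integrable field.\<close>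

locale plane_field =
  fixes \<phi> a b :: "complex \<Rightarrow> complex" and C :: real
  assumes wirtinger: "\<And>z. has_wirtinger \<phi> (a z) (b z) z"
    and cont_a: "continuous_on UNIV a" and cont_b: "continuous_on UNIV b"
    and le_phi: "\<And>z. norm (\<phi> z) \<le> C" and le_z_phi: "\<And>z. norm (z * \<phi> z) \<le> C"
    and le_a: "\<And>z. norm (a z) \<le> C / (1 + (cmod z)\<^sup>2)"
    and le_b: "\<And>z. norm (b z) \<le> C * decay z"
begin

text \<open>\<open>cut_a\<close> and \<open>cut_b\<close> are not cutoffs of \<open>a\<close> and
  \<open>b\<close> but the two derivatives of \<open>cut\<close>, including the derivative of the
  Gaussian; see \<open>wirtinger_cut\<close>.\<close>

definition cut where "cut e z = gauss_cutoff e z * \<phi> z"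
definition cut_a where "cut_a e z = gauss_cutoff e z * (a z - of_real e * cnj z * \<phi> z)"
definition cut_b where "cut_b e z = gauss_cutoff e z * (b z - of_real e * z * \<phi> z)"

lemma C_nonneg: "C \<ge> 0"
  using order_trans[OF norm_ge_zero le_phi] .

lemma le_b': "norm (b z) \<le> C / (1 + (cmod z)\<^sup>2)"
  using le_b[of z] mult_left_mono[OF decay_le C_nonneg, of z] by simp

lemma le_C: "norm (a z) \<le> C" "norm (b z) \<le> C"
proof -
  have "C / (1 + (cmod z)\<^sup>2) \<le> C / 1"
    by (intro divide_left_mono C_nonneg) auto
  then show "norm (a z) \<le> C" "norm (b z) \<le> C"
    using le_a[of z] le_b'[of z] by linarith+
qed

lemma cont_phi: "continuous_on UNIV \<phi>"
  by (auto intro!: continuous_at_imp_continuous_on has_wirtinger_continuous wirtinger)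

lemma measurable_field [measurable]:
  "\<phi> \<in> borel_measurable borel" "a \<in> borel_measurable borel" "b \<in> borel_measurable borel"
  using cont_phi cont_a cont_b by (auto intro: borel_measurable_continuous_onI)

lemma measurable_cut [measurable]:
  "cut e \<in> borel_measurable borel" "cut_a e \<in> borel_measurable borel" "cut_b e \<in> borel_measurable borel"
  unfolding cut_def[abs_def] cut_a_def[abs_def] cut_b_def[abs_def] gauss_cutoff_eq
  by (intro borel_measurable_continuous_onI continuous_intros cont_phi cont_a cont_b)+

lemma wirtinger_cut: "has_wirtinger (cut e) (cut_a e z) (cut_b e z) z"
  unfolding cut_def
  by (rule has_wirtinger_cong, rule has_wirtinger_mult[OF has_wirtinger_gauss_cutoff wirtinger])
    (simp_all add: cut_a_def cut_b_def algebra_simps)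

text \<open>The bounds by \<open>decay\<close> degenerate as \<open>e\<close> tends to 0 and serve
  integrability at fixed \<open>e\<close>. The last two are uniform and serve dominated convergence:
  of the 3, one unit comes from the field and two from the differentiated cutoff, where |z phi| <= C
  is used.\<close>

lemma cut_bounds:
  assumes "0 < e" "e \<le> 1"
  shows "norm (cut e z) \<le> 4 * C / e\<^sup>2 * decay z"
    "norm (cut_a e z) \<le> 4 * C / e\<^sup>2 * decay z" "norm (cut_b e z) \<le> 4 * C / e\<^sup>2 * decay z"
    "norm (cut_a e z) \<le> 3 * C / (1 + (cmod z)\<^sup>2)" "norm (cut_b e z) \<le> 3 * C / (1 + (cmod z)\<^sup>2)"
proof -
  have cut1: "norm (gauss_cutoff e z) \<le> 1" "norm (gauss_cutoff e z) \<ge> 0"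
    using assms by (simp_all add: norm_gauss_cutoff)
  have ez: "norm (of_real e * cnj z * \<phi> z) \<le> e * C" "norm (of_real e * z * \<phi> z) \<le> e * C"
    using le_z_phi[of z] assms by (simp_all add: norm_mult)
  have eC: "e * C \<le> C" using assms C_nonneg by (simp add: mult_left_le_one_le)
  have ga: "norm (a z - of_real e * cnj z * \<phi> z) \<le> norm (a z) + e * C"
    and gb: "norm (b z - of_real e * z * \<phi> z) \<le> norm (b z) + e * C"
    using ez by (auto intro: order_trans[OF norm_triangle_ineq4])
  have B: "norm (gauss_cutoff e z * x) \<le> 4 * C / e\<^sup>2 * decay z" if "norm x \<le> 2 * C" for x
  proof -
    have "norm (gauss_cutoff e z) * norm x \<le> (2 / e\<^sup>2 * decay z) * (2 * C)"
      by (intro mult_mono norm_gauss_cutoff_le that assms) auto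
    then show ?thesis by (simp add: norm_mult mult_ac)
  qed
  show "norm (cut e z) \<le> 4 * C / e\<^sup>2 * decay z"
    unfolding cut_def using le_phi[of z] C_nonneg by (intro B) linarith
  show "norm (cut_a e z) \<le> 4 * C / e\<^sup>2 * decay z"
    unfolding cut_a_def using ga le_C[of z] eC by (intro B) linarith
  show "norm (cut_b e z) \<le> 4 * C / e\<^sup>2 * decay z"
    unfolding cut_b_def using gb le_C[of z] eC by (intro B) linarith
  have D: "norm (gauss_cutoff e z * x) \<le> 3 * C / (1 + (cmod z)\<^sup>2)"
    if "norm x \<le> y + e * C" "y \<le> C / (1 + (cmod z)\<^sup>2)" "0 \<le> y" for x y
  proof -
    have "norm (gauss_cutoff e z) * norm x \<le> norm (gauss_cutoff e z) * (y + e * C)"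
      by (intro mult_left_mono that) auto
    also have "\<dots> = norm (gauss_cutoff e z) * y + e * norm (gauss_cutoff e z) * C"
      by (simp add: algebra_simps)
    also have "\<dots> \<le> 1 * (C / (1 + (cmod z)\<^sup>2)) + 2 / (1 + (cmod z)\<^sup>2) * C"
      by (intro add_mono mult_mono norm_gauss_cutoff_le cut1 that assms C_nonneg order_refl) (auto simp: C_nonneg)
    finally show ?thesis by (simp add: norm_mult add_divide_distrib flip: distrib_right)
  qed
  show "norm (cut_a e z) \<le> 3 * C / (1 + (cmod z)\<^sup>2)"
    unfolding cut_a_def by (rule D[OF ga le_a]) simp
  show "norm (cut_b e z) \<le> 3 * C / (1 + (cmod z)\<^sup>2)"
    unfolding cut_b_def by (rule D[OF gb le_b']) simp
qed

lemma integrable_cut: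
  assumes "0 < e" "e \<le> 1"
  shows "integrable lborel (cut e)" "integrable lborel (cut_a e)" "integrable lborel (cut_b e)"
    by (rule integrable_decay_bound[OF _ cut_bounds(1)[OF assms]], simp)
    (rule integrable_decay_bound[OF _ cut_bounds(2)[OF assms]], simp,
     rule integrable_decay_bound[OF _ cut_bounds(3)[OF assms]], simp)

text \<open>Integration by parts: the derivatives of the character times \<open>cut\<close>
  integrate to zero, and the part in which the character is differentiated supplies the
  symbol.\<close>

lemma fourier_cut:
  assumes e: "0 < e" "e \<le> 1"
  shows "fourier_integral (cut_a e) \<xi> = \<i> / 2 * cnj \<xi> * fourier_integral (cut e) \<xi>"
    "fourier_integral (cut_b e) \<xi> = \<i> / 2 * \<xi> * fourier_integral (cut e) \<xi>"
proof -
  let ?c = "\<lambda>z. cis (- (z \<bullet> \<xi>))"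
  define K where "K = 4 * C / e\<^sup>2 * (1 + norm \<xi>)"
  have K: "4 * C / e\<^sup>2 * decay z \<le> K * decay z"
    "4 * C / e\<^sup>2 * decay z + norm \<xi> * (4 * C / e\<^sup>2 * decay z) = K * decay z" for z
  proof -
    have "0 \<le> 4 * C / e\<^sup>2 * decay z * norm \<xi>" using C_nonneg by simp
    moreover have "K * decay z = 4 * C / e\<^sup>2 * decay z + 4 * C / e\<^sup>2 * decay z * norm \<xi>"
      unfolding K_def distrib_left distrib_right by (simp add: mult_ac)
    ultimately show "4 * C / e\<^sup>2 * decay z \<le> K * decay z"
      "4 * C / e\<^sup>2 * decay z + norm \<xi> * (4 * C / e\<^sup>2 * decay z) = K * decay z"
      by (simp_all add: mult.commute[of "norm \<xi>"])
  qed
  have W: "has_wirtinger (\<lambda>z. ?c z * cut e z)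
      (?c z * (cut_a e z - \<i> / 2 * cnj \<xi> * cut e z)) (?c z * (cut_b e z - \<i> / 2 * \<xi> * cut e z)) z" for z
    by (rule has_wirtinger_cong, rule has_wirtinger_mult[OF has_wirtinger_character wirtinger_cut])
      (simp_all add: algebra_simps)
  have half: "norm (x - \<i> / 2 * y * cut e z) \<le> K * decay z"
    if "norm x \<le> 4 * C / e\<^sup>2 * decay z" "norm y = norm \<xi>" for x y z
  proof -
    have "norm (\<i> / 2 * y * cut e z) \<le> norm \<xi> * norm (cut e z)"
      using that(2) by (simp add: norm_mult)
    also have "\<dots> \<le> norm \<xi> * (4 * C / e\<^sup>2 * decay z)"
      by (intro mult_left_mono cut_bounds e) auto
    finally show ?thesis
      using that(1) norm_triangle_ineq4[of x "\<i> / 2 * y * cut e z"] K(2)[of z] by linarith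
  qed
  have le: "norm (?c z * cut e z) \<le> K * decay z"
    "norm (?c z * (cut_a e z - \<i> / 2 * cnj \<xi> * cut e z)) \<le> K * decay z"
    "norm (?c z * (cut_b e z - \<i> / 2 * \<xi> * cut e z)) \<le> K * decay z" for z
    using order_trans[OF cut_bounds(1)[OF e] K(1), of z]
      half[OF cut_bounds(2)[OF e], of "cnj \<xi>" z] half[OF cut_bounds(3)[OF e], of \<xi> z]
    by (simp_all add: norm_mult)
  note z = has_bochner_integral_wirtinger_zero[OF W le]
  have split: "(LINT z|lborel. ?c z * (f z - y * cut e z)) = fourier_integral f \<xi> - y * fourier_integral (cut e) \<xi>"
    if "integrable lborel f" for f y
    using fourier_integral_diff[OF that integrable_mult_right[OF integrable_cut(1)[OF e], of y], of \<xi>]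
    unfolding fourier_integral_cmult by (simp add: fourier_integral_def)
  show "fourier_integral (cut_a e) \<xi> = \<i> / 2 * cnj \<xi> * fourier_integral (cut e) \<xi>"
    using trans[OF split[OF integrable_cut(2)[OF e], of "\<i> / 2 * cnj \<xi>", symmetric] has_bochner_integral_integral_eq[OF z(1)]]
    by (simp only: right_minus_eq)
  show "fourier_integral (cut_b e) \<xi> = \<i> / 2 * \<xi> * fourier_integral (cut e) \<xi>"
    using trans[OF split[OF integrable_cut(3)[OF e], of "\<i> / 2 * \<xi>", symmetric] has_bochner_integral_integral_eq[OF z(2)]]
    by (simp only: right_minus_eq)
qed

lemma fourier_cut_beurling:
  assumes "0 < e" "e \<le> 1" "\<xi> \<noteq> 0"
  shows "fourier_integral (cut_a e) \<xi> = beurling_symbol \<xi> * fourier_integral (cut_b e) \<xi>"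
  using assms by (simp add: fourier_cut beurling_symbol_eq)

lemma cut_tendsto:
  "(\<lambda>k. cut_a (1 / real (Suc k)) z) \<longlonglongrightarrow> a z" "(\<lambda>k. cut_b (1 / real (Suc k)) z) \<longlonglongrightarrow> b z"
proof -
  have 0: "(\<lambda>k. 1 / real (Suc k)) \<longlonglongrightarrow> 0"
    using LIMSEQ_inverse_real_of_nat by (simp add: inverse_eq_divide)
  have "(\<lambda>k. cut_a (1 / real (Suc k)) z) \<longlonglongrightarrow> of_real (exp (- (0 * (cmod z)\<^sup>2))) * (a z - of_real 0 * cnj z * \<phi> z)"
    unfolding cut_a_def gauss_cutoff_eq by (intro tendsto_intros 0)
  then show "(\<lambda>k. cut_a (1 / real (Suc k)) z) \<longlonglongrightarrow> a z" by simp
  have "(\<lambda>k. cut_b (1 / real (Suc k)) z) \<longlonglongrightarrow> of_real (exp (- (0 * (cmod z)\<^sup>2))) * (b z - of_real 0 * z * \<phi> z)"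
    unfolding cut_b_def gauss_cutoff_eq by (intro tendsto_intros 0)
  then show "(\<lambda>k. cut_b (1 / real (Suc k)) z) \<longlonglongrightarrow> b z" by simp
qed

text \<open>\<open>a\<close> decays only like \<open>|z|\<^sup>-\<^sup>2\<close> and need not be integrable, so its transform is reached
  through the Gaussian cutoffs, for which the relation with the transform of \<open>b\<close> is an
  integration by parts.\<close>

lemma is_fourier_multiplier_beurling:
  "is_fourier_multiplier (\<lambda>\<xi>. c * beurling_symbol \<xi>) b (\<lambda>z. c * a z)"
  unfolding is_fourier_multiplier_def
proof (intro exI conjI)
  let ?F = "fourier_integral b"
  let ?\<epsilon> = "\<lambda>k. 1 / real (Suc k)"
  have \<epsilon>: "0 < ?\<epsilon> k" "?\<epsilon> k \<le> 1" for k by simp_all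
  show L2b: "has_L2_fourier b ?F"
    by (rule has_L2_fourier_integrable[OF cont_b le_b C_nonneg])
  have b_int: "integrable lborel b" by (rule integrable_decay_bound[OF _ le_b]) simp
  have sq_ca: "square_integrable (\<lambda>z. c * a z)"
  proof (rule square_integrable_decay)
    show "norm (c * a z) \<le> (norm c * C) / (1 + (cmod z)\<^sup>2)" for z
      using mult_left_mono[OF le_a[of z], of "norm c"] by (simp add: norm_mult)
  qed measurable
  have bF_le: "(norm (c * beurling_symbol \<xi> * x))\<^sup>2 \<le> (norm c)\<^sup>2 * (norm x)\<^sup>2" for \<xi> x
  proof -
    have "norm (c * beurling_symbol \<xi> * x) \<le> norm c * 1 * norm x"
      unfolding norm_mult by (intro mult_mono norm_beurling_symbol_le) auto
    then have "(norm (c * beurling_symbol \<xi> * x))\<^sup>2 \<le> (norm c * 1 * norm x)\<^sup>2"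
      by (intro power_mono) auto
    then show ?thesis by (simp add: power_mult_distrib)
  qed
  have sq_F: "square_integrable (\<lambda>\<xi>. c * beurling_symbol \<xi> * ?F \<xi>)"
    unfolding square_integrable_def
  proof
    show "integrable lborel (\<lambda>\<xi>. (norm (c * beurling_symbol \<xi> * ?F \<xi>))\<^sup>2)"
    proof (rule Bochner_Integration.integrable_bound)
      show "integrable lborel (\<lambda>\<xi>. (norm c)\<^sup>2 * (norm (?F \<xi>))\<^sup>2)"
        using L2b by (auto simp: has_L2_fourier_def square_integrable_def)
    qed (use bF_le in auto)
  qed measurable
  define M where "M = ennreal (2 * (norm c)\<^sup>2 * (2 * pi)\<^sup>2)"
  have M_eq: "M = ennreal (2 * (norm c)\<^sup>2) * ennreal ((2 * pi)\<^sup>2)"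
    unfolding M_def by (intro ennreal_mult) auto
  let ?E = "\<lambda>R. \<integral>\<^sup>+\<xi>. ennreal ((norm (c * beurling_symbol \<xi> * ?F \<xi> - fourier_integral (truncate R (\<lambda>z. c * a z)) \<xi>))\<^sup>2) \<partial>lborel"
  have key: "?E R \<le> M * (\<integral>\<^sup>+z. ennreal ((norm (a z - truncate R a z))\<^sup>2) \<partial>lborel)" for R
  proof -
    let ?T = "truncate R a"
    have T_int: "integrable lborel ?T" by (rule integrable_truncate[OF cont_a])
    have T_eq: "truncate R (\<lambda>z. c * a z) = (\<lambda>z. c * ?T z)"
      by (auto simp: truncate_def fun_eq_iff)
    let ?B = "\<lambda>k. \<integral>\<^sup>+z. ennreal ((norm (b z - cut_b (?\<epsilon> k) z))\<^sup>2) \<partial>lborel"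
    let ?A = "\<lambda>k. \<integral>\<^sup>+z. ennreal ((norm (cut_a (?\<epsilon> k) z - ?T z))\<^sup>2) \<partial>lborel"
    \<comment> \<open>The transforms of the cutoffs are inserted between those of \<open>b\<close>
      and of the truncated \<open>a\<close>. By \<open>fourier_cut_beurling\<close> the two
      insertions cancel away from \<open>\<xi> = 0\<close>, a null set, and the Plancherel
      inequality bounds the two remaining differences.\<close>
    have step: "?E R \<le> M * (?B k + ?A k)" for k
    proof -
      note ints = integrable_cut[OF \<epsilon>, of k]
      let ?x = "\<lambda>\<xi>. fourier_integral (\<lambda>z. b z - cut_b (?\<epsilon> k) z) \<xi>"
      let ?y = "\<lambda>\<xi>. fourier_integral (\<lambda>z. cut_a (?\<epsilon> k) z - ?T z) \<xi>"
      have "?E R \<le> (\<integral>\<^sup>+\<xi>. ennreal (2 * (norm c)\<^sup>2) * (ennreal ((norm (?x \<xi>))\<^sup>2) + ennreal ((norm (?y \<xi>))\<^sup>2)) \<partial>lborel)"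
      proof (rule nn_integral_mono_AE)
        have "AE \<xi> in lborel. \<xi> \<noteq> (0::complex)" by (rule AE_lborel_singleton)
        then show "AE \<xi> in lborel. ennreal ((norm (c * beurling_symbol \<xi> * ?F \<xi> - fourier_integral (truncate R (\<lambda>z. c * a z)) \<xi>))\<^sup>2)
            \<le> ennreal (2 * (norm c)\<^sup>2) * (ennreal ((norm (?x \<xi>))\<^sup>2) + ennreal ((norm (?y \<xi>))\<^sup>2))"
        proof eventually_elim
          fix \<xi> :: complex assume \<xi>: "\<xi> \<noteq> 0"
          have "c * beurling_symbol \<xi> * ?F \<xi> - fourier_integral (truncate R (\<lambda>z. c * a z)) \<xi>
              = c * beurling_symbol \<xi> * ?x \<xi> + c * ?y \<xi>"
            unfolding T_eq fourier_integral_cmult fourier_integral_diff[OF b_int ints(3)]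
              fourier_integral_diff[OF ints(2) T_int] fourier_cut_beurling[OF \<epsilon> \<xi>]
            by (simp add: algebra_simps)
          moreover have "(norm (p + q))\<^sup>2 \<le> 2 * (norm p)\<^sup>2 + 2 * (norm q)\<^sup>2" for p q :: complex
          proof -
            have "(norm (p + q))\<^sup>2 \<le> (norm p + norm q)\<^sup>2" by (intro power_mono norm_triangle_ineq) auto
            also have "\<dots> \<le> 2 * (norm p)\<^sup>2 + 2 * (norm q)\<^sup>2"
              using sum_squares_bound[of "norm p" "norm q"] by (simp add: power2_sum)
            finally show ?thesis .
          qed
          ultimately have "(norm (c * beurling_symbol \<xi> * ?F \<xi> - fourier_integral (truncate R (\<lambda>z. c * a z)) \<xi>))\<^sup>2
              \<le> 2 * (norm (c * beurling_symbol \<xi> * ?x \<xi>))\<^sup>2 + 2 * (norm (c * ?y \<xi>))\<^sup>2" by metis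
          also have "\<dots> \<le> 2 * ((norm c)\<^sup>2 * (norm (?x \<xi>))\<^sup>2) + 2 * ((norm c)\<^sup>2 * (norm (?y \<xi>))\<^sup>2)"
            using bF_le[of \<xi> "?x \<xi>"] by (simp add: norm_mult power_mult_distrib)
          also have "\<dots> = 2 * (norm c)\<^sup>2 * ((norm (?x \<xi>))\<^sup>2 + (norm (?y \<xi>))\<^sup>2)"
            by (simp add: algebra_simps)
          finally show "ennreal ((norm (c * beurling_symbol \<xi> * ?F \<xi> - fourier_integral (truncate R (\<lambda>z. c * a z)) \<xi>))\<^sup>2)
            \<le> ennreal (2 * (norm c)\<^sup>2) * (ennreal ((norm (?x \<xi>))\<^sup>2) + ennreal ((norm (?y \<xi>))\<^sup>2))"
            by (simp add: ennreal_leI flip: ennreal_mult ennreal_plus)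
        qed
      qed
      also have "\<dots> = ennreal (2 * (norm c)\<^sup>2) * ((\<integral>\<^sup>+\<xi>. ennreal ((norm (?x \<xi>))\<^sup>2) \<partial>lborel) + (\<integral>\<^sup>+\<xi>. ennreal ((norm (?y \<xi>))\<^sup>2) \<partial>lborel))"
        by (subst nn_integral_cmult) (simp_all add: nn_integral_add)
      also have "\<dots> \<le> ennreal (2 * (norm c)\<^sup>2) * (ennreal ((2 * pi)\<^sup>2) * ?B k + ennreal ((2 * pi)\<^sup>2) * ?A k)"
        by (intro mult_left_mono add_mono plancherel_inequality Bochner_Integration.integrable_diff b_int ints T_int) auto
      also have "\<dots> = M * (?B k + ?A k)"
        unfolding M_eq by (simp only: distrib_left mult.assoc)
      finally show ?thesis .
    qed
    have "?B \<longlonglongrightarrow> (\<integral>\<^sup>+z. ennreal ((norm (0::complex))\<^sup>2) \<partial>(lborel :: complex measure))"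
    proof (rule tendsto_L2_dominated[where C = "4 * C"])
      show "(\<lambda>k. b z - cut_b (?\<epsilon> k) z) \<longlonglongrightarrow> 0" for z
        using tendsto_diff[OF tendsto_const[of "b z"] cut_tendsto(2)[of z]] by simp
      show "norm (b z - cut_b (?\<epsilon> k) z) \<le> 4 * C / (1 + (cmod z)\<^sup>2)" for k z
        using norm_triangle_ineq4[of "b z" "cut_b (?\<epsilon> k) z"] le_b'[of z] cut_bounds(5)[OF \<epsilon>, of k z]
          add_divide_distrib[of "3 * C" C "1 + (cmod z)\<^sup>2"]
        by simp
    qed auto
    moreover have "?A \<longlonglongrightarrow> (\<integral>\<^sup>+z. ennreal ((norm (a z - ?T z))\<^sup>2) \<partial>lborel)"
    proof (rule tendsto_L2_dominated[where C = "4 * C"])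
      show "(\<lambda>k. cut_a (?\<epsilon> k) z - ?T z) \<longlonglongrightarrow> a z - ?T z" for z
        by (intro tendsto_intros cut_tendsto)
      show "norm (cut_a (?\<epsilon> k) z - ?T z) \<le> 4 * C / (1 + (cmod z)\<^sup>2)" for k z
        using norm_triangle_ineq4[of "cut_a (?\<epsilon> k) z" "?T z"] le_a[of z] cut_bounds(4)[OF \<epsilon>, of k z]
          norm_truncate_le[of R a z] add_divide_distrib[of "3 * C" C "1 + (cmod z)\<^sup>2"]
        by simp
    qed auto
    \<comment> \<open>The cutoff is removed while \<open>R\<close> is fixed, which leaves only the
      part of \<open>a\<close> outside the disc; \<open>R\<close> grows afterwards.\<close>
    ultimately have "(\<lambda>k. ?B k + ?A k) \<longlonglongrightarrow> 0 + (\<integral>\<^sup>+z. ennreal ((norm (a z - ?T z))\<^sup>2) \<partial>lborel)"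
      by (intro tendsto_add) simp_all
    then have "(\<lambda>k. M * (?B k + ?A k)) \<longlonglongrightarrow> M * (\<integral>\<^sup>+z. ennreal ((norm (a z - ?T z))\<^sup>2) \<partial>lborel)"
      by (intro ennreal_tendsto_cmult) (simp_all add: M_def)
    then show ?thesis
      by (rule LIMSEQ_le_const) (use step in blast)
  qed
  have "(?E \<longlongrightarrow> 0) at_top"
  proof (rule tendsto_sandwich[OF _ _ tendsto_const])
    show "\<forall>\<^sub>F R in at_top. ?E R \<le> M * (\<integral>\<^sup>+z. ennreal ((norm (a z - truncate R a z))\<^sup>2) \<partial>lborel)"
      using key by (intro always_eventually) blast
    have "((\<lambda>R. M * (\<integral>\<^sup>+z. ennreal ((norm (a z - truncate R a z))\<^sup>2) \<partial>lborel)) \<longlongrightarrow> M * 0) at_top"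
      by (intro ennreal_tendsto_cmult truncate_L2_tendsto[OF _ le_a]) (simp_all add: M_def)
    then show "((\<lambda>R. M * (\<integral>\<^sup>+z. ennreal ((norm (a z - truncate R a z))\<^sup>2) \<partial>lborel)) \<longlongrightarrow> 0) at_top" by simp
  qed auto
  then show "has_L2_fourier (\<lambda>z. c * a z) (\<lambda>\<xi>. c * beurling_symbol \<xi> * ?F \<xi>)"
    using sq_ca sq_F by (simp add: has_L2_fourier_def truncate_def[abs_def])
qed

text \<open>A smooth version of the flux through large circles. Since \<open>cut_b\<close> has
  integral zero, the Gaussian mean of \<open>b\<close> equals e times the Gaussian mean of z phi.
  Rescaling by 1/sqrt e turns the latter into the integral of exp (-|z|^2) against z phi at ever
  larger arguments, which tends to pi L.\<close>

lemma has_bochner_integral_flux: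
  assumes lim: "((\<lambda>z. z * \<phi> z) \<longlongrightarrow> L) at_infinity"
  shows "has_bochner_integral lborel b (of_real pi * L)"
proof -
  \<comment> \<open>Squared so that the rescaling factor 1/sqrt e is the number k + 1.\<close>
  let ?\<epsilon> = "\<lambda>k. (1 / real (Suc k))\<^sup>2"
  have \<epsilon>: "0 < ?\<epsilon> k" "?\<epsilon> k \<le> 1" for k by (simp_all add: power_le_one)
  have \<epsilon>0: "?\<epsilon> \<longlonglongrightarrow> 0"
    using tendsto_power[OF LIMSEQ_inverse_real_of_nat, of 2] by (simp add: inverse_eq_divide)
  have b_int: "integrable lborel b" by (rule integrable_decay_bound[OF _ le_b]) simp
  have gm [measurable]: "gauss_cutoff e \<in> borel_measurable borel" for e
    unfolding gauss_cutoff_eq by (intro borel_measurable_continuous_onI continuous_intros)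
  have bal: "(LINT z|lborel. gauss_cutoff (?\<epsilon> k) z * b z)
      = (LINT z|lborel. of_real (?\<epsilon> k) * gauss_cutoff (?\<epsilon> k) z * (z * \<phi> z))" for k
  proof -
    \<comment> \<open>At frequency 0 the symbol vanishes, and the Fourier integral is the plain
      integral.\<close>
    have "(LINT z|lborel. cut_b (?\<epsilon> k) z) = 0"
      using fourier_cut(2)[OF \<epsilon>, of k 0] by (simp add: fourier_integral_def)
    moreover have i1: "integrable lborel (\<lambda>z. gauss_cutoff (?\<epsilon> k) z * b z)"
      by (rule Bochner_Integration.integrable_bound[OF b_int])
        (auto simp: norm_mult norm_gauss_cutoff intro!: mult_left_le_one_le)
    moreover have "integrable lborel (\<lambda>z. gauss_cutoff (?\<epsilon> k) z * b z - cut_b (?\<epsilon> k) z)"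
      by (intro Bochner_Integration.integrable_diff i1 integrable_cut \<epsilon>)
    moreover have "(\<lambda>z. gauss_cutoff (?\<epsilon> k) z * b z - cut_b (?\<epsilon> k) z)
        = (\<lambda>z. of_real (?\<epsilon> k) * gauss_cutoff (?\<epsilon> k) z * (z * \<phi> z))"
      by (auto simp: cut_b_def fun_eq_iff algebra_simps)
    ultimately show ?thesis
      using Bochner_Integration.integral_diff[OF i1 integrable_cut(3)[OF \<epsilon>, of k]] by simp
  qed
  have "(\<lambda>k. LINT z|lborel. gauss_cutoff (?\<epsilon> k) z * b z) \<longlonglongrightarrow> (LINT z|lborel. b z)"
  proof (rule integral_dominated_convergence[where w = "\<lambda>z. norm (b z)"])
    show "AE z in lborel. (\<lambda>k. gauss_cutoff (?\<epsilon> k) z * b z) \<longlonglongrightarrow> b z"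
    proof (rule AE_I2)
      fix z
      have "(\<lambda>k. gauss_cutoff (?\<epsilon> k) z * b z) \<longlonglongrightarrow> of_real (exp (- (0 * (cmod z)\<^sup>2))) * b z"
        unfolding gauss_cutoff_eq by (intro tendsto_intros \<epsilon>0)
      then show "(\<lambda>k. gauss_cutoff (?\<epsilon> k) z * b z) \<longlonglongrightarrow> b z" by simp
    qed
  qed (auto simp: b_int norm_mult norm_gauss_cutoff intro!: integrable_norm mult_left_le_one_le)
  moreover have "(\<lambda>k. LINT z|lborel. of_real (?\<epsilon> k) * gauss_cutoff (?\<epsilon> k) z * (z * \<phi> z)) \<longlonglongrightarrow> of_real pi * L"
  proof -
    let ?g = "\<lambda>k z. gauss_cutoff 1 z * (real (Suc k) *\<^sub>R z * \<phi> (real (Suc k) *\<^sub>R z))"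
    have dom: "integrable lborel (\<lambda>z. C * norm (gauss_cutoff 1 z))"
      by (intro integrable_mult_right integrable_decay_bound[where C = 2])
        (use norm_gauss_cutoff_le(1)[of 1] in auto)
    have g_le: "norm (?g k z) \<le> C * norm (gauss_cutoff 1 z)" for k z
      using mult_right_mono[OF le_z_phi[of "real (Suc k) *\<^sub>R z"], of "norm (gauss_cutoff 1 z)"]
      by (simp add: norm_mult mult_ac)
    have g_meas [measurable]: "?g k \<in> borel_measurable borel" for k by measurable
    have g_int: "integrable lborel (?g k)" for k
    proof (rule Bochner_Integration.integrable_bound[OF dom])
      show "AE z in lborel. norm (?g k z) \<le> norm (C * norm (gauss_cutoff 1 z))"
        unfolding real_norm_def by (rule AE_I2, rule order_trans[OF g_le abs_ge_self])
    qed simp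
    have scale: "(LINT z|lborel. of_real (?\<epsilon> k) * gauss_cutoff (?\<epsilon> k) z * (z * \<phi> z)) = (LINT z|lborel. ?g k z)" for k
    proof -
      let ?n = "real (Suc k)"
      have eq: "?n\<^sup>2 *\<^sub>R (of_real (?\<epsilon> k) * gauss_cutoff (?\<epsilon> k) (?n *\<^sub>R z) * (?n *\<^sub>R z * \<phi> (?n *\<^sub>R z))) = ?g k z" for z
      proof -
        have "?\<epsilon> k * (cmod (?n *\<^sub>R z))\<^sup>2 = 1 * (cmod z)\<^sup>2" "?n\<^sup>2 * ?\<epsilon> k = 1"
          by (simp_all add: power_mult_distrib power_divide)
        moreover from this(2) have "complex_of_real (?n\<^sup>2) * of_real (?\<epsilon> k) = 1"
          by (simp only: flip: of_real_mult) simp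
        ultimately show ?thesis
          unfolding gauss_cutoff_eq scaleR_conv_of_real[of "?n\<^sup>2"] by (simp only: flip: mult.assoc) simp
      qed
      have "has_bochner_integral lborel
          (\<lambda>z. ?n\<^sup>2 *\<^sub>R (of_real (?\<epsilon> k) * gauss_cutoff (?\<epsilon> k) (?n *\<^sub>R z) * (?n *\<^sub>R z * \<phi> (?n *\<^sub>R z))))
          (LINT z|lborel. ?g k z)"
        unfolding eq by (rule has_bochner_integral_integrable[OF g_int])
      then have "has_bochner_integral lborel (\<lambda>z. of_real (?\<epsilon> k) * gauss_cutoff (?\<epsilon> k) z * (z * \<phi> z)) (LINT z|lborel. ?g k z)"
        by (rule has_bochner_integral_complex_scale[of ?n, rotated 2]) simp_all
      then show ?thesis by (rule has_bochner_integral_integral_eq)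
    qed
    have "(\<lambda>k. LINT z|lborel. ?g k z) \<longlonglongrightarrow> (LINT z|lborel. gauss_cutoff 1 z * L)"
    proof (rule integral_dominated_convergence[OF _ _ dom])
      \<comment> \<open>Dilation sends every point to infinity except the origin.\<close>
      have "AE z in lborel. z \<noteq> (0::complex)" by (rule AE_lborel_singleton)
      then show "AE z in lborel. (\<lambda>k. ?g k z) \<longlonglongrightarrow> gauss_cutoff 1 z * L"
      proof eventually_elim
        fix z :: complex assume z: "z \<noteq> 0"
        have "filterlim (\<lambda>k. real (Suc k) * norm z) at_top sequentially"
          by (rule filterlim_at_top_mult_tendsto_pos[OF tendsto_const _ filterlim_compose[OF filterlim_real_sequentially filterlim_Suc]])
            (use z in simp)
        then have "filterlim (\<lambda>k. real (Suc k) *\<^sub>R z) at_infinity sequentially"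
          by (subst filterlim_at_infinity_conv_norm_at_top) simp
        from filterlim_compose[OF lim this]
        have "(\<lambda>k. real (Suc k) *\<^sub>R z * \<phi> (real (Suc k) *\<^sub>R z)) \<longlonglongrightarrow> L" .
        then show "(\<lambda>k. ?g k z) \<longlonglongrightarrow> gauss_cutoff 1 z * L"
          by (rule tendsto_mult[OF tendsto_const])
      qed
      show "AE z in lborel. norm (?g k z) \<le> C * norm (gauss_cutoff 1 z)" for k
        using g_le by blast
    qed simp_all
    moreover have "(LINT z|lborel. gauss_cutoff 1 z * L) = of_real pi * L"
    proof -
      have "has_bochner_integral lborel (gauss_cutoff 1) (of_real pi)"
      proof (rule has_bochner_integral_complex_scale[of "1 / sqrt 2"])
        have "has_bochner_integral lborel (\<lambda>z. (1/2) * (cis (- (z \<bullet> 0)) * of_real (exp (- (cmod z)\<^sup>2 / 2))))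
            ((1/2) * of_real (2 * pi * exp (- (cmod 0)\<^sup>2 / 2)))"
          by (intro has_bochner_integral_mult_right gaussian_2d)
        moreover have "(1/2) * (cis (- (z \<bullet> 0)) * of_real (exp (- (cmod z)\<^sup>2 / 2)))
            = (1 / sqrt 2)\<^sup>2 *\<^sub>R gauss_cutoff 1 ((1 / sqrt 2) *\<^sub>R z)" for z
          by (simp add: gauss_cutoff_eq scaleR_conv_of_real power_divide norm_divide)
        ultimately show "has_bochner_integral lborel (\<lambda>z. (1 / sqrt 2)\<^sup>2 *\<^sub>R gauss_cutoff 1 ((1 / sqrt 2) *\<^sub>R z)) (of_real pi)"
          by (simp only:) simp
      qed simp_all
      then show ?thesis by (simp add: has_bochner_integral_iff)
    qed
    ultimately show ?thesis by (simp only: scale)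
  qed
  ultimately have "(LINT z|lborel. b z) = of_real pi * L"
    by (simp only: bal) (rule LIMSEQ_unique)
  then show ?thesis using b_int by (simp add: has_bochner_integral_iff)
qed

end

section \<open>The stationary identities for a polynomial\<close>

lemma has_wirtinger_poly: "has_wirtinger (poly q) (poly (pderiv q) z) 0 z"
  by (rule has_wirtinger_holomorphic[OF poly_DERIV])

locale poly_profile =
  fixes p :: "complex poly"
begin

abbreviation "f \<equiv> poly p"
abbreviation "f1 \<equiv> poly (pderiv p)"
abbreviation "f2 \<equiv> poly (pderiv (pderiv p))"
abbreviation "f3 \<equiv> poly (pderiv (pderiv (pderiv p)))"
abbreviation "f4 \<equiv> poly (pderiv (pderiv (pderiv (pderiv p))))"

text \<open>The reciprocal of \<open>\<tau>\<close>. Kept as one symbol, it makes all derivatives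
  polynomial expressions in \<open>s\<close>, the derivatives of \<open>f\<close> and conjugates,
  with \<open>s_rel\<close> to eliminate \<open>s\<close>.\<close>

definition s :: "complex \<Rightarrow> complex" where "s z = inverse (1 + f z * cnj (f z))"

definition Q where "Q z = - 8 * (cmod (f1 z))\<^sup>2 / (1 + (cmod (f z))\<^sup>2)\<^sup>2"
text \<open>The complex-valued copy of \<open>Q\<close> (see \<open>V_eq\<close>), to which the
  Wirtinger rules apply; \<open>V1\<close> and \<open>V2\<close> are its first and second
  z-derivatives.\<close>

definition V where "V z = - 8 * f1 z * cnj (f1 z) * (s z)\<^sup>2"
definition V1 where "V1 z = - 8 * cnj (f1 z) * (f2 z * (s z)\<^sup>2 - 2 * (f1 z)\<^sup>2 * cnj (f z) * (s z)^3)"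
definition W where "W z = 24 * (f2 z * cnj (f z) * s z - (f1 z)\<^sup>2 * (cnj (f z))\<^sup>2 * (s z)\<^sup>2)"
definition V2 where "V2 z = - 8 * f3 z * cnj (f1 z) * (s z)\<^sup>2 - V z * W z / 4"
text \<open>The z-derivative of -64 f3 (cnj f1) s^2. Both sides of the evolution equation will be
  brought to the form \<open>Y z + cnj (Y z)\<close>.\<close>

definition Y where "Y z = - 64 * (f4 z * cnj (f1 z) * (s z)\<^sup>2 - 2 * f1 z * f3 z * cnj (f1 z) * cnj (f z) * (s z)^3)"
definition phi where "phi z = f1 z * cnj (f z) * s z"

lemma s_eq: "s z = of_real (inverse (1 + (cmod (f z))\<^sup>2))"
  unfolding s_def complex_norm_square[symmetric] by simp

lemma s_rel: "s z * (1 + f z * cnj (f z)) = 1"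
proof -
  have "1 + f z * cnj (f z) = of_real (1 + (cmod (f z))\<^sup>2)"
    unfolding complex_norm_square[symmetric] by simp
  then have "1 + f z * cnj (f z) \<noteq> 0" by (metis one_plus_cmod_sq(2) of_real_eq_0_iff)
  then show ?thesis by (simp add: s_def)
qed

lemma cnj_s [simp]: "cnj (s z) = s z"
  by (simp add: s_eq)

lemma V_eq: "V z = of_real (Q z)"
proof -
  have "V z = - 8 * of_real ((cmod (f1 z))\<^sup>2) * (s z)\<^sup>2"
    unfolding complex_norm_square V_def by (simp add: mult_ac)
  then show ?thesis by (simp add: s_eq Q_def divide_inverse power_inverse)
qed

lemma cnj_V [simp]: "cnj (V z) = V z"
  by (simp add: V_eq)

lemma has_wirtinger_s: "has_wirtinger s (- f1 z * cnj (f z) * (s z)\<^sup>2) (- f z * cnj (f1 z) * (s z)\<^sup>2) z"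
proof -
  have "1 + f z * cnj (f z) \<noteq> 0" using s_rel[of z] by auto
  then show ?thesis
    unfolding s_def
    by (intro has_wirtinger_cong[OF has_wirtinger_inverse[OF has_wirtinger_add[OF has_wirtinger_const
        has_wirtinger_mult[OF has_wirtinger_poly has_wirtinger_cnj[OF has_wirtinger_poly]]]]])
      (auto simp: divide_inverse power_inverse)
qed

lemma has_wirtinger_sq:
  assumes "has_wirtinger g a b z"
  shows "has_wirtinger (\<lambda>z. (g z)\<^sup>2) (2 * g z * a) (2 * g z * b) z"
  unfolding power2_eq_square by (rule has_wirtinger_cong[OF has_wirtinger_mult[OF assms assms]]) auto

lemma has_wirtinger_phi: "has_wirtinger phi (W z / 24) (- V z / 8) z"
proof -
  note c = has_wirtinger_cnj[OF has_wirtinger_poly]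
  show ?thesis
    unfolding phi_def
    apply (rule has_wirtinger_cong[OF has_wirtinger_mult[OF has_wirtinger_mult[OF has_wirtinger_poly c] has_wirtinger_s]])
    subgoal by (simp add: W_def power2_eq_square algebra_simps)
    \<comment> \<open>The rules give |f1|^2 s (1 - |f|^2 s), and the bracket equals \<open>s\<close>
      by \<open>s_rel\<close>.\<close>
    subgoal using s_rel[of z] unfolding V_def complex_cnj_zero power2_eq_square by algebra
    done
qed

lemma has_wirtinger_s2:
  "has_wirtinger (\<lambda>z. (s z)\<^sup>2) (- 2 * f1 z * cnj (f z) * (s z)^3) (- 2 * f z * cnj (f1 z) * (s z)^3) z"
  by (rule has_wirtinger_cong[OF has_wirtinger_sq[OF has_wirtinger_s]])
    (simp_all add: power2_eq_square power3_eq_cube mult_ac)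

lemma has_wirtinger_s3:
  "has_wirtinger (\<lambda>z. (s z)^3) (- 3 * f1 z * cnj (f z) * (s z)^4) (- 3 * f z * cnj (f1 z) * (s z)^4) z"
proof -
  have e: "(\<lambda>z. (s z)^3) = (\<lambda>z. (s z)\<^sup>2 * s z)"
    by (simp add: fun_eq_iff power2_eq_square power3_eq_cube)
  show ?thesis unfolding e
    by (rule has_wirtinger_cong[OF has_wirtinger_mult[OF has_wirtinger_s2 has_wirtinger_s]])
      (simp_all add: eval_nat_numeral algebra_simps)
qed

lemmas has_wirtinger_poly_cnj = has_wirtinger_cnj[OF has_wirtinger_poly]

lemma has_wirtinger_V: "has_wirtinger V (V1 z) (cnj (V1 z)) z"
  unfolding V_def
  by (rule has_wirtinger_cong[OF has_wirtinger_mult[OF has_wirtinger_mult[OF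
        has_wirtinger_cmult[OF has_wirtinger_poly] has_wirtinger_poly_cnj] has_wirtinger_s2]])
    (simp_all add: V1_def algebra_simps power2_eq_square)

lemma has_wirtinger_V1: "\<exists>b. has_wirtinger V1 (V2 z) b z"
proof -
  have e: "V1 = (\<lambda>z. cnj (f1 z) * (- 8 * (f2 z * (s z)\<^sup>2) + 16 * ((f1 z)\<^sup>2 * cnj (f z) * (s z)^3)))"
    by (auto simp: V1_def fun_eq_iff algebra_simps)
  show ?thesis
    unfolding e
    by (rule exI, rule has_wirtinger_cong[OF has_wirtinger_mult[OF has_wirtinger_poly_cnj
          has_wirtinger_add[OF has_wirtinger_cmult[OF has_wirtinger_mult[OF has_wirtinger_poly has_wirtinger_s2]]
          has_wirtinger_cmult[OF has_wirtinger_mult[OF has_wirtinger_mult[OF has_wirtinger_sq[OF has_wirtinger_poly]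
          has_wirtinger_poly_cnj] has_wirtinger_s3]]]] _ refl])
      (simp add: V2_def V_def W_def field_simps eval_nat_numeral)
qed

text \<open>The value is what equality of the mixed derivatives of \<open>phi\<close> predicts: its
  z-derivative is W/24 and its zbar-derivative -V/8.\<close>

lemma has_wirtinger_W: "\<exists>a. has_wirtinger W a (- 3 * V1 z) z"
proof -
  have e: "W = (\<lambda>z. 24 * (f2 z * cnj (f z) * s z + (-1) * ((f1 z)\<^sup>2 * (cnj (f z))\<^sup>2 * (s z)\<^sup>2)))"
    by (auto simp: W_def fun_eq_iff algebra_simps)
  \<comment> \<open>The left side is spelled exactly as the sum and product rules will produce the
    zbar-component, so that \<open>has_wirtinger_cong\<close> can replace it.\<close>
  have "24 * (((0 * cnj (f z) + f2 z * cnj (f1 z)) * s z + f2 z * cnj (f z) * (- f z * cnj (f1 z) * (s z)\<^sup>2))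
      + (-1) * ((2 * f1 z * 0 * (cnj (f z))\<^sup>2 + (f1 z)\<^sup>2 * (2 * cnj (f z) * cnj (f1 z))) * (s z)\<^sup>2
        + (f1 z)\<^sup>2 * (cnj (f z))\<^sup>2 * (- 2 * f z * cnj (f1 z) * (s z)^3))) = - 3 * V1 z"
    using s_rel[of z] unfolding V1_def power2_eq_square power3_eq_cube by algebra
  from has_wirtinger_cong[OF has_wirtinger_cmult[OF has_wirtinger_add[OF
          has_wirtinger_mult[OF has_wirtinger_mult[OF has_wirtinger_poly has_wirtinger_poly_cnj] has_wirtinger_s]
          has_wirtinger_cmult[OF has_wirtinger_mult[OF has_wirtinger_mult[OF has_wirtinger_sq[OF has_wirtinger_poly]
          has_wirtinger_sq[OF has_wirtinger_poly_cnj]] has_wirtinger_s2]]]] refl this]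
  show ?thesis unfolding e by blast
qed

text \<open>The nonlinear term is absorbed: \<open>8 \<partial>\<^sub>z\<^sup>2 V + 2 V W = - 64 f\<^sub>3 (cnj f\<^sub>1) s\<^sup>2\<close>.\<close>

lemma has_wirtinger_VW:
  obtains a b where "has_wirtinger (\<lambda>z. V z * W z) a b z" "\<exists>b. has_wirtinger V2 ((Y z - 2 * a) / 8) b z"
proof -
  obtain a where a: "has_wirtinger W a (- 3 * V1 z) z" using has_wirtinger_W by blast
  note VW = has_wirtinger_mult[OF has_wirtinger_V a]
  have e: "V2 = (\<lambda>z. - 8 * (f3 z * cnj (f1 z) * (s z)\<^sup>2) + (- 1 / 4) * (V z * W z))"
    by (auto simp: V2_def fun_eq_iff algebra_simps)
  have "\<exists>b. has_wirtinger V2 ((Y z - 2 * (V1 z * W z + V z * a)) / 8) b z"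
    unfolding e
    by (rule exI, rule has_wirtinger_cong[OF has_wirtinger_add[OF has_wirtinger_cmult[OF has_wirtinger_mult[OF
          has_wirtinger_mult[OF has_wirtinger_poly has_wirtinger_poly_cnj] has_wirtinger_s2]]
          has_wirtinger_cmult[OF VW]] _ refl])
      (simp add: Y_def field_simps)
  with VW show thesis by (rule that)
qed

lemma d_z_V: "d_z V = V1" and d_zbar_V: "d_zbar V = (\<lambda>z. cnj (V1 z))"
  using has_wirtinger_V by (auto simp: fun_eq_iff dest: has_wirtinger_d_z has_wirtinger_d_zbar)

lemma d_z_V1: "d_z V1 = V2" and d_zbar_V1: "d_zbar (\<lambda>z. cnj (V1 z)) = (\<lambda>z. cnj (V2 z))"
  using has_wirtinger_V1
  by (metis has_wirtinger_d_z ext, metis has_wirtinger_d_zbar has_wirtinger_cnj)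

lemma d_zbar_W: "d_zbar W z = - 3 * V1 z"
  using has_wirtinger_W by (metis has_wirtinger_d_zbar)

text \<open>The derivative \<open>a\<close> of the product \<open>V W\<close> stays unevaluated: it
  cancels between 8 (Y - 2 a) / 8 and 2 a. The zbar-terms are the conjugates of the z-terms because
  \<open>V\<close> is real.\<close>

lemma novikov_veselov_rhs:
  "8 * (d_z (d_z (d_z V)) z + d_zbar (d_zbar (d_zbar V)) z)
    + 2 * d_z (\<lambda>\<zeta>. V \<zeta> * W \<zeta>) z + 2 * d_zbar (\<lambda>\<zeta>. V \<zeta> * cnj (W \<zeta>)) z = Y z + cnj (Y z)"
proof -
  obtain a b where VW: "has_wirtinger (\<lambda>z. V z * W z) a b z"
    and V2: "\<exists>b. has_wirtinger V2 ((Y z - 2 * a) / 8) b z" by (rule has_wirtinger_VW)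
  from V2 obtain b' where b': "has_wirtinger V2 ((Y z - 2 * a) / 8) b' z" by blast
  have 1: "d_z (d_z (d_z V)) z = (Y z - 2 * a) / 8"
    unfolding d_z_V d_z_V1 by (rule has_wirtinger_d_z[OF b'])
  have 2: "d_zbar (d_zbar (d_zbar V)) z = cnj ((Y z - 2 * a) / 8)"
    unfolding d_zbar_V d_zbar_V1 by (rule has_wirtinger_d_zbar[OF has_wirtinger_cnj[OF b']])
  have 3: "d_z (\<lambda>\<zeta>. V \<zeta> * W \<zeta>) z = a" by (rule has_wirtinger_d_z[OF VW])
  have 4: "d_zbar (\<lambda>\<zeta>. V \<zeta> * cnj (W \<zeta>)) z = cnj a"
    using has_wirtinger_d_zbar[OF has_wirtinger_cnj[OF VW]] by simp
  show ?thesis unfolding 1 2 3 4 by (simp add: field_simps)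
qed

end

text \<open>The time side of the equation. \<open>V\<close> depends on t through \<open>f\<close>,
  \<open>f1\<close> and their conjugates, so the linear equation for these two determines its
  derivative; the terms from \<open>f\<close>, \<open>f1\<close> give \<open>Y\<close>, the others
  its conjugate.\<close>

lemma has_vector_derivative_V:
  fixes p :: "real \<Rightarrow> complex poly"
  assumes F: "((\<lambda>t. poly (p t) z) has_vector_derivative (8 * poly (pderiv (pderiv (pderiv (p t)))) z)) (at t)"
    and F1: "((\<lambda>t. poly (pderiv (p t)) z) has_vector_derivative (8 * poly (pderiv (pderiv (pderiv (pderiv (p t))))) z)) (at t)"
  shows "((\<lambda>t. poly_profile.V (p t) z) has_vector_derivative (poly_profile.Y (p t) z + cnj (poly_profile.Y (p t) z))) (at t)"
proof -
  let ?f = "\<lambda>t. poly (p t) z" and ?f1 = "\<lambda>t. poly (pderiv (p t)) z"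
  let ?g = "8 * poly (pderiv (pderiv (pderiv (p t)))) z"
  let ?g1 = "8 * poly (pderiv (pderiv (pderiv (pderiv (p t))))) z"
  let ?s = "\<lambda>t. poly_profile.s (p t) z"
  have nz: "1 + ?f t * cnj (?f t) \<noteq> 0"
    using poly_profile.s_rel[of "p t" z] by auto
  have D: "((\<lambda>t. 1 + ?f t * cnj (?f t)) has_derivative (\<lambda>x. x *\<^sub>R (?f t * cnj ?g + ?g * cnj (?f t)))) (at t)"
    using has_vector_derivative_add[OF has_vector_derivative_const has_vector_derivative_mult[OF F has_vector_derivative_cnj[OF F]]]
    by (simp add: has_vector_derivative_def)
  have key: "- (i * (x *\<^sub>R d) * i) = x *\<^sub>R (- d * i\<^sup>2)" for i d :: complex and x
    by (simp add: scaleR_conv_of_real power2_eq_square mult_ac)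
  have S: "(?s has_vector_derivative (- (?f t * cnj ?g + ?g * cnj (?f t)) * (?s t)\<^sup>2)) (at t)"
    using Deriv.has_derivative_inverse[where f = "\<lambda>t. 1 + ?f t * cnj (?f t)", OF nz D]
    unfolding has_vector_derivative_def poly_profile.s_def key .
  have "((\<lambda>t. (- 8 * ?f1 t * cnj (?f1 t)) * (?s t * ?s t)) has_vector_derivative
      (poly_profile.Y (p t) z + cnj (poly_profile.Y (p t) z))) (at t)"
    by (rule has_vector_derivative_eq_rhs[OF has_vector_derivative_mult[OF has_vector_derivative_mult[OF
          has_vector_derivative_mult[OF has_vector_derivative_const F1] has_vector_derivative_cnj[OF F1]]
          has_vector_derivative_mult[OF S S]]])
      (simp add: poly_profile.Y_def poly_profile.cnj_s power2_eq_square power3_eq_cube algebra_simps)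
  then show ?thesis by (simp add: poly_profile.V_def power2_eq_square)
qed

section \<open>Asymptotics at infinity\<close>

text \<open>Away from 0 the quotient is the reflected polynomial at 1/z, whose value at 0 is the
  leading coefficient.\<close>

lemma poly_div_power_tendsto:
  fixes q :: "complex poly"
  shows "((\<lambda>z. poly q z / z ^ degree q) \<longlongrightarrow> lead_coeff q) at_infinity"
proof -
  have "((\<lambda>z. poly (reflect_poly q) (inverse z)) \<longlongrightarrow> poly (reflect_poly q) 0) at_infinity"
    by (intro tendsto_intros tendsto_inverse_0)
  moreover have "\<forall>\<^sub>F z in at_infinity. poly (reflect_poly q) (inverse z) = poly q z / z ^ degree q"
    using eventually_not_equal_at_infinity[of 0]
    by eventually_elim (simp add: poly_reflect_poly_nz power_inverse field_simps)
  ultimately show ?thesis by (simp add: filterlim_cong)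
qed

text \<open>The limit controls \<open>g\<close> outside a disc and compactness inside. It is used
  with m = 0 for \<open>phi\<close> and z phi, m = 1 for \<open>W\<close> and m = 2 for
  \<open>V\<close>.\<close>

lemma bounded_of_weighted_limit:
  fixes g :: "complex \<Rightarrow> complex"
  assumes cont: "continuous_on UNIV g" and lim: "((\<lambda>z. norm (z ^ (2 * m) * g z)) \<longlongrightarrow> L) at_infinity"
  shows "\<exists>C. \<forall>z. norm (g z) \<le> C / (1 + (cmod z)\<^sup>2) ^ m"
proof -
  define h where "h = (\<lambda>z. norm (g z) * (1 + (cmod z)\<^sup>2) ^ m)"
  have "((\<lambda>z. norm (z ^ (2 * m) * g z) * (1 + (cmod (inverse z))\<^sup>2) ^ m) \<longlongrightarrow> L * (1 + (cmod 0)\<^sup>2) ^ m) at_infinity"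
    by (intro tendsto_intros lim tendsto_inverse_0)
  moreover have "\<forall>\<^sub>F z in at_infinity. norm (z ^ (2 * m) * g z) * (1 + (cmod (inverse z))\<^sup>2) ^ m = h z"
    using eventually_not_equal_at_infinity[of 0]
  proof eventually_elim
    case (elim z)
    have "((cmod z)\<^sup>2 * (1 + (cmod (inverse z))\<^sup>2)) ^ m = (1 + (cmod z)\<^sup>2) ^ m"
    proof -
      have "(cmod z)\<^sup>2 * (cmod (inverse z))\<^sup>2 = 1"
        using elim by (simp add: norm_inverse flip: power_mult_distrib)
      then show ?thesis by (simp only: distrib_left mult_1_right add.commute)
    qed
    then show ?case
      unfolding h_def power_mult_distrib norm_mult norm_power power_mult
      by (metis mult.assoc mult.commute)
  qed
  ultimately have "(h \<longlongrightarrow> L) at_infinity" by (simp add: filterlim_cong)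
  then have "\<forall>\<^sub>F z in at_infinity. dist (h z) L < 1" by (rule tendstoD) simp
  then obtain B where B: "\<And>z. norm z \<ge> B \<Longrightarrow> dist (h z) L < 1"
    by (auto simp: eventually_at_infinity)
  have "continuous_on (cball 0 B) h"
    unfolding h_def by (intro continuous_intros continuous_on_subset[OF cont]) auto
  then have "bounded (h ` cball 0 B)"
    by (intro compact_imp_bounded compact_continuous_image compact_cball)
  then obtain K where "\<forall>z\<in>cball 0 B. norm (h z) \<le> K"
    unfolding bounded_iff by auto
  then have K: "\<And>z. norm z \<le> B \<Longrightarrow> norm (h z) \<le> K" by simp
  have "h z \<le> max K (L + 1)" for z
  proof (cases "norm z \<le> B")
    case True
    then show ?thesis using K[of z] by simp
  next
    case False
    then have "h z \<le> L + 1" using B[of z] by (simp add: dist_real_def abs_less_iff)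
    then show ?thesis by simp
  qed
  then have "norm (g z) \<le> max K (L + 1) / (1 + (cmod z)\<^sup>2) ^ m" for z
    unfolding h_def by (subst pos_le_divide_eq) auto
  then show ?thesis by blast
qed

context poly_profile
begin

lemma continuous_profile:
  "continuous_on UNIV phi" "continuous_on UNIV V" "continuous_on UNIV W"
  using has_wirtinger_phi has_wirtinger_V has_wirtinger_W
  by (auto intro!: continuous_at_imp_continuous_on dest: has_wirtinger_continuous)

lemma tendsto_over_f:
  assumes "p \<noteq> 0"
  shows "((\<lambda>z. z ^ degree p / f z) \<longlongrightarrow> 1 / lead_coeff p) at_infinity"
proof -
  have "((\<lambda>z. 1 / (f z / z ^ degree p)) \<longlongrightarrow> 1 / lead_coeff p) at_infinity"
    by (intro tendsto_intros poly_div_power_tendsto) (use assms in simp)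
  then show ?thesis by simp
qed

lemma eventually_f_nz:
  assumes "p \<noteq> 0"
  shows "\<forall>\<^sub>F z in at_infinity. z \<noteq> 0 \<and> f z \<noteq> 0"
proof -
  have "\<forall>\<^sub>F z in at_infinity. f z / z ^ degree p \<noteq> 0"
    by (rule tendsto_imp_eventually_ne[OF poly_div_power_tendsto]) (use assms in simp)
  with eventually_not_equal_at_infinity[of 0] show ?thesis
    by eventually_elim auto
qed

text \<open>The expression is |f|^2 / (1 + |f|^2). Pulling it out of \<open>phi\<close>,
  \<open>W\<close> and \<open>V\<close> leaves quotients by \<open>f\<close> whose limits depend
  only on degree and leading coefficient.\<close>

lemma tendsto_f_cnj_f_s:
  assumes "degree p > 0"
  shows "((\<lambda>z. f z * cnj (f z) * s z) \<longlongrightarrow> 1) at_infinity"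
proof -
  have p: "p \<noteq> 0" using assms by auto
  have "((\<lambda>z. inverse z ^ degree p * (z ^ degree p / f z)) \<longlongrightarrow> 0 ^ degree p * (1 / lead_coeff p)) at_infinity"
    by (intro tendsto_intros tendsto_over_f tendsto_inverse_0 p)
  moreover have "\<forall>\<^sub>F z in at_infinity. inverse z ^ degree p * (z ^ degree p / f z) = inverse (f z)"
    using eventually_f_nz[OF p] by eventually_elim (simp add: field_simps)
  ultimately have inv: "((\<lambda>z. inverse (f z)) \<longlongrightarrow> 0) at_infinity"
    using assms by (simp add: filterlim_cong power_0_left)
  have "((\<lambda>z. 1 / (inverse (f z) * cnj (inverse (f z)) + 1)) \<longlongrightarrow> 1 / (0 * cnj 0 + 1)) at_infinity"
    by (intro tendsto_intros inv) simp
  moreover have "\<forall>\<^sub>F z in at_infinity. 1 / (inverse (f z) * cnj (inverse (f z)) + 1) = f z * cnj (f z) * s z"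
    using eventually_f_nz[OF p]
  proof eventually_elim
    case (elim z)
    have e: "inverse (f z) * cnj (inverse (f z)) + 1 = (1 + f z * cnj (f z)) / (f z * cnj (f z))"
      using elim by (simp add: field_simps)
    show ?case unfolding e s_def by (simp add: divide_inverse)
  qed
  ultimately show ?thesis by (simp add: filterlim_cong)
qed

lemma lead_coeff_derivs:
  assumes "degree p \<ge> 2"
  shows "degree (pderiv p) = degree p - 1" "lead_coeff (pderiv p) = of_nat (degree p) * lead_coeff p"
    "degree (pderiv (pderiv p)) = degree p - 2"
    "lead_coeff (pderiv (pderiv p)) = of_nat (degree p) * of_nat (degree p - 1) * lead_coeff p"
proof -
  obtain k where k: "degree p = Suc (Suc k)" using assms by (metis Suc_le_D numeral_2_eq_2 Suc_le_eq Suc_leD le_Suc_eq)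
  show "degree (pderiv p) = degree p - 1" "lead_coeff (pderiv p) = of_nat (degree p) * lead_coeff p"
    "degree (pderiv (pderiv p)) = degree p - 2"
    "lead_coeff (pderiv (pderiv p)) = of_nat (degree p) * of_nat (degree p - 1) * lead_coeff p"
    by (simp_all add: k degree_pderiv coeff_pderiv)
qed

lemma tendsto_f1_over_f:
  assumes "degree p \<ge> 2"
  shows "((\<lambda>z. z * f1 z / f z) \<longlongrightarrow> of_nat (degree p)) at_infinity"
    "((\<lambda>z. z\<^sup>2 * f2 z / f z) \<longlongrightarrow> of_nat (degree p) * of_nat (degree p - 1)) at_infinity"
    "((\<lambda>z. z / f z) \<longlongrightarrow> 0) at_infinity"
proof -
  have p: "p \<noteq> 0" using assms by auto
  have nz: "lead_coeff p \<noteq> 0" using p by simp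
  obtain k where k: "degree p = Suc (Suc k)" using assms by (metis Suc_le_D numeral_2_eq_2 Suc_le_eq Suc_leD le_Suc_eq)
  have "((\<lambda>z. (f1 z / z ^ degree (pderiv p)) * (z ^ degree p / f z)) \<longlongrightarrow> lead_coeff (pderiv p) * (1 / lead_coeff p)) at_infinity"
    by (intro tendsto_intros poly_div_power_tendsto tendsto_over_f p)
  moreover have "\<forall>\<^sub>F z in at_infinity. (f1 z / z ^ degree (pderiv p)) * (z ^ degree p / f z) = z * f1 z / f z"
    using eventually_f_nz[OF p] by eventually_elim (simp add: lead_coeff_derivs(1)[OF assms] k)
  ultimately show "((\<lambda>z. z * f1 z / f z) \<longlongrightarrow> of_nat (degree p)) at_infinity"
    unfolding lead_coeff_derivs(2)[OF assms] using nz by (simp add: filterlim_cong)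
  have "((\<lambda>z. (f2 z / z ^ degree (pderiv (pderiv p))) * (z ^ degree p / f z)) \<longlongrightarrow> lead_coeff (pderiv (pderiv p)) * (1 / lead_coeff p)) at_infinity"
    by (intro tendsto_intros poly_div_power_tendsto tendsto_over_f p)
  moreover have "\<forall>\<^sub>F z in at_infinity. (f2 z / z ^ degree (pderiv (pderiv p))) * (z ^ degree p / f z) = z\<^sup>2 * f2 z / f z"
    using eventually_f_nz[OF p] by eventually_elim (simp add: lead_coeff_derivs(3)[OF assms] k power2_eq_square)
  ultimately show "((\<lambda>z. z\<^sup>2 * f2 z / f z) \<longlongrightarrow> of_nat (degree p) * of_nat (degree p - 1)) at_infinity"
    unfolding lead_coeff_derivs(4)[OF assms] using nz by (simp add: filterlim_cong)
  have "((\<lambda>z. inverse z ^ Suc k * (z ^ degree p / f z)) \<longlongrightarrow> 0 ^ Suc k * (1 / lead_coeff p)) at_infinity"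
    by (intro tendsto_intros tendsto_over_f tendsto_inverse_0 p)
  moreover have "\<forall>\<^sub>F z in at_infinity. inverse z ^ Suc k * (z ^ degree p / f z) = z / f z"
    using eventually_f_nz[OF p] by eventually_elim (simp add: k field_simps)
  ultimately have "((\<lambda>z. z / f z) \<longlongrightarrow> 0 ^ Suc k * (1 / lead_coeff p)) at_infinity"
    by (rule Lim_transform_eventually)
  then show "((\<lambda>z. z / f z) \<longlongrightarrow> 0) at_infinity" by simp
qed

lemma tendsto_z_phi:
  assumes "degree p \<ge> 2"
  shows "((\<lambda>z. z * phi z) \<longlongrightarrow> of_nat (degree p)) at_infinity"
proof -
  have p: "p \<noteq> 0" "degree p > 0" using assms by auto
  have "((\<lambda>z. (z * f1 z / f z) * (f z * cnj (f z) * s z)) \<longlongrightarrow> of_nat (degree p) * 1) at_infinity"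
    by (intro tendsto_mult tendsto_f1_over_f tendsto_f_cnj_f_s assms p)
  moreover have "\<forall>\<^sub>F z in at_infinity. (z * f1 z / f z) * (f z * cnj (f z) * s z) = z * phi z"
    using eventually_f_nz[OF p(1)] by eventually_elim (simp add: phi_def)
  ultimately show ?thesis by (simp add: filterlim_cong)
qed

text \<open>The limit found in the proof is n (n - 1) - n^2 = -n with n the degree. It is nonzero,
  so \<open>W\<close> is exactly of order |z|^(-2) and not integrable.\<close>

lemma tendsto_z_W:
  assumes "degree p \<ge> 2"
  obtains L where "((\<lambda>z. z\<^sup>2 * (W z / 24)) \<longlongrightarrow> L) at_infinity"
proof -
  have p: "p \<noteq> 0" "degree p > 0" using assms by auto
  have "((\<lambda>z. (z\<^sup>2 * f2 z / f z) * (f z * cnj (f z) * s z) - ((z * f1 z / f z) * (f z * cnj (f z) * s z))\<^sup>2)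
      \<longlongrightarrow> (of_nat (degree p) * of_nat (degree p - 1)) * 1 - (of_nat (degree p) * 1)\<^sup>2) at_infinity"
    by (intro tendsto_diff tendsto_power tendsto_mult tendsto_f1_over_f tendsto_f_cnj_f_s assms p)
  moreover have "\<forall>\<^sub>F z in at_infinity. (z\<^sup>2 * f2 z / f z) * (f z * cnj (f z) * s z) - ((z * f1 z / f z) * (f z * cnj (f z) * s z))\<^sup>2
      = z\<^sup>2 * (W z / 24)"
    using eventually_f_nz[OF p(1)]
    by eventually_elim (simp add: W_def power_mult_distrib power2_eq_square algebra_simps)
  ultimately show thesis by (rule that[OF Lim_transform_eventually])
qed

lemma norm_s: "norm (s z) = 1 / (1 + (cmod (f z))\<^sup>2)"
  unfolding s_eq norm_of_real by (simp add: inverse_eq_divide)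

text \<open>The first limit is the coarse decay required by \<open>plane_field\<close>, and uses
  that z / f tends to 0 for degree at least 2. The second is the sharp rate; its nonzero constant
  gives both halves of the Theta bound.\<close>

lemma tendsto_z_V:
  assumes "degree p \<ge> 2"
  shows "((\<lambda>z. norm (z ^ 4 * (- V z / 8))) \<longlongrightarrow> 0) at_infinity"
    "((\<lambda>z. Q z / (1 / cmod z ^ (2 * (degree p + 1)))) \<longlongrightarrow> - 8 * (real (degree p) / cmod (lead_coeff p))\<^sup>2) at_infinity"
proof -
  have p: "p \<noteq> 0" "degree p > 0" using assms by auto
  have "((\<lambda>z. (norm (z * f1 z / f z))\<^sup>2 * (norm (z / f z))\<^sup>2 * (norm (f z * cnj (f z) * s z))\<^sup>2)
      \<longlongrightarrow> (norm (of_nat (degree p) :: complex))\<^sup>2 * (norm (0::complex))\<^sup>2 * (norm (1::complex))\<^sup>2) at_infinity"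
    by (intro tendsto_norm tendsto_power tendsto_mult tendsto_f1_over_f tendsto_f_cnj_f_s assms p)
  moreover have "\<forall>\<^sub>F z in at_infinity. (norm (z * f1 z / f z))\<^sup>2 * (norm (z / f z))\<^sup>2 * (norm (f z * cnj (f z) * s z))\<^sup>2
      = norm (z ^ 4 * (- V z / 8))"
    using eventually_f_nz[OF p(1)]
    by eventually_elim (simp add: V_def norm_mult norm_divide norm_power power_mult_distrib power_divide eval_nat_numeral)
  ultimately show "((\<lambda>z. norm (z ^ 4 * (- V z / 8))) \<longlongrightarrow> 0) at_infinity"
    by (simp add: filterlim_cong)
  have "((\<lambda>z. - 8 * (norm (z * f1 z / f z))\<^sup>2 * (norm (z ^ degree p / f z))\<^sup>2 * (norm (f z * cnj (f z) * s z))\<^sup>2)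
      \<longlongrightarrow> - 8 * (norm (of_nat (degree p) :: complex))\<^sup>2 * (norm (1 / lead_coeff p))\<^sup>2 * (norm (1::complex))\<^sup>2) at_infinity"
    by (intro tendsto_norm tendsto_power tendsto_mult tendsto_f1_over_f tendsto_over_f tendsto_f_cnj_f_s tendsto_const assms p)
  moreover have "\<forall>\<^sub>F z in at_infinity. - 8 * (norm (z * f1 z / f z))\<^sup>2 * (norm (z ^ degree p / f z))\<^sup>2 * (norm (f z * cnj (f z) * s z))\<^sup>2
      = Q z / (1 / cmod z ^ (2 * (degree p + 1)))"
    using eventually_f_nz[OF p(1)]
  proof eventually_elim
    case (elim z)
    have "cmod z ^ (2 * (degree p + 1)) = (cmod z)\<^sup>2 * (cmod z ^ degree p)\<^sup>2"
      by (simp add: power_mult_distrib flip: power_mult power_add) (simp add: algebra_simps)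
    moreover have "cmod (f z) \<noteq> 0" using elim by simp
    ultimately show ?case
      by (simp only: norm_s Q_def norm_mult norm_divide norm_power complex_mod_cnj)
        (simp add: power_mult_distrib power_divide eval_nat_numeral)
  qed
  ultimately show "((\<lambda>z. Q z / (1 / cmod z ^ (2 * (degree p + 1)))) \<longlongrightarrow> - 8 * (real (degree p) / cmod (lead_coeff p))\<^sup>2) at_infinity"
    by (simp add: filterlim_cong norm_divide power_divide)
qed

lemma Q_bigtheta:
  assumes "degree p \<ge> 2"
  shows "Q \<in> \<Theta>[at_infinity](\<lambda>z. 1 / cmod z ^ (2 * (degree p + 1)))"
  by (rule bigthetaI_tendsto[OF _ tendsto_z_V(2)[OF assms]]) (use assms in auto)

lemma plane_field_phi:
  assumes "degree p \<ge> 2"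
  obtains C where "plane_field phi (\<lambda>z. W z / 24) (\<lambda>z. - V z / 8) C"
proof -
  have z_phi: "((\<lambda>z. norm (z ^ (2 * 0) * (z * phi z))) \<longlongrightarrow> norm (of_nat (degree p) :: complex)) at_infinity"
    using tendsto_norm[OF tendsto_z_phi[OF assms]] by simp
  have "((\<lambda>z. inverse z * (z * phi z)) \<longlongrightarrow> 0 * of_nat (degree p)) at_infinity"
    by (intro tendsto_mult tendsto_inverse_0 tendsto_z_phi assms)
  moreover have "\<forall>\<^sub>F z in at_infinity. inverse z * (z * phi z) = phi z"
    using eventually_not_equal_at_infinity[of 0] by eventually_elim simp
  ultimately have "(phi \<longlongrightarrow> 0) at_infinity" by (simp add: filterlim_cong)
  then have phi: "((\<lambda>z. norm (z ^ (2 * 0) * phi z)) \<longlongrightarrow> 0) at_infinity"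
    using tendsto_norm_zero by simp
  obtain L where "((\<lambda>z. z\<^sup>2 * (W z / 24)) \<longlongrightarrow> L) at_infinity" using tendsto_z_W[OF assms] .
  from tendsto_norm[OF this] have W: "((\<lambda>z. norm (z ^ (2 * 1) * (W z / 24))) \<longlongrightarrow> norm L) at_infinity" by simp
  have V: "((\<lambda>z. norm (z ^ (2 * 2) * (- V z / 8))) \<longlongrightarrow> 0) at_infinity"
    using tendsto_z_V(1)[OF assms] by simp
  have cont: "continuous_on UNIV (\<lambda>z. W z / 24)" "continuous_on UNIV (\<lambda>z. - V z / 8)" "continuous_on UNIV (\<lambda>z. z * phi z)"
    by (intro continuous_intros continuous_profile; simp)+
  obtain C1 where C1: "\<And>z. norm (phi z) \<le> C1"
    using bounded_of_weighted_limit[OF continuous_profile(1) phi] by auto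
  obtain C2 where C2: "\<And>z. norm (z * phi z) \<le> C2"
    using bounded_of_weighted_limit[OF cont(3) z_phi] by auto
  obtain C3 where C3: "\<And>z. norm (W z / 24) \<le> C3 / (1 + (cmod z)\<^sup>2)"
    using bounded_of_weighted_limit[OF cont(1) W] unfolding power_one_right by blast
  obtain C4 where C4: "\<And>z. norm (- V z / 8) \<le> C4 / (1 + (cmod z)\<^sup>2)\<^sup>2"
    using bounded_of_weighted_limit[OF cont(2) V] by blast
  define C where "C = max (max C1 C2) (max C3 C4)"
  show thesis
  proof (rule that[of C], unfold_locales)
    fix z
    show "has_wirtinger phi (W z / 24) (- V z / 8) z" by (rule has_wirtinger_phi)
    show "norm (phi z) \<le> C" "norm (z * phi z) \<le> C"
      using C1[of z] C2[of z] by (auto simp: C_def)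
    have "C3 / (1 + (cmod z)\<^sup>2) \<le> C / (1 + (cmod z)\<^sup>2)"
      by (intro divide_right_mono) (auto simp: C_def)
    then show "norm (W z / 24) \<le> C / (1 + (cmod z)\<^sup>2)" using C3[of z] by linarith
    have "C4 / (1 + (cmod z)\<^sup>2)\<^sup>2 \<le> C / (1 + (cmod z)\<^sup>2)\<^sup>2"
      by (intro divide_right_mono) (auto simp: C_def)
    with C4[of z] have "norm (- V z / 8) \<le> C / (1 + (cmod z)\<^sup>2)\<^sup>2" by (rule order_trans)
    then show "norm (- V z / 8) \<le> C * decay z"
      by (simp only: decay_def times_divide_eq_right mult_1_right)
  qed (fact cont)+
qed

lemma is_fourier_multiplier_V_W:
  assumes "degree p \<ge> 2"
  shows "is_fourier_multiplier (\<lambda>\<xi>. - 3 * beurling_symbol \<xi>) V W"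
proof -
  obtain C where "plane_field phi (\<lambda>z. W z / 24) (\<lambda>z. - V z / 8) C"
    using plane_field_phi[OF assms] .
  then interpret A: plane_field phi "\<lambda>z. W z / 24" "\<lambda>z. - V z / 8" C .
  \<comment> \<open>Rescaled by -8, the zbar-component becomes \<open>V\<close> itself and the
    z-component -W/3, so the multiplier constant -3 returns \<open>W\<close>.\<close>
  have "plane_field (\<lambda>z. - 8 * phi z) (\<lambda>z. - 8 * (W z / 24)) (\<lambda>z. - 8 * (- V z / 8)) (8 * C)"
  proof
    fix z
    show "has_wirtinger (\<lambda>z. - 8 * phi z) (- 8 * (W z / 24)) (- 8 * (- V z / 8)) z"
      by (rule has_wirtinger_cmult[OF A.wirtinger])
    show "norm (- 8 * phi z) \<le> 8 * C" using A.le_phi[of z] by (simp add: norm_mult)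
    show "norm (z * (- 8 * phi z)) \<le> 8 * C" using A.le_z_phi[of z] by (simp add: norm_mult)
    have "norm (- 8 * (W z / 24)) = 8 * norm (W z / 24)" by (simp add: norm_mult norm_divide)
    also have "\<dots> \<le> 8 * (C / (1 + (cmod z)\<^sup>2))" by (intro mult_left_mono A.le_a) simp
    finally show "norm (- 8 * (W z / 24)) \<le> 8 * C / (1 + (cmod z)\<^sup>2)"
      by (simp only: times_divide_eq_right)
    show "norm (- 8 * (- V z / 8)) \<le> 8 * C * decay z" using A.le_b[of z] unfolding norm_mult by simp
  qed (intro continuous_intros A.cont_a A.cont_b)+
  from plane_field.is_fourier_multiplier_beurling[OF this, of "- 3"] show ?thesis by simp
qed

lemma has_bochner_integral_Q:
  assumes "degree p \<ge> 2"
  shows "has_bochner_integral lborel Q (- 8 * real (degree p) * pi)"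
proof -
  obtain C where "plane_field phi (\<lambda>z. W z / 24) (\<lambda>z. - V z / 8) C"
    using plane_field_phi[OF assms] .
  from plane_field.has_bochner_integral_flux[OF this tendsto_z_phi[OF assms]]
  have "has_bochner_integral lborel (\<lambda>z. - 8 * Re (- V z / 8)) (- 8 * Re (of_real pi * of_nat (degree p)))"
    by (intro has_bochner_integral_mult_right has_bochner_integral_bounded_linear[OF bounded_linear_Re])
  then show ?thesis by (simp add: V_eq mult_ac)
qed

lemma square_integrable_Q:
  assumes "degree p \<ge> 2"
  shows "square_integrable Q"
proof -
  obtain C where "plane_field phi (\<lambda>z. W z / 24) (\<lambda>z. - V z / 8) C"
    using plane_field_phi[OF assms] .
  then interpret A: plane_field phi "\<lambda>z. W z / 24" "\<lambda>z. - V z / 8" C .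
  have Q_eq: "Q = (\<lambda>z. Re (V z))" by (simp add: V_eq fun_eq_iff)
  show ?thesis
  proof (rule square_integrable_decay[where C = "8 * C"])
    show "Q \<in> borel_measurable borel"
      unfolding Q_eq by (intro borel_measurable_continuous_onI continuous_intros continuous_profile)
    show "norm (Q z) \<le> 8 * C / (1 + (cmod z)\<^sup>2)" for z
      using A.le_b'[of z] by (simp add: V_eq norm_divide mult.commute[of 8 C])
  qed
qed

end

section \<open>The polynomial family\<close>

text \<open>Divided powers: differentiation lowers the index without a factor, so three derivatives
  become a mere index shift in \<open>flow\<close>.\<close>

definition unit_monom :: "nat \<Rightarrow> complex poly" where
  "unit_monom m = monom (1 / fact m) m"

definition flow_coeff :: "nat \<Rightarrow> real \<Rightarrow> complex" where
  "flow_coeff k t = of_real (8 * t) ^ k / fact k"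

text \<open>The exponential of 8t times the third derivative, applied to z^n / n!; the series stops
  by itself at \<open>n div 3\<close>. The term k = 0 is constant in time and carries the
  degree.\<close>

definition flow :: "nat \<Rightarrow> real \<Rightarrow> complex poly" where
  "flow n t = (\<Sum>k\<le>n div 3. smult (flow_coeff k t) (unit_monom (n - 3 * k)))"

lemma pderiv_unit_monom_Suc: "pderiv (unit_monom (Suc m)) = unit_monom m"
  by (simp add: unit_monom_def pderiv_monom field_simps del: of_nat_Suc)

lemma pderiv_unit_monom_0: "pderiv (unit_monom 0) = 0"
  by (simp add: unit_monom_def pderiv_monom)

lemma pderiv3_unit_monom:
  "(pderiv ^^ 3) (unit_monom m) = (if m < 3 then 0 else unit_monom (m - 3))"
proof (cases "m < 3")
  case True
  then have "m \<in> {0, Suc 0, Suc (Suc 0)}" by auto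
  then show ?thesis
    by (auto simp: numeral_3_eq_3 pderiv_unit_monom_Suc pderiv_unit_monom_0)
next
  case False
  then obtain k where "m = Suc (Suc (Suc k))" by (auto dest!: le_Suc_ex simp: not_less numeral_3_eq_3)
  then show ?thesis by (simp add: numeral_3_eq_3 pderiv_unit_monom_Suc)
qed

lemma pderiv_sum: "pderiv (\<Sum>i\<in>I. g i) = (\<Sum>i\<in>I. pderiv (g i))"
  by (induction I rule: infinite_finite_induct) (simp_all add: pderiv_add)

lemma pderiv_flow:
  "(pderiv ^^ j) (flow n t) = (\<Sum>k\<le>n div 3. smult (flow_coeff k t) ((pderiv ^^ j) (unit_monom (n - 3 * k))))"
  by (induction j) (simp_all add: flow_def pderiv_sum pderiv_smult)

lemma flow_coeff_derivative:
  "(flow_coeff 0 has_vector_derivative 0) (at t)"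
  "(flow_coeff (Suc k) has_vector_derivative (8 * flow_coeff k t)) (at t)"
proof -
  show "(flow_coeff 0 has_vector_derivative 0) (at t)"
    by (simp add: flow_coeff_def[abs_def])
  have "((\<lambda>t. (8 * t) ^ Suc k) has_real_derivative (1 + real k) * (8 * (8 * t) ^ k)) (at t)"
    by (rule DERIV_power_Suc) (auto intro!: derivative_eq_intros)
  then have "((\<lambda>t. of_real ((8 * t) ^ Suc k / fact k / real (Suc k))) has_vector_derivative
      complex_of_real ((1 + real k) * (8 * (8 * t) ^ k) / fact k / real (Suc k))) (at t)"
    by (intro has_vector_derivative_of_real DERIV_cdivide)
      (simp add: has_real_derivative_iff_has_vector_derivative)
  moreover have "(\<lambda>t. of_real ((8 * t) ^ Suc k / fact k / real (Suc k))) = flow_coeff (Suc k)"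
    by (auto simp: flow_coeff_def fun_eq_iff field_simps)
  moreover have "complex_of_real ((1 + real k) * (8 * (8 * t) ^ k) / fact k / real (Suc k)) = 8 * flow_coeff k t"
  proof -
    have "(1 + real k) * (8 * (8 * t) ^ k) / fact k / real (Suc k) = 8 * ((8 * t) ^ k / fact k)"
      by (simp add: nonzero_divide_eq_eq)
    then show ?thesis by (simp only: flow_coeff_def) simp
  qed
  ultimately show "(flow_coeff (Suc k) has_vector_derivative (8 * flow_coeff k t)) (at t)" by simp
qed

lemma flow_time_derivative:
  "((\<lambda>t. poly ((pderiv ^^ j) (flow n t)) z) has_vector_derivative
     (8 * poly ((pderiv ^^ (j + 3)) (flow n t)) z)) (at t)"
proof -
  define q where "q = (\<lambda>k. poly ((pderiv ^^ j) (unit_monom (n - 3 * k))) z)"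
  define K where "K = n div 3"
  define c' where "c' = (\<lambda>k. if k = 0 then 0 else 8 * flow_coeff (k - 1) t)"
  have "(flow_coeff k has_vector_derivative c' k) (at t)" for k
    using flow_coeff_derivative by (cases k) (auto simp: c'_def)
  then have "((\<lambda>t. \<Sum>k\<le>K. flow_coeff k t * q k) has_vector_derivative (\<Sum>k\<le>K. c' k * q k)) (at t)"
    by (intro has_vector_derivative_sum) (auto intro!: has_vector_derivative_eq_rhs[OF has_vector_derivative_mult])
  moreover have "(\<lambda>t. poly ((pderiv ^^ j) (flow n t)) z) = (\<lambda>t. \<Sum>k\<le>K. flow_coeff k t * q k)"
    by (simp add: pderiv_flow poly_sum q_def K_def)
  moreover have "(\<Sum>k\<le>K. c' k * q k) = 8 * poly ((pderiv ^^ (j + 3)) (flow n t)) z"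
  proof -
    have 0: "(pderiv ^^ j) (0 :: complex poly) = 0" by (induction j) auto
    \<comment> \<open>Three derivatives send the k-th monomial to the next one and annihilate the
      last, for which n - 3k < 3. This matches the time derivative, which kills the term k = 0 and
      lowers the other coefficients by one index.\<close>
    have 3: "poly ((pderiv ^^ (j + 3)) (unit_monom (n - 3 * k))) z = (if k < K then q (Suc k) else 0)" if "k \<le> K" for k
    proof -
      have "k < K \<longleftrightarrow> \<not> n - 3 * k < 3" using that unfolding K_def by linarith
      moreover have "n - 3 * Suc k = n - 3 * k - 3" by simp
      ultimately show ?thesis
        by (simp only: funpow_add comp_def pderiv3_unit_monom q_def) (simp add: 0)
    qed
    have "8 * poly ((pderiv ^^ (j + 3)) (flow n t)) z = (\<Sum>k\<le>K. 8 * (flow_coeff k t * (if k < K then q (Suc k) else 0)))"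
      unfolding pderiv_flow poly_sum sum_distrib_left by (intro sum.cong) (auto simp: 3 K_def)
    also have "\<dots> = (\<Sum>k<K. 8 * (flow_coeff k t * q (Suc k)))"
      by (simp add: lessThan_Suc_atMost[symmetric])
    also have "\<dots> = (\<Sum>k<K. c' (Suc k) * q (Suc k))"
      by (simp add: c'_def mult.assoc)
    also have "\<dots> = (\<Sum>k\<le>K. c' k * q k)"
      by (simp add: sum.lessThan_Suc_shift lessThan_Suc_atMost[symmetric] c'_def del: sum.lessThan_Suc)
    finally show ?thesis by simp
  qed
  ultimately show ?thesis by simp
qed

section \<open>Coefficients, degree and joint regularity of the flow\<close>

lemma coeff_flow:
  "coeff (flow n t) i = (\<Sum>k\<le>n div 3. if n - 3 * k = i then flow_coeff k t / fact i else 0)"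
  unfolding flow_def coeff_sum by (intro sum.cong) (auto simp: unit_monom_def)

lemma coeff_flow_single:
  assumes "3 * k \<le> n"
  shows "coeff (flow n t) (n - 3 * k) = flow_coeff k t / fact (n - 3 * k)"
proof -
  have "coeff (flow n t) (n - 3 * k) = (\<Sum>j\<le>n div 3. if j = k then flow_coeff k t / fact (n - 3 * k) else 0)"
    unfolding coeff_flow using assms by (intro sum.cong refl if_cong) auto
  then show ?thesis using assms by (simp add: less_eq_div_iff_mult_less_eq mult.commute)
qed

lemma degree_flow [simp]: "degree (flow n t) = n"
proof (rule antisym)
  show "degree (flow n t) \<le> n"
    by (rule degree_le) (auto simp: coeff_flow intro!: sum.neutral)
  show "n \<le> degree (flow n t)"
    by (rule le_degree) (use coeff_flow_single[of 0 n t] in \<open>simp add: flow_coeff_def\<close>)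
qed

lemma C_k_flow:
  "C_k m (\<lambda>(t, z). poly ((pderiv ^^ j) (flow n t)) z)"
proof -
  have fst: "C_k m (\<lambda>x :: real \<times> complex. complex_of_real (fst x))"
    by (intro C_k_linear bounded_linear_compose[OF bounded_linear_of_real bounded_linear_fst])
  have snd: "C_k m (\<lambda>x :: real \<times> complex. snd x)"
    by (intro C_k_linear bounded_linear_snd)
  have "C_k m (\<lambda>x :: real \<times> complex. \<Sum>k\<le>n div 3. ((8 * complex_of_real (fst x)) ^ k * (1 / fact k)) *
      poly ((pderiv ^^ j) (unit_monom (n - 3 * k))) (snd x))"
    by (intro C_k_sum C_k_mult C_k_power C_k_const C_k_poly fst snd)
  then show ?thesis
    by (simp add: case_prod_beta' pderiv_flow poly_sum flow_coeff_def)
qed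

lemma C_k_profile:
  "C_k m (\<lambda>(t, z). poly_profile.Q (flow n t) z)" "C_k m (\<lambda>(t, z). poly_profile.W (flow n t) z)"
proof -
  have f: "C_k m (\<lambda>x. poly (flow n (fst x)) (snd x))" "C_k m (\<lambda>x. poly (pderiv (flow n (fst x))) (snd x))"
    "C_k m (\<lambda>x. poly (pderiv (pderiv (flow n (fst x)))) (snd x))"
    using C_k_flow[of m 0 n] C_k_flow[of m 1 n] C_k_flow[of m 2 n]
    by (simp_all add: case_prod_beta' numeral_2_eq_2)
  note c = C_k_compose_linear[OF bounded_linear_cnj]
  have "1 + poly (flow n (fst x)) (snd x) * cnj (poly (flow n (fst x)) (snd x)) \<noteq> 0" for x
    using poly_profile.s_rel[of "flow n (fst x)" "snd x"] by auto
  then have s: "C_k m (\<lambda>x. poly_profile.s (flow n (fst x)) (snd x))"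
    unfolding poly_profile.s_def by (intro C_k_inverse C_k_add C_k_mult C_k_const c f)
  have "C_k m (\<lambda>x. Re (poly_profile.V (flow n (fst x)) (snd x)))"
    unfolding poly_profile.V_def
    by (intro C_k_compose_linear[OF bounded_linear_Re] C_k_mult C_k_power C_k_const c f s)
  then show "C_k m (\<lambda>(t, z). poly_profile.Q (flow n t) z)"
    by (simp add: case_prod_beta' poly_profile.V_eq)
  have "C_k m (\<lambda>x. 24 * (poly (pderiv (pderiv (flow n (fst x)))) (snd x) * cnj (poly (flow n (fst x)) (snd x)) * poly_profile.s (flow n (fst x)) (snd x)
      + (- 1) * ((poly (pderiv (flow n (fst x))) (snd x))\<^sup>2 * (cnj (poly (flow n (fst x)) (snd x)))\<^sup>2 * (poly_profile.s (flow n (fst x)) (snd x))\<^sup>2)))"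
    by (intro C_k_add C_k_mult C_k_power C_k_const c f s)
  then show "C_k m (\<lambda>(t, z). poly_profile.W (flow n t) z)"
    by (simp add: case_prod_beta' poly_profile.W_def)
qed

lemma NV_solution_flow:
  assumes "n \<ge> 2"
  shows "NV_solution (\<lambda>t. poly_profile.Q (flow n t)) (\<lambda>t. poly_profile.W (flow n t))"
  unfolding NV_solution_def Let_def
proof (intro conjI allI C_k_profile)
  fix t z
  have V: "(\<lambda>z. complex_of_real (poly_profile.Q (flow n t) z)) = poly_profile.V (flow n t)" for t
    by (simp add: poly_profile.V_eq fun_eq_iff)
  show "is_fourier_multiplier (\<lambda>\<xi>. - 3 * beurling_symbol \<xi>)
      (\<lambda>z. complex_of_real (poly_profile.Q (flow n t) z)) (poly_profile.W (flow n t))"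
    unfolding V by (rule poly_profile.is_fourier_multiplier_V_W) (use assms in simp)
  show "d_zbar (poly_profile.W (flow n t)) z = - 3 * d_z (\<lambda>z. complex_of_real (poly_profile.Q (flow n t) z)) z"
    unfolding V poly_profile.d_z_V by (rule poly_profile.d_zbar_W)
  have "((\<lambda>s. poly_profile.V (flow n s) z) has_vector_derivative
      (poly_profile.Y (flow n t) z + cnj (poly_profile.Y (flow n t) z))) (at t)"
    using flow_time_derivative[of 0 n z t] flow_time_derivative[of 1 n z t]
    by (intro has_vector_derivative_V) (simp_all add: numeral_3_eq_3)
  then show "((\<lambda>s. complex_of_real (poly_profile.Q (flow n s) z)) has_vector_derivative
      8 * (d_z (d_z (d_z (\<lambda>z. complex_of_real (poly_profile.Q (flow n t) z)))) z
        + d_zbar (d_zbar (d_zbar (\<lambda>z. complex_of_real (poly_profile.Q (flow n t) z)))) z)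
      + 2 * d_z (\<lambda>\<zeta>. complex_of_real (poly_profile.Q (flow n t) \<zeta>) * poly_profile.W (flow n t) \<zeta>) z
      + 2 * d_zbar (\<lambda>\<zeta>. complex_of_real (poly_profile.Q (flow n t) \<zeta>) * cnj (poly_profile.W (flow n t) \<zeta>)) z) (at t)"
    unfolding poly_profile.V_eq[symmetric] poly_profile.novikov_veselov_rhs[symmetric] by simp
qed

section \<open>Blow-up of the \<open>L\<^sup>2\<close> norm\<close>

lemma flow_nonzero: "n > 0 \<Longrightarrow> flow n t \<noteq> 0"
  by (metis degree_0 degree_flow less_irrefl)

lemma smult_sum_right: "smult c (\<Sum>i\<in>I. g i) = (\<Sum>i\<in>I. smult c (g i))"
  by (induction I rule: infinite_finite_induct) (simp_all add: smult_add_right)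

text \<open>Weighted homogeneity: with weight 1 for z and weight 3 for t, every term t^k z^(n - 3k)
  has weight n.\<close>

lemma flow_scaling:
  "flow n (s ^ 3 / 8) \<circ>\<^sub>p [:0, of_real s:] = smult (of_real s ^ n) (flow n (1 / 8))"
proof -
  have comp: "unit_monom m \<circ>\<^sub>p [:0, of_real s:] = smult (of_real s ^ m) (unit_monom m)" for m
    unfolding poly_eq_poly_eq_iff[symmetric]
    by (simp add: fun_eq_iff poly_pcompose unit_monom_def poly_monom power_mult_distrib)
  have "smult (flow_coeff k (s ^ 3 / 8)) (smult (of_real s ^ (n - 3 * k)) q)
      = smult (of_real s ^ n) (smult (flow_coeff k (1 / 8)) q)" if "k \<le> n div 3" for k and q :: "complex poly"
  proof -
    have "n = 3 * k + (n - 3 * k)" using that by linarith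
    then have "of_real s ^ n = of_real s ^ (3 * k) * (of_real s ^ (n - 3 * k) :: complex)"
      by (metis power_add)
    then show ?thesis by (simp add: flow_coeff_def power_mult)
  qed
  then show ?thesis
    unfolding flow_def pcompose_sum pcompose_smult comp smult_sum_right by (intro sum.cong) auto
qed

lemma poly_flow_scaling:
  "poly (flow n (s ^ 3 / 8)) (of_real s * \<zeta>) = of_real s ^ n * poly (flow n (1 / 8)) \<zeta>"
  "of_real s * poly (pderiv (flow n (s ^ 3 / 8))) (of_real s * \<zeta>)
    = of_real s ^ n * poly (pderiv (flow n (1 / 8))) \<zeta>"
proof -
  show "poly (flow n (s ^ 3 / 8)) (of_real s * \<zeta>) = of_real s ^ n * poly (flow n (1 / 8)) \<zeta>"
    using arg_cong[OF flow_scaling[of n s], of "\<lambda>q. poly q \<zeta>"] by (simp add: poly_pcompose mult.commute)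
  show "of_real s * poly (pderiv (flow n (s ^ 3 / 8))) (of_real s * \<zeta>)
      = of_real s ^ n * poly (pderiv (flow n (1 / 8))) \<zeta>"
    using arg_cong[OF flow_scaling[of n s], of "\<lambda>q. poly (pderiv q) \<zeta>"]
    by (simp add: pderiv_pcompose poly_pcompose pderiv_smult pderiv_pCons mult.commute)
qed

text \<open>If \<open>flow n (1/8) = c (z - a)\<^sup>n\<close>, then \<open>a = 0\<close> because the coefficient of \<open>z\<^bsup>n-1\<^esup>\<close> vanishes,
  which contradicts the nonzero coefficient of \<open>z\<^bsup>n-3\<^esup>\<close>.\<close>

lemma order_flow_less:
  assumes n: "n \<ge> 3"
  shows "order a (flow n (1 / 8)) < n"
proof (rule ccontr)
  let ?P = "flow n (1 / 8)"
  assume "\<not> order a ?P < n"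
  moreover have nz: "?P \<noteq> 0" using flow_nonzero n by simp
  ultimately have ord: "order a ?P = n"
    using order_degree[OF nz, of a] by simp
  obtain q where q: "?P = [:- a, 1:] ^ n * q" using order_decomp[OF nz, of a] ord by auto
  have "q \<noteq> 0" using q nz by auto
  then have "degree ?P = n + degree q"
    unfolding q by (subst degree_mult_eq) (auto simp: degree_linear_power)
  then have "degree q = 0" by simp
  then obtain c where c: "q = [:c:]" by (rule degree_eq_zeroE)
  have coeff: "coeff ?P i = c * (of_nat (n choose i) * (- a) ^ (n - i))" if "i \<le> n" for i
    unfolding q c using coeff_linear_poly_power[OF that, of "- a" 1] by (simp add: mult.commute[of _ "[:c:]"])
  have "c \<noteq> 0" using c \<open>q \<noteq> 0\<close> by auto
  have "coeff ?P (n - 1) = 0"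
    unfolding coeff_flow by (rule sum.neutral) (use n in \<open>auto; presburger\<close>)
  then have "a = 0" using coeff[of "n - 1"] n \<open>c \<noteq> 0\<close> by auto
  then have "coeff ?P (n - 3) = 0" using coeff[of "n - 3"] n by simp
  moreover have "coeff ?P (n - 3 * 1) = 1 / fact (n - 3 * 1)"
    using coeff_flow_single[of 1 n "1 / 8"] n by (simp add: flow_coeff_def)
  ultimately show False by simp
qed

text \<open>Splitting off the root from the polynomial and from its derivative lowers the exponent
  by exactly one, and the cofactor of the derivative is nonzero at \<open>a\<close>. An upper bound
  on P and a lower bound on P' are what a lower bound on |Q| requires.\<close>

lemma local_bounds_at_root:
  fixes P :: "complex poly"
  assumes nz: "P \<noteq> 0" and root: "poly P a = 0"
  obtains C c \<delta> where "C > 0" "c > 0" "\<delta> > 0"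
    "\<And>\<zeta>. dist \<zeta> a < \<delta> \<Longrightarrow> cmod (poly P \<zeta>) \<le> C * dist \<zeta> a ^ order a P"
    "\<And>\<zeta>. dist \<zeta> a < \<delta> \<Longrightarrow> cmod (poly (pderiv P) \<zeta>) \<ge> c * dist \<zeta> a ^ (order a P - 1)"
proof -
  obtain q where q: "P = [:- a, 1:] ^ order a P * q" using order_decomp[OF nz] by blast
  have ord: "order a P = Suc (order a (pderiv P))" by (rule order_pderiv[OF nz root])
  have nz': "pderiv P \<noteq> 0"
  proof
    assume "pderiv P = 0"
    then have "degree P = 0" by (simp add: pderiv_eq_0_iff)
    then obtain k where "P = [:k:]" by (rule degree_eq_zeroE)
    then show False using root nz by simp
  qed
  obtain r where r: "pderiv P = [:- a, 1:] ^ order a (pderiv P) * r" "\<not> [:- a, 1:] dvd r"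
    using order_decomp[OF nz'] by blast
  have ra: "poly r a \<noteq> 0" using r(2) by (simp add: poly_eq_0_iff_dvd)
  have "\<forall>\<^sub>F \<zeta> in nhds a. cmod (poly q \<zeta>) < cmod (poly q a) + 1"
    by (rule order_tendstoD[where y = "cmod (poly q a)"]) (auto intro!: tendsto_intros filterlim_ident)
  moreover have "\<forall>\<^sub>F \<zeta> in nhds a. cmod (poly r a) / 2 < cmod (poly r \<zeta>)"
    by (rule order_tendstoD[where y = "cmod (poly r a)"]) (use ra in \<open>auto intro!: tendsto_intros filterlim_ident\<close>)
  ultimately have "\<forall>\<^sub>F \<zeta> in nhds a. cmod (poly q \<zeta>) < cmod (poly q a) + 1 \<and> cmod (poly r a) / 2 < cmod (poly r \<zeta>)"
    by (rule eventually_conj)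
  then obtain \<delta> where \<delta>: "\<delta> > 0"
    "\<And>\<zeta>. dist \<zeta> a < \<delta> \<Longrightarrow> cmod (poly q \<zeta>) < cmod (poly q a) + 1"
    "\<And>\<zeta>. dist \<zeta> a < \<delta> \<Longrightarrow> cmod (poly r a) / 2 < cmod (poly r \<zeta>)"
    unfolding eventually_nhds_metric by blast
  have lin: "cmod (poly ([:- a, 1:] ^ k * u) \<zeta>) = dist \<zeta> a ^ k * cmod (poly u \<zeta>)" for k u \<zeta>
    by (simp add: poly_power norm_mult norm_power dist_norm)
  show thesis
  proof (rule that[of "cmod (poly q a) + 1" "cmod (poly r a) / 2" \<delta>])
    fix \<zeta> assume d: "dist \<zeta> a < \<delta>"
    show "cmod (poly P \<zeta>) \<le> (cmod (poly q a) + 1) * dist \<zeta> a ^ order a P"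
      by (subst q, unfold lin) (use \<delta>(2)[OF d] in \<open>auto simp: mult.commute[of "dist \<zeta> a ^ _"] intro!: mult_right_mono\<close>)
    show "cmod (poly r a) / 2 * dist \<zeta> a ^ (order a P - 1) \<le> cmod (poly (pderiv P) \<zeta>)"
      by (subst r(1), unfold lin) (use mult_right_mono[OF less_imp_le[OF \<delta>(3)[OF d]], of "dist \<zeta> a ^ (order a P - 1)"] ord in \<open>simp add: mult.commute\<close>)
  qed (use ra \<delta>(1) in \<open>auto simp: add_nonneg_pos\<close>)
qed

lemma L2_norm_plane_ge:
  fixes f :: "complex \<Rightarrow> real"
  assumes f: "square_integrable f" and r: "r \<ge> 0" and b: "b \<ge> 0"
    and le: "\<And>z. z \<in> ball c r \<Longrightarrow> b \<le> \<bar>f z\<bar>"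
  shows "sqrt pi * r * b \<le> L2_norm_plane f"
proof -
  have ball: "emeasure lborel (ball c r) = ennreal (pi * r\<^sup>2)"
    using emeasure_ball[OF r, of c] by (simp add: unit_ball_vol_2)
  have "pi * r\<^sup>2 * b\<^sup>2 = (LINT z|lborel. indicator (ball c r) z * b\<^sup>2)"
    using ball r by (simp add: measure_def)
  also have "\<dots> \<le> (LINT z|lborel. (norm (f z))\<^sup>2)"
  proof (rule integral_mono)
    show "integrable lborel (\<lambda>z. indicator (ball c r) z * b\<^sup>2)"
      using ball by (intro integrable_mult_left integrable_real_indicator) auto
    show "integrable lborel (\<lambda>z. (norm (f z))\<^sup>2)" using f by (simp add: square_integrable_def)
    show "indicator (ball c r) z * b\<^sup>2 \<le> (norm (f z))\<^sup>2" for z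
      using power_mono[OF le b, of z 2] by (auto simp: indicator_def)
  qed
  finally have "sqrt (pi * r\<^sup>2 * b\<^sup>2) \<le> L2_norm_plane f"
    unfolding L2_norm_plane_def by (rule real_sqrt_le_mono)
  then show ?thesis using r b by (simp add: real_sqrt_mult)
qed

text \<open>In the variable \<open>\<zeta> = z / s\<close>, where \<open>8 t = s\<^sup>3\<close>, a zero of order \<open>m < n\<close> of \<open>flow n (1/8)\<close> makes
  \<open>Q\<close> concentrate at the scale \<open>\<rho> = |s| powr (- n / m)\<close>, at which \<open>|f|\<close> is of order one. In the
  variable \<open>z\<close> this scale is \<open>|s| \<rho> \<rightarrow> 0\<close>.\<close>

lemma L2_norm_flow_ge:
  assumes n: "n \<ge> 3"
  obtains \<kappa> \<alpha> S where "\<kappa> > 0" "\<alpha> > 0" "S > 0"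
    "\<And>s. \<bar>s\<bar> \<ge> S \<Longrightarrow> \<kappa> * \<bar>s\<bar> powr \<alpha> \<le> L2_norm_plane (poly_profile.Q (flow n (s ^ 3 / 8)))"
proof -
  let ?P = "flow n (1 / 8)"
  have nz: "?P \<noteq> 0" using flow_nonzero n by simp
  have "\<not> constant (poly ?P)" using n by (simp add: constant_degree)
  then obtain a where a: "poly ?P a = 0" using fundamental_theorem_of_algebra by blast
  define m where "m = order a ?P"
  have m: "0 < m" "m < n"
    using order_root[of ?P a] a nz order_flow_less[OF n, of a] by (auto simp: m_def)
  obtain C c \<delta> where Cc: "C > 0" "c > 0" "\<delta> > 0"
    and P_le: "\<And>\<zeta>. dist \<zeta> a < \<delta> \<Longrightarrow> cmod (poly ?P \<zeta>) \<le> C * dist \<zeta> a ^ m"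
    and P'_ge: "\<And>\<zeta>. dist \<zeta> a < \<delta> \<Longrightarrow> cmod (poly (pderiv ?P) \<zeta>) \<ge> c * dist \<zeta> a ^ (m - 1)"
    unfolding m_def by (rule local_bounds_at_root[OF nz a]) blast
  \<comment> \<open>The derivative bound at the inner distance rho/2, after the powers of s and rho
    have been absorbed through |s|^n rho^m = 1.\<close>
  define d where "d = c / 2 ^ (m - 1)"
  have d: "d > 0" using Cc by (simp add: d_def)
  \<comment> \<open>A lower bound for |Q| (|s| rho)^2, obtained from |f| <= C and |f1| |s| rho >=
    d.\<close>
  define B where "B = 8 * d\<^sup>2 / (1 + C\<^sup>2)\<^sup>2"
  have C2: "1 + C\<^sup>2 > 0" by (simp add: add_pos_nonneg)
  have B: "B > 0" using d C2 by (simp add: B_def)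
  define \<beta> where "\<beta> = real n / real m"
  have \<beta>: "\<beta> > 1" using m by (simp add: \<beta>_def)
  have key: "sqrt pi / 4 * B * \<bar>s\<bar> powr (\<beta> - 1) \<le> L2_norm_plane (poly_profile.Q (flow n (s ^ 3 / 8)))"
    if s: "\<bar>s\<bar> > 0" "\<bar>s\<bar> powr (- \<beta>) < \<delta>" for s :: real
  proof -
    define \<rho> where "\<rho> = \<bar>s\<bar> powr (- \<beta>)"
    have \<rho>: "\<rho> > 0" "\<rho> < \<delta>" using s by (simp_all add: \<rho>_def)
    have "\<rho> ^ m = \<bar>s\<bar> powr (- real n)"
      using s m by (simp add: \<rho>_def \<beta>_def powr_power)
    then have \<rho>m: "\<bar>s\<bar> ^ n * \<rho> ^ m = 1"
      using s by (simp add: powr_minus powr_realpow)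
    let ?Q = "poly_profile.Q (flow n (s ^ 3 / 8))"
    define b where "b = B / (\<bar>s\<bar> * \<rho>)\<^sup>2"
    \<comment> \<open>After division by s this disc has centre a + 3 rho/4 and radius rho/4, so it
      lies in the annulus between rho/2 and rho about \<open>a\<close>. The outer radius bounds |f|
      above, the inner one keeps |f1| away from its possible zero at \<open>a\<close>.\<close>
    have "b \<le> \<bar>?Q z\<bar>" if z: "z \<in> ball (of_real s * (a + of_real (3 / 4 * \<rho>))) (\<bar>s\<bar> * \<rho> / 4)" for z
    proof -
      define \<zeta> where "\<zeta> = z / of_real s"
      have z_eq: "z = of_real s * \<zeta>" using s by (simp add: \<zeta>_def)
      have "\<bar>s\<bar> * dist (a + of_real (3 / 4 * \<rho>)) \<zeta> < \<bar>s\<bar> * (\<rho> / 4)"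
      proof -
        have "dist (of_real s * (a + of_real (3 / 4 * \<rho>))) z = \<bar>s\<bar> * dist (a + of_real (3 / 4 * \<rho>)) \<zeta>"
          unfolding z_eq dist_norm by (simp flip: right_diff_distrib add: norm_mult)
        then show ?thesis using z by simp
      qed
      then have near: "dist (a + of_real (3 / 4 * \<rho>)) \<zeta> < \<rho> / 4"
        using s by (simp add: mult_less_cancel_left_pos)
      have "dist (a + of_real (3 / 4 * \<rho>)) a = 3 / 4 * \<rho>"
        using \<rho> unfolding dist_norm by (simp add: norm_mult)
      then have dist: "\<rho> / 2 \<le> dist \<zeta> a" "dist \<zeta> a \<le> \<rho>"
        using near dist_triangle[of \<zeta> a "a + of_real (3 / 4 * \<rho>)"] dist_triangle[of "a + of_real (3 / 4 * \<rho>)" a \<zeta>]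
        by (simp_all add: dist_commute)
      define f where "f = cmod (poly (flow n (s ^ 3 / 8)) z)"
      define f1 where "f1 = cmod (poly (pderiv (flow n (s ^ 3 / 8))) z)"
      have "f = \<bar>s\<bar> ^ n * cmod (poly ?P \<zeta>)"
        unfolding f_def z_eq poly_flow_scaling by (simp add: norm_mult norm_power)
      also have "\<dots> \<le> \<bar>s\<bar> ^ n * (C * \<rho> ^ m)"
      proof (intro mult_left_mono)
        have "cmod (poly ?P \<zeta>) \<le> C * dist \<zeta> a ^ m" by (rule P_le) (use dist \<rho> in linarith)
        also have "\<dots> \<le> C * \<rho> ^ m" using dist Cc by (intro mult_left_mono power_mono) auto
        finally show "cmod (poly ?P \<zeta>) \<le> C * \<rho> ^ m" .
      qed simp
      also have "\<dots> = C" using \<rho>m by (simp add: mult.left_commute)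
      finally have f_le: "f \<le> C" .
      have "d = \<bar>s\<bar> ^ n * (c * (\<rho> / 2) ^ (m - 1)) * \<rho>"
      proof -
        have "\<rho> ^ (m - 1) * \<rho> = \<rho> ^ m" using m by (cases m) auto
        then have "\<bar>s\<bar> ^ n * (c * (\<rho> / 2) ^ (m - 1)) * \<rho> = d * (\<bar>s\<bar> ^ n * \<rho> ^ m)"
          by (simp add: d_def power_divide)
        then show ?thesis by (simp add: \<rho>m)
      qed
      also have "\<dots> \<le> \<bar>s\<bar> ^ n * cmod (poly (pderiv ?P) \<zeta>) * \<rho>"
      proof (intro mult_left_mono mult_right_mono)
        have "c * (\<rho> / 2) ^ (m - 1) \<le> c * dist \<zeta> a ^ (m - 1)"
          using dist \<rho> Cc by (intro mult_left_mono power_mono) auto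
        also have "\<dots> \<le> cmod (poly (pderiv ?P) \<zeta>)" by (rule P'_ge) (use dist \<rho> in linarith)
        finally show "c * (\<rho> / 2) ^ (m - 1) \<le> cmod (poly (pderiv ?P) \<zeta>)" .
      qed (use \<rho> in auto)
      also have "\<bar>s\<bar> ^ n * cmod (poly (pderiv ?P) \<zeta>) = \<bar>s\<bar> * f1"
        using arg_cong[OF poly_flow_scaling(2)[of s n \<zeta>], of cmod]
        by (simp add: f1_def z_eq norm_mult norm_power)
      finally have f1_ge: "d \<le> f1 * (\<bar>s\<bar> * \<rho>)" by (simp add: mult_ac)
      have "8 * d\<^sup>2 / (1 + C\<^sup>2)\<^sup>2 \<le> 8 * (f1 * (\<bar>s\<bar> * \<rho>))\<^sup>2 / (1 + f\<^sup>2)\<^sup>2"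
        using f1_ge d f_le by (intro frac_le mult_left_mono power_mono add_left_mono) (auto simp: f_def add_pos_nonneg)
      then have "B \<le> 8 * f1\<^sup>2 / (1 + f\<^sup>2)\<^sup>2 * (\<bar>s\<bar> * \<rho>)\<^sup>2"
        by (simp add: B_def power_mult_distrib)
      also have "8 * f1\<^sup>2 / (1 + f\<^sup>2)\<^sup>2 = \<bar>?Q z\<bar>"
        by (simp add: poly_profile.Q_def f_def f1_def abs_mult)
      finally show ?thesis
        unfolding b_def using s \<rho> by (subst pos_divide_le_eq) auto
    qed
    then have "sqrt pi * (\<bar>s\<bar> * \<rho> / 4) * b \<le> L2_norm_plane ?Q"
      using B \<rho> n
      by (intro L2_norm_plane_ge[where c = "of_real s * (a + of_real (3 / 4 * \<rho>))"] poly_profile.square_integrable_Q)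
        (auto simp: b_def)
    also have "sqrt pi * (\<bar>s\<bar> * \<rho> / 4) * b = sqrt pi / 4 * B * (1 / (\<bar>s\<bar> * \<rho>))"
      using s \<rho> by (simp add: b_def power2_eq_square)
    also have "1 / (\<bar>s\<bar> * \<rho>) = \<bar>s\<bar> powr (\<beta> - 1)"
      using s by (simp add: \<rho>_def powr_minus powr_diff field_simps)
    finally show ?thesis .
  qed
  \<comment> \<open>Chosen so that \<open>S powr (- \<beta>)\<close> is \<open>\<delta> / 2\<close>,
    which keeps the annulus inside the neighbourhood of the local bounds.\<close>
  define S where "S = (\<delta> / 2) powr (- 1 / \<beta>)"
  show thesis
  proof (rule that[of "sqrt pi / 4 * B" "\<beta> - 1" S])
    show "S > 0" using Cc by (simp add: S_def)
    fix s :: real assume s: "\<bar>s\<bar> \<ge> S"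
    have pos: "\<bar>s\<bar> > 0" using s \<open>S > 0\<close> by linarith
    have "\<bar>s\<bar> powr (- \<beta>) \<le> S powr (- \<beta>)"
      using s \<open>S > 0\<close> \<beta> by (intro powr_mono2') auto
    also have "\<dots> = \<delta> / 2" using \<beta> Cc by (simp add: S_def powr_powr)
    also have "\<dots> < \<delta>" using Cc by simp
    finally show "sqrt pi / 4 * B * \<bar>s\<bar> powr (\<beta> - 1) \<le> L2_norm_plane (poly_profile.Q (flow n (s ^ 3 / 8)))"
      by (rule key[OF pos])
  qed (use B \<beta> in auto)
qed

lemma filterlim_powr_at_top:
  assumes "\<alpha> > 0"
  shows "filterlim (\<lambda>x::real. x powr \<alpha>) at_top at_top"
proof -
  have "filterlim (\<lambda>x. exp (\<alpha> * ln x)) at_top at_top"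
    by (intro filterlim_compose[OF exp_at_top] filterlim_tendsto_pos_mult_at_top[OF tendsto_const assms ln_at_top])
  moreover have "\<forall>\<^sub>F x::real in at_top. exp (\<alpha> * ln x) = x powr \<alpha>"
    using eventually_gt_at_top[of 0] by eventually_elim (simp add: powr_def)
  ultimately show ?thesis by (simp add: filterlim_cong)
qed

text \<open>The substitution s = \<open>root 3 (8 * t)\<close> is real for either sign of t, so a
  general filter with |t| tending to infinity covers both time directions.\<close>

lemma L2_norm_flow_at_top:
  assumes n: "n \<ge> 3" and F: "filterlim (\<lambda>t. \<bar>t\<bar>) at_top F"
  shows "filterlim (\<lambda>t. L2_norm_plane (poly_profile.Q (flow n t))) at_top F"
proof -
  obtain \<kappa> \<alpha> S where pos: "\<kappa> > 0" "\<alpha> > 0" "S > 0"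
    and ge: "\<And>s. \<bar>s\<bar> \<ge> S \<Longrightarrow> \<kappa> * \<bar>s\<bar> powr \<alpha> \<le> L2_norm_plane (poly_profile.Q (flow n (s ^ 3 / 8)))"
    by (rule L2_norm_flow_ge[OF n]) blast
  have large: "\<forall>\<^sub>F t in F. Z \<le> \<bar>root 3 (8 * t)\<bar>" if "Z \<ge> 0" for Z
  proof -
    have "\<forall>\<^sub>F t in F. Z ^ 3 / 8 \<le> \<bar>t\<bar>" using F unfolding filterlim_at_top by blast
    then show ?thesis
    proof eventually_elim
      case (elim t)
      have "\<bar>root 3 (8 * t)\<bar> ^ 3 = 8 * \<bar>t\<bar>"
        by (simp flip: power_abs add: odd_real_root_pow abs_mult)
      then have "Z ^ 3 \<le> \<bar>root 3 (8 * t)\<bar> ^ 3" using elim by simp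
      then show ?case by (rule power_le_imp_le_base[of _ 2, simplified]) simp
    qed
  qed
  have "filterlim (\<lambda>t. \<kappa> * \<bar>root 3 (8 * t)\<bar> powr \<alpha>) at_top F"
  proof -
    have "filterlim (\<lambda>t. \<bar>root 3 (8 * t)\<bar>) at_top F"
      unfolding filterlim_at_top_ge[where c = 0] using large by blast
    then show ?thesis
      using pos by (intro filterlim_tendsto_pos_mult_at_top[OF tendsto_const]
          filterlim_compose[OF filterlim_powr_at_top])
  qed
  then show ?thesis
  proof (rule filterlim_at_top_mono)
    show "\<forall>\<^sub>F t in F. \<kappa> * \<bar>root 3 (8 * t)\<bar> powr \<alpha> \<le> L2_norm_plane (poly_profile.Q (flow n t))"
      using large[OF less_imp_le[OF pos(3)]]
    proof eventually_elim
      case (elim t)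
      then show ?case using ge[of "root 3 (8 * t)"] by (simp add: odd_real_root_pow)
    qed
  qed
qed

theorem theorem1p3:
  fixes n :: nat
  assumes "n \<ge> 3"
  shows "\<exists>(Q :: real \<Rightarrow> complex \<Rightarrow> real) (w :: real \<Rightarrow> complex \<Rightarrow> complex).
    NV_solution Q w \<and>
    (\<forall>t z. Q t z \<le> 0) \<and>
    (\<forall>t. (\<lambda>z. Q t z) \<in> \<Theta>[at_infinity](\<lambda>z. 1 / cmod z ^ (2 * (n + 1)))) \<and>
    (\<forall>t. has_bochner_integral lborel (Q t) (- 8 * real n * pi)) \<and>
    (\<forall>t. square_integrable (Q t)) \<and>
    filterlim (\<lambda>t. L2_norm_plane (Q t)) at_top at_top \<and>
    filterlim (\<lambda>t. L2_norm_plane (Q t)) at_top at_bot"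
proof (intro exI conjI allI)
  have n: "n \<ge> 2" "degree (flow n t) \<ge> 2" for t using assms by simp_all
  let ?Q = "\<lambda>t. poly_profile.Q (flow n t)" and ?W = "\<lambda>t. poly_profile.W (flow n t)"
  show "NV_solution ?Q ?W" by (rule NV_solution_flow[OF n(1)])
  fix t
  show "?Q t z \<le> 0" for z by (simp add: poly_profile.Q_def)
  show "(\<lambda>z. ?Q t z) \<in> \<Theta>[at_infinity](\<lambda>z. 1 / cmod z ^ (2 * (n + 1)))"
    using poly_profile.Q_bigtheta[OF n(2)[of t]] by simp
  show "has_bochner_integral lborel (?Q t) (- 8 * real n * pi)"
    using poly_profile.has_bochner_integral_Q[OF n(2)[of t]] by simp
  show "square_integrable (?Q t)" by (rule poly_profile.square_integrable_Q[OF n(2)])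
  show "filterlim (\<lambda>t. L2_norm_plane (?Q t)) at_top at_top"
    by (rule L2_norm_flow_at_top[OF assms filterlim_abs_real])
  have "filterlim (\<lambda>t::real. \<bar>- t\<bar>) at_top at_bot"
    by (rule filterlim_compose[OF filterlim_abs_real filterlim_uminus_at_top_at_bot])
  then show "filterlim (\<lambda>t. L2_norm_plane (?Q t)) at_top at_bot"
    by (intro L2_norm_flow_at_top[OF assms]) simp
qed

end
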